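(* Let $0<\varepsilon<1$. There is a random-order contention resolution scheme (RCRS) for vertex arrivals, with running time polynomial in the input $G,(x_e)_{e\in E}$ and $1/\varepsilon$, such that for every odd integer $g\ge 3$ or $g=\infty$, every graph $G=(V,E)$ of odd-girth $g$, and every fractional matching $\bm{x}$ of $G$, the RCRS is $(1-\varepsilon)^2\alpha_g$-selectable, i.e. $\mathbb{P}[e\in\mathcal{M}]\ge(1-\varepsilon)^2\alpha_g\, x_e$ for every $e\in E$, where $\mathcal{M}$ is the matching output.
   Context: Graph $G=(V,E)$; $N(v)$ denotes the neighbours of $v$. A fractional matching is $\bm{x}=(x_e)_{e\in E}\in[0,1]^E$ with $\sum_{e\ni v}x_e\le 1$ for all $v\in V$. Random-order vertex arrival model: independently for each $v\in V$, draw $F_v\in N(v)\cup\{\perp\}$ with $\mathbb{P}[F_v=u]=x_{u,v}$ for $u\in N(v)$ and $\mathbb{P}[F_v=\perp]=1-\sum_{u\in N(v)}x_{u,v}$, and draw an arrival time $Y_v$ uniformly from $[0,1]$, all independent. An edge $(u,v)$ is active if ($F_v=u$ and $Y_u<Y_v$) or ($F_u=v$ and $Y_v<Y_u$); thus $\mathbb{P}[e \text{ active}]=x_e$ and each arriving vertex has at most one active edge to previously arrived vertices. An RCRS knows $G$ and $\bm{x}$, processes vertices in increasing order of arrival time, and when $v$ arrives it learns which edge (if any) between $v$ and previously arrived vertices is active; it may then (possibly using randomness) irrevocably add that active edge to its current matching $\mathcal{M}$, provided $\mathcal{M}$ stays a matching. Only active edges may be selected. The RCRS is $\alpha$-selectable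 if $\mathbb{P}[e\in\mathcal{M}]\ge \alpha x_e$ for all $e\in E$. The odd-girth of $G$ is the length of its shortest odd cycle, where edges with $x_e=0$ are disregarded; it is $\infty$ if there is no odd cycle. For odd $g\ge3$ let $\Gamma(s,z)=\int_z^\infty \zeta^{s-1}\mathsf{e}^{-\zeta}\,d\zeta$ (upper incomplete gamma function, $z\in\mathbb{R}$), define $c(0)=1$ and for $y\in(0,1]$, $c(y)=\frac{1}{2y}-\frac{\mathsf{e}^{-2y}}{2y}-\frac{\mathsf{e}^{-2y}(\Gamma(g,-2y)-\Gamma(g,0))}{2^{g-1}y(g-1)!}$, and set $\alpha_g:=2\int_0^1 c(y)\,y\,dy$; set $\alpha_\infty:=(1+\mathsf{e}^{-2})/2$. (E.g. $\alpha_3=5/12+1/(4\mathsf{e}^2)$, $\alpha_5=121/240+7/(16\mathsf{e}^2)$.) *)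

theory Defs
  imports "HOL-Probability.Probability" "HOL-Library.Log_Nat" "HOL-Library.Extended_Nat"
begin

(* A graph has vertex set {..<n} and edge set E, whose elements are two-element sets. *)

definition graph :: "nat \<Rightarrow> nat set set \<Rightarrow> bool" where
  "graph n E \<longleftrightarrow> (\<forall>e\<in>E. \<exists>u v. u < n \<and> v < n \<and> u \<noteq> v \<and> e = {u, v})"

definition neighbours :: "nat set set \<Rightarrow> nat \<Rightarrow> nat set" where
  "neighbours E v = {u. {u, v} \<in> E}"

definition matching :: "nat set set \<Rightarrow> bool" where
  "matching M \<longleftrightarrow> pairwise disjnt M"

definition fractional_matching :: "nat \<Rightarrow> nat set set \<Rightarrow> (nat set \<Rightarrow> real) \<Rightarrow> bool" where
  "fractional_matching n E x \<longleftrightarrow>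
     (\<forall>e\<in>E. 0 \<le> x e \<and> x e \<le> 1) \<and> (\<forall>v<n. (\<Sum>e\<in>{e\<in>E. v \<in> e}. x e) \<le> 1)"

definition is_cycle :: "nat set set \<Rightarrow> nat list \<Rightarrow> bool" where
  "is_cycle E p \<longleftrightarrow> 3 \<le> length p \<and> distinct p \<and>
     (\<forall>i<length p. {p ! i, p ! (Suc i mod length p)} \<in> E)"

(* The infimum of the empty set in enat is \<infinity>. *)
definition odd_girth :: "nat set set \<Rightarrow> (nat set \<Rightarrow> real) \<Rightarrow> enat" where
  "odd_girth E x = Inf {enat (length p) |p. is_cycle {e\<in>E. x e \<noteq> 0} p \<and> odd (length p)}"

(* Only integer s >= 1 is needed; the integral then also makes sense for negative z. *)
definition upper_Gamma :: "nat \<Rightarrow> real \<Rightarrow> real" where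
  "upper_Gamma s z = integral {z..} (\<lambda>t. t ^ (s - 1) * exp (- t))"

definition c_fun :: "nat \<Rightarrow> real \<Rightarrow> real" where
  "c_fun g y =
     (if y = 0 then 1
      else 1 / (2 * y) - exp (- 2 * y) / (2 * y)
           - exp (- 2 * y) * (upper_Gamma g (- 2 * y) - upper_Gamma g 0)
             / (2 ^ (g - 1) * y * fact (g - 1)))"

definition alpha :: "enat \<Rightarrow> real" where
  "alpha g = (case g of enat k \<Rightarrow> 2 * integral {0..1} (\<lambda>y. c_fun k y * y)
                      | \<infinity> \<Rightarrow> (1 + exp (- 2)) / 2)"


(* Random-order vertex arrivals. F v = None stands for F_v = \<bottom>. *)

definition choice_pmf :: "nat set set \<Rightarrow> (nat set \<Rightarrow> real) \<Rightarrow> nat \<Rightarrow> nat option pmf" where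
  "choice_pmf E x v = embed_pmf (\<lambda>r. case r of
       Some u \<Rightarrow> if u \<in> neighbours E v then x {u, v} else 0
     | None \<Rightarrow> 1 - (\<Sum>u\<in>neighbours E v. x {u, v}))"

lemma pmf_choice_pmf:
  assumes "graph n E" and "fractional_matching n E x" and "v < n"
  shows "pmf (choice_pmf E x v) (Some u) = (if u \<in> neighbours E v then x {u, v} else 0)"
    and "pmf (choice_pmf E x v) None = 1 - (\<Sum>u\<in>neighbours E v. x {u, v})"
proof -
  let ?N = "neighbours E v"
  let ?S = "\<Sum>u\<in>?N. x {u, v}"
  let ?f = "\<lambda>r. case r of Some u \<Rightarrow> if u \<in> ?N then x {u, v} else 0 | None \<Rightarrow> 1 - ?S"
  have "?N \<subseteq> {..<n}"
    using assms(1) by (fastforce simp: neighbours_def graph_def doubleton_eq_iff)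
  then have fin: "finite ?N"
    by (rule finite_subset) simp
  have nonneg: "0 \<le> x {u, v}" if "u \<in> ?N" for u
    using assms(2) that by (auto simp: neighbours_def fractional_matching_def)
  have "bij_betw (\<lambda>u. {u, v}) ?N {e\<in>E. v \<in> e}"
  proof (rule bij_betw_imageI)
    show "inj_on (\<lambda>u. {u, v}) ?N"
      by (auto simp: inj_on_def doubleton_eq_iff)
    show "(\<lambda>u. {u, v}) ` ?N = {e\<in>E. v \<in> e}"
    proof
      show "{e\<in>E. v \<in> e} \<subseteq> (\<lambda>u. {u, v}) ` ?N"
      proof
        fix e assume e: "e \<in> {e\<in>E. v \<in> e}"
        then obtain a b where "e = {a, b}"
          using assms(1) by (auto simp: graph_def)
        with e obtain u where "e = {u, v}" by auto
        with e show "e \<in> (\<lambda>u. {u, v}) ` ?N" by (auto simp: neighbours_def)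
      qed
    qed (auto simp: neighbours_def)
  qed
  then have "?S = (\<Sum>e\<in>{e\<in>E. v \<in> e}. x e)"
    by (rule sum.reindex_bij_betw)
  then have le: "?S \<le> 1"
    using assms(2,3) by (simp add: fractional_matching_def)
  have f_nonneg: "0 \<le> ?f r" for r
    using nonneg le by (auto split: option.splits)
  have "(\<integral>\<^sup>+ r. ennreal (?f r) \<partial>count_space UNIV) =
      (\<Sum>r\<in>insert None (Some ` ?N). ennreal (?f r))"
    by (rule nn_integral_count_space'[OF _ _ subset_UNIV])
      (use fin in \<open>auto split: option.splits\<close>)
  also have "\<dots> = ennreal (\<Sum>r\<in>insert None (Some ` ?N). ?f r)"
    by (rule sum_ennreal) (use f_nonneg in blast)
  also have "(\<Sum>r\<in>insert None (Some ` ?N). ?f r) = 1"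
    using fin by (simp add: sum.reindex)
  finally have "(\<integral>\<^sup>+ r. ennreal (?f r) \<partial>count_space UNIV) = 1"
    by simp
  then have "pmf (choice_pmf E x v) r = ?f r" for r
    unfolding choice_pmf_def by (intro pmf_embed_pmf f_nonneg)
  then show "pmf (choice_pmf E x v) (Some u) = (if u \<in> ?N then x {u, v} else 0)"
    and "pmf (choice_pmf E x v) None = 1 - ?S"
    by simp_all
qed

definition uniform01 :: "real measure" where
  "uniform01 = uniform_measure lborel {0..1}"

(* The third component is the internal randomness of the scheme: an infinite sequence of
   independent uniform samples. *)
definition arrival_space ::
  "nat \<Rightarrow> nat set set \<Rightarrow> (nat set \<Rightarrow> real) \<Rightarrow>
   ((nat \<Rightarrow> nat option) \<times> (nat \<Rightarrow> real) \<times> real stream) measure" where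
  "arrival_space n E x =
     (\<Pi>\<^sub>M v\<in>{..<n}. measure_pmf (choice_pmf E x v)) \<Otimes>\<^sub>M
     ((\<Pi>\<^sub>M v\<in>{..<n}. uniform01) \<Otimes>\<^sub>M stream_space uniform01)"

definition active :: "(nat \<Rightarrow> nat option) \<Rightarrow> (nat \<Rightarrow> real) \<Rightarrow> nat \<Rightarrow> nat \<Rightarrow> bool" where
  "active F Y u v \<longleftrightarrow> F v = Some u \<and> Y u < Y v \<or> F u = Some v \<and> Y v < Y u"

(* The information revealed when v arrives: the earlier vertex joined to v by an active edge. *)
definition learned :: "(nat \<Rightarrow> nat option) \<Rightarrow> (nat \<Rightarrow> real) \<Rightarrow> nat \<Rightarrow> nat option" where
  "learned F Y v =
     (case F v of None \<Rightarrow> None | Some u \<Rightarrow> if Y u < Y v then Some u else None)"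

lemma learned_iff: "learned F Y v = Some u \<longleftrightarrow> Y u < Y v \<and> active F Y u v"
  by (auto simp: learned_def active_def split: option.splits)


(* The model of computation is a random access machine with natural-number and real cells.
   Cells are organised in arrays, addressed by a name and a list of indices.
   Real numbers can be added, subtracted, compared, and multiplied or divided by naturals, but not
   multiplied with each other, and storing a natural number costs its bit length. Hence, within
   t steps started from rationals of L bits (and leaving aside uniform samples), every cell holds
   a number whose bit length is polynomial in t and L: polynomially many steps cannot produce
   exponentially long numbers, and unit cost for real operations is not an abuse. The only
   constants of a program are natural numbers, so that no information can be hidden in real
   constants. *)

record state =
  nat_mem :: "string \<Rightarrow> nat list \<Rightarrow> nat"
  real_mem :: "string \<Rightarrow> nat list \<Rightarrow> real"
  samples :: "real stream"

datatype nexp =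
    NConst nat
  | NCell string "nexp list"
  | NAdd nexp nexp
  | NSub nexp nexp
  | NMul nexp nexp
  | NDiv nexp nexp

datatype rexp =
    RNat nexp
  | RCell string "nexp list"
  | RAdd rexp rexp
  | RSub rexp rexp
  | RScale nexp rexp
  | RDiv rexp nexp

datatype bexp =
    NLess nexp nexp
  | RLess rexp rexp
  | BNot bexp
  | BAnd bexp bexp

datatype com =
    Skip
  | NAssign string "nexp list" nexp
  | RAssign string "nexp list" rexp
  | Draw string "nexp list"
  | Seq com com
  | If bexp com com
  | While bexp com

fun nval :: "nexp \<Rightarrow> state \<Rightarrow> nat" where
  "nval (NConst k) s = k"
| "nval (NCell a js) s = nat_mem s a (map (\<lambda>j. nval j s) js)"
| "nval (NAdd i j) s = nval i s + nval j s"
| "nval (NSub i j) s = nval i s - nval j s"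
| "nval (NMul i j) s = nval i s * nval j s"
| "nval (NDiv i j) s = nval i s div nval j s"

fun rval :: "rexp \<Rightarrow> state \<Rightarrow> real" where
  "rval (RNat i) s = real (nval i s)"
| "rval (RCell a js) s = real_mem s a (map (\<lambda>j. nval j s) js)"
| "rval (RAdd p q) s = rval p s + rval q s"
| "rval (RSub p q) s = rval p s - rval q s"
| "rval (RScale i p) s = real (nval i s) * rval p s"
| "rval (RDiv p i) s = rval p s / real (nval i s)"

fun bval :: "bexp \<Rightarrow> state \<Rightarrow> bool" where
  "bval (NLess i j) s \<longleftrightarrow> nval i s < nval j s"
| "bval (RLess p q) s \<longleftrightarrow> rval p s < rval q s"
| "bval (BNot b) s \<longleftrightarrow> \<not> bval b s"
| "bval (BAnd b b') s \<longleftrightarrow> bval b s \<and> bval b' s"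

definition store_at :: "(string \<Rightarrow> nat list \<Rightarrow> 'a) \<Rightarrow> string \<Rightarrow> nat list \<Rightarrow> 'a \<Rightarrow> (string \<Rightarrow> nat list \<Rightarrow> 'a)" where
  "store_at m a js z = m(a := (m a)(js := z))"

definition set_nat :: "string \<Rightarrow> nat list \<Rightarrow> nat \<Rightarrow> state \<Rightarrow> state" where
  "set_nat a js k s = s\<lparr>nat_mem := store_at (nat_mem s) a js k\<rparr>"

definition set_real :: "string \<Rightarrow> nat list \<Rightarrow> real \<Rightarrow> state \<Rightarrow> state" where
  "set_real a js z s = s\<lparr>real_mem := store_at (real_mem s) a js z\<rparr>"

(* exec c s t s': started in s, the command c terminates in s' after t steps. *)
inductive exec :: "com \<Rightarrow> state \<Rightarrow> nat \<Rightarrow> state \<Rightarrow> bool" where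
  Skip: "exec Skip s 1 s"
| NAssign: "exec (NAssign a js i) s (1 + floorlog 2 (nval i s))
              (set_nat a (map (\<lambda>j. nval j s) js) (nval i s) s)"
| RAssign: "exec (RAssign a js p) s 1 (set_real a (map (\<lambda>j. nval j s) js) (rval p s) s)"
| Draw: "exec (Draw a js) s 1
           ((set_real a (map (\<lambda>j. nval j s) js) (shd (samples s)) s)\<lparr>samples := stl (samples s)\<rparr>)"
| Seq: "exec c s t s' \<Longrightarrow> exec d s' t' s'' \<Longrightarrow> exec (Seq c d) s (t + t') s''"
| IfTrue: "bval b s \<Longrightarrow> exec c s t s' \<Longrightarrow> exec (If b c d) s (1 + t) s'"
| IfFalse: "\<not> bval b s \<Longrightarrow> exec d s t s' \<Longrightarrow> exec (If b c d) s (1 + t) s'"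
| WhileFalse: "\<not> bval b s \<Longrightarrow> exec (While b c) s 1 s"
| WhileTrue: "bval b s \<Longrightarrow> exec c s t s' \<Longrightarrow> exec (While b c) s' t' s'' \<Longrightarrow>
    exec (While b c) s (1 + t + t') s''"

inductive_cases exec_SkipE: "exec Skip s t s'"
inductive_cases exec_NAssignE: "exec (NAssign a js i) s t s'"
inductive_cases exec_RAssignE: "exec (RAssign a js p) s t s'"
inductive_cases exec_DrawE: "exec (Draw a js) s t s'"
inductive_cases exec_SeqE: "exec (Seq c d) s t s'"
inductive_cases exec_IfE: "exec (If b c d) s t s'"
inductive_cases exec_WhileE: "exec (While b c) s t s'"

lemma exec_deterministic:
  "exec c s t s' \<Longrightarrow> exec c s u r \<Longrightarrow> t = u \<and> s' = r"
proof (induction arbitrary: u r rule: exec.induct)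
  case (Seq c s t s' d t' s'')
  from Seq.prems show ?case by (rule exec_SeqE) (metis Seq.IH)
next
  case (IfTrue b s c t s' d)
  from IfTrue.prems show ?case by (rule exec_IfE) (use IfTrue.hyps(1) IfTrue.IH in simp_all)
next
  case (IfFalse b s d t s' c)
  from IfFalse.prems show ?case by (rule exec_IfE) (use IfFalse.hyps(1) IfFalse.IH in simp_all)
next
  case (WhileFalse b s c)
  from WhileFalse.prems show ?case by (rule exec_WhileE) (use WhileFalse.hyps(1) in simp_all)
next
  case (WhileTrue b s c t s' t' s'')
  from WhileTrue.prems show ?case 
    by (rule exec_WhileE)
      (use WhileTrue.hyps(1) in simp, metis WhileTrue.IH add_Suc plus_1_eq_Suc)
qed (erule exec_SkipE exec_NAssignE exec_RAssignE exec_DrawE; simp)+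


(* A scheme consists of a program that is run on G, x and \<epsilon> before the first arrival and a
   program that is run at each arrival; both work on the same memory. *)
datatype rcrs = RCRS (preprocess: com) (on_arrival: com)

definition initial_state ::
  "nat \<Rightarrow> nat set set \<Rightarrow> (nat set \<Rightarrow> real) \<Rightarrow> real \<Rightarrow> real stream \<Rightarrow> state" where
  "initial_state n E x \<epsilon> \<omega> =
     \<lparr>nat_mem = (\<lambda>a js.
        if a = ''n'' \<and> js = [] then n
        else if a = ''E'' \<and> (\<exists>u v. js = [u, v] \<and> {u, v} \<in> E) then 1
        else 0),
      real_mem = (\<lambda>a js.
        if a = ''eps'' \<and> js = [] then \<epsilon>
        else if a = ''x'' \<and> (\<exists>u v. js = [u, v] \<and> {u, v} \<in> E) then x {js ! 0, js ! 1}
        else 0),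
      samples = \<omega>\<rparr>"

(* When v arrives, cell ''v'' receives v, and cell ''partner'' receives u + 1 if the edge {u, v}
   to an earlier vertex u is active and 0 if there is no such edge. *)
definition present :: "nat \<Rightarrow> nat option \<Rightarrow> state \<Rightarrow> state" where
  "present v p s =
     set_nat ''partner'' [] (case p of None \<Rightarrow> 0 | Some u \<Rightarrow> Suc u) (set_nat ''v'' [] v s)"

(* The program for v accepts the active edge by leaving a nonzero value in cell ''accept''. *)
definition select :: "nat \<Rightarrow> nat option \<Rightarrow> state \<Rightarrow> nat set set \<Rightarrow> nat set set" where
  "select v p s M =
     (case p of
        None \<Rightarrow> M
      | Some u \<Rightarrow>
          if nat_mem s ''accept'' [] \<noteq> 0 \<and> matching (insert {u, v} M) then insert {u, v} M else M)"

(* arrivals c p vs s M t M': processing the vertices vs in this order, starting with memory s and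
   matching M, takes t steps in total and results in the matching M'. *)
inductive arrivals ::
  "com \<Rightarrow> (nat \<Rightarrow> nat option) \<Rightarrow> nat list \<Rightarrow> state \<Rightarrow> nat set set \<Rightarrow> nat \<Rightarrow> nat set set \<Rightarrow> bool"
  for c :: com and p :: "nat \<Rightarrow> nat option" where
  Nil: "arrivals c p [] s M 0 M"
| Cons: "exec c (present v (p v) s) t s' \<Longrightarrow>
    arrivals c p vs s' (select v (p v) s' M) t' M' \<Longrightarrow>
    arrivals c p (v # vs) s M (t + t') M'"

inductive_cases arrivals_NilE: "arrivals c p [] s M t M'"
inductive_cases arrivals_ConsE: "arrivals c p (v # vs) s M t M'"

lemma arrivals_deterministic:
  "arrivals c p vs s M t M' \<Longrightarrow> arrivals c p vs s M u N \<Longrightarrow> t = u \<and> M' = N"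
proof (induction arbitrary: u N rule: arrivals.induct)
  case (Nil s M)
  then show ?case by (auto elim: arrivals_NilE)
next
  case (Cons v s t s' vs M t' M')
  from Cons.prems show ?case
    by (rule arrivals_ConsE) (metis Cons.IH exec_deterministic[OF Cons.hyps(1)])
qed

lemma arrivals_matching: "arrivals c p vs s M t M' \<Longrightarrow> matching M \<Longrightarrow> matching M'"
  by (induction rule: arrivals.induct) (auto simp: select_def split: option.splits if_splits)

(* rcrs_run S n E x \<epsilon> F Y \<omega> t M: on the given outcome of the random choices, the scheme S
   takes t steps in total and outputs M. *)
definition rcrs_run ::
  "rcrs \<Rightarrow> nat \<Rightarrow> nat set set \<Rightarrow> (nat set \<Rightarrow> real) \<Rightarrow> real \<Rightarrow>
   (nat \<Rightarrow> nat option) \<Rightarrow> (nat \<Rightarrow> real) \<Rightarrow> real stream \<Rightarrow> nat \<Rightarrow> nat set set \<Rightarrow> bool" where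
  "rcrs_run S n E x \<epsilon> F Y \<omega> t M \<longleftrightarrow>
     (\<exists>t\<^sub>1 t\<^sub>2 s. exec (preprocess S) (initial_state n E x \<epsilon> \<omega>) t\<^sub>1 s \<and>
        arrivals (on_arrival S) (learned F Y) (sort_key Y [0..<n]) s {} t\<^sub>2 M \<and>
        t = t\<^sub>1 + t\<^sub>2)"

lemma rcrs_run_deterministic:
  "rcrs_run S n E x \<epsilon> F Y \<omega> t M \<Longrightarrow> rcrs_run S n E x \<epsilon> F Y \<omega> u N \<Longrightarrow> t = u \<and> M = N"
  unfolding rcrs_run_def using exec_deterministic arrivals_deterministic by metis

lemma rcrs_run_matching: "rcrs_run S n E x \<epsilon> F Y \<omega> t M \<Longrightarrow> matching M"
  unfolding rcrs_run_def by (elim exE conjE, erule arrivals_matching) (simp add: matching_def)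

(* S is \<alpha>-selectable on the input G, x, \<epsilon>. *)
definition selectable ::
  "rcrs \<Rightarrow> nat \<Rightarrow> nat set set \<Rightarrow> (nat set \<Rightarrow> real) \<Rightarrow> real \<Rightarrow> real \<Rightarrow> bool" where
  "selectable S n E x \<epsilon> \<alpha> \<longleftrightarrow>
     (\<forall>e\<in>E. \<P>((F, Y, \<omega>) in arrival_space n E x.
        \<exists>t M. rcrs_run S n E x \<epsilon> F Y \<omega> t M \<and> e \<in> M) \<ge> \<alpha> * x e)"

(* Worst-case bound, over all outcomes of the random choices. As the input consists of
   O((n + |E| + 1)\<^sup>2) numbers and 1/\<epsilon> > 1, bounds of the form a * (n + |E| + 1/\<epsilon>) ^ k
   majorise all polynomials in the input size and 1/\<epsilon>. *)
definition polynomial_time :: "rcrs \<Rightarrow> bool" where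
  "polynomial_time S \<longleftrightarrow>
     (\<exists>a k :: nat. \<forall>\<epsilon> n E x F Y \<omega>.
        0 < \<epsilon> \<and> \<epsilon> < 1 \<and> graph n E \<and> fractional_matching n E x \<and>
        (\<forall>v<n. \<forall>u. F v = Some u \<longrightarrow> u \<in> neighbours E v) \<and>
        (\<forall>v<n. Y v \<in> {0..1}) \<and> \<omega> \<in> streams {0..1} \<longrightarrow>
        (\<exists>t M. rcrs_run S n E x \<epsilon> F Y \<omega> t M \<and>
           real t \<le> real a * (real n + real (card E) + 1 / \<epsilon>) ^ k))"

end

theory Submission
  imports Defs
begin

text \<open>
  Time is divided into \<open>T\<close> phases. A vertex \<open>v\<close> that arrives in phase \<open>k\<close> with an active edge to a
  free vertex \<open>u\<close> accepts this edge with a probability inversely proportional to the probability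
  that, if \<open>v\<close> is left out, \<open>u\<close> has arrived before phase \<open>k\<close> and is still free. Hence all edges \<open>e\<close> are
  selected in phase \<open>k\<close> with the same probability per unit of \<open>x e\<close>. The scheme estimates these
  probabilities by simulating itself on fresh samples; conditioned on the estimates being accurate,
  their errors cost a factor close to 1.

  Leaving out \<open>v\<close> changes the state of \<open>u\<close> only along an alternating path of vertices with
  decreasing arrival times. If \<open>u\<close> is free only because \<open>v\<close> is present, this path and the edge \<open>{u, v}\<close>
  form an odd cycle, which has at least \<open>g\<close> vertices; this happens with probability
  at most \<open>2 y\<^sup>g / g!\<close> at time \<open>y\<close>. So edges can be selected up to time \<open>y\<close> with probability \<open>2 * h y * x e\<close>,
  where \<open>h' y = y - 2 * h y - 2 y\<^sup>g / g!\<close> and \<open>h 0 = 0\<close>; this solution satisfies \<open>2 * h 1 = alpha g\<close>.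

  The program does not see the arrival times. It draws \<open>n\<close> phases in advance and assigns them in
  increasing order to the arriving vertices; as the order of arrival is uniformly distributed, this
  has the same effect as drawing the phases of the vertices independently.
\<close>

section \<open>Samplers\<close>

text \<open>When v arrives, the process so far has not met v. So the chance of finding u free is a
  probability in the process without v, it is independent of the choice and coin of v, and selection
  probabilities factorise (\<open>prob_sel\<close>). The rates at which edges are selected, however,
  are known in the process with v: there u is busy with probability at most twice their sum,
  whatever the graph, because the rates are equal per unit of weight and the weights at u sum to at
  most 1. Odd cycles are the price of comparing the two processes. The correct acceptance
  probabilities of a phase depend on those of all earlier phases, so the estimates are made phase by
  phase, each under the thresholds already fixed. All errors of rates are additive, of order 1/T,
  h/R and n^2/T; since \<open>alpha g\<close> is at least 1/3, they fit into one factor 1 -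
  \<epsilon>, and the chance of inaccurate tables is the other. Program and probability meet in
  samplers: a sampler is the deterministic function of the stream that the program computes, and
  \<open>realises\<close> supplies its law.\<close>

type_synonym 'a sampler = "real stream \<Rightarrow> 'a \<times> real stream"

abbreviation sample_space :: "real stream measure" where
  "sample_space \<equiv> stream_space uniform01"

interpretation uniform01: prob_space uniform01
  unfolding uniform01_def by (rule prob_space_uniform_measure) simp_all

interpretation sample_space: prob_space sample_space
  by (rule uniform01.prob_space_stream_space)

lemma space_uniform01 [simp]: "space uniform01 = UNIV"
  and sets_uniform01 [simp, measurable_cong]: "sets uniform01 = sets borel"
  by (simp_all add: uniform01_def)

lemma space_sample_space [simp]: "space sample_space = UNIV"
  by (simp add: space_stream_space streams_UNIV)

lemma emeasure_uniform01:
  "A \<in> sets borel \<Longrightarrow> emeasure uniform01 A = emeasure lborel ({0..1} \<inter> A)"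
  unfolding uniform01_def by (subst emeasure_uniform_measure) (auto simp: divide_ennreal_def)

lemma AE_uniform01: "AE t in uniform01. 0 < t \<and> t < 1"
proof -
  have "emeasure uniform01 {t. \<not> (0 < t \<and> t < 1)} = emeasure lborel ({0..1} \<inter> {t. \<not> (0 < t \<and> t < (1::real))})"
    by (rule emeasure_uniform01) measurable
  also have "{0..1} \<inter> {t. \<not> (0 < t \<and> t < (1::real))} = {0, 1}" by auto
  also have "emeasure lborel {0, 1::real} = 0" by (rule emeasure_lborel_countable) simp
  finally show ?thesis by (subst AE_iff_measurable[OF _ refl]) (auto simp: )
qed

text \<open>Agreement on the open interval suffices because its complement is null; the outcome sets
  of a sampler can thus be computed without regard to the endpoints.\<close>

lemma emeasure_uniform01_Ico:
  assumes "0 \<le> a" "a \<le> b" "b \<le> 1" "A \<in> sets borel"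
    and "\<And>t. 0 < t \<Longrightarrow> t < 1 \<Longrightarrow> t \<in> A \<longleftrightarrow> a \<le> t \<and> t < b"
  shows "emeasure uniform01 A = ennreal (b - a)"
proof -
  have "emeasure uniform01 A = emeasure uniform01 {a..<b}"
    by (rule emeasure_eq_AE) (use AE_uniform01 assms in auto)
  also have "\<dots> = emeasure lborel ({0..1} \<inter> {a..<b})" by (rule emeasure_uniform01) simp
  also have "{0..1} \<inter> {a..<b} = {a..<b}" using assms by auto
  finally show ?thesis using assms by simp
qed

definition s_ret :: "'a \<Rightarrow> 'a sampler" where
  "s_ret a = (\<lambda>\<omega>. (a, \<omega>))"

definition s_bind :: "'a sampler \<Rightarrow> ('a \<Rightarrow> 'b sampler) \<Rightarrow> 'b sampler" where
  "s_bind f g = (\<lambda>\<omega>. g (fst (f \<omega>)) (snd (f \<omega>)))"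

definition s_draw :: "(real \<Rightarrow> 'a) \<Rightarrow> 'a sampler" where
  "s_draw g = (\<lambda>\<omega>. (g (shd \<omega>), stl \<omega>))"

fun s_iter :: "(nat \<Rightarrow> 'a \<Rightarrow> 'a sampler) \<Rightarrow> nat \<Rightarrow> 'a \<Rightarrow> 'a sampler" where
  "s_iter f 0 a = s_ret a"
| "s_iter f (Suc k) a = s_bind (s_iter f k a) (f k)"

fun p_iter :: "(nat \<Rightarrow> 'a \<Rightarrow> 'a pmf) \<Rightarrow> nat \<Rightarrow> 'a \<Rightarrow> 'a pmf" where
  "p_iter f 0 a = return_pmf a"
| "p_iter f (Suc k) a = bind_pmf (p_iter f k a) (f k)"

text \<open>
  \<open>realises f p\<close>: the result of \<open>f\<close> has distribution \<open>p\<close> and is independent of the unused samples,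
  which are again independent and uniform.
\<close>
definition realises :: "'a sampler \<Rightarrow> 'a pmf \<Rightarrow> bool" where
  "realises f p \<longleftrightarrow> (\<forall>h :: 'a \<Rightarrow> real stream \<Rightarrow> ennreal. (\<forall>a. h a \<in> borel_measurable sample_space) \<longrightarrow>
     (\<lambda>\<omega>. h (fst (f \<omega>)) (snd (f \<omega>))) \<in> borel_measurable sample_space \<and>
     (\<integral>\<^sup>+\<omega>. h (fst (f \<omega>)) (snd (f \<omega>)) \<partial>sample_space) =
       (\<integral>\<^sup>+a. \<integral>\<^sup>+\<omega>. h a \<omega> \<partial>sample_space \<partial>measure_pmf p))"

lemma realises_measurable:
  "realises f p \<Longrightarrow> (\<And>a. h a \<in> borel_measurable sample_space) \<Longrightarrow>
   (\<lambda>\<omega>. h (fst (f \<omega>)) (snd (f \<omega>)) :: ennreal) \<in> borel_measurable sample_space"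
  unfolding realises_def by blast

lemma realises_integral:
  "realises f p \<Longrightarrow> (\<And>a. h a \<in> borel_measurable sample_space) \<Longrightarrow>
   (\<integral>\<^sup>+\<omega>. h (fst (f \<omega>)) (snd (f \<omega>)) \<partial>sample_space) =
     (\<integral>\<^sup>+a. \<integral>\<^sup>+\<omega>. h a \<omega> \<partial>sample_space \<partial>measure_pmf p)"
  unfolding realises_def by blast

lemma realises_ret: "realises (s_ret a) (return_pmf a)"
  unfolding realises_def s_ret_def by (simp add: nn_integral_return)

lemma realises_bind:
  assumes f: "realises f p" and g: "\<And>a. realises (g a) (q a)"
  shows "realises (s_bind f g) (bind_pmf p q)"
  unfolding realises_def
proof (intro allI impI)
  fix h :: "'b \<Rightarrow> real stream \<Rightarrow> ennreal"
  assume h: "\<forall>b. h b \<in> borel_measurable sample_space"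
  let ?h = "\<lambda>a \<omega>. h (fst (g a \<omega>)) (snd (g a \<omega>))"
  have m: "?h a \<in> borel_measurable sample_space" for a
    using realises_measurable[OF g] h by blast
  have "(\<integral>\<^sup>+\<omega>. ?h (fst (f \<omega>)) (snd (f \<omega>)) \<partial>sample_space) =
      (\<integral>\<^sup>+a. \<integral>\<^sup>+\<omega>. ?h a \<omega> \<partial>sample_space \<partial>measure_pmf p)"
    by (rule realises_integral[OF f m])
  also have "\<dots> = (\<integral>\<^sup>+a. \<integral>\<^sup>+b. \<integral>\<^sup>+\<omega>. h b \<omega> \<partial>sample_space \<partial>measure_pmf (q a) \<partial>measure_pmf p)"
    using realises_integral[OF g] h by (intro nn_integral_cong) blast
  finally show "(\<lambda>\<omega>. h (fst (s_bind f g \<omega>)) (snd (s_bind f g \<omega>))) \<in> borel_measurable sample_space \<and>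
     (\<integral>\<^sup>+\<omega>. h (fst (s_bind f g \<omega>)) (snd (s_bind f g \<omega>)) \<partial>sample_space) =
       (\<integral>\<^sup>+a. \<integral>\<^sup>+\<omega>. h a \<omega> \<partial>sample_space \<partial>measure_pmf (bind_pmf p q))"
    using realises_measurable[OF f m] by (simp add: s_bind_def)
qed

lemma realises_iter:
  "(\<And>k a. k < n \<Longrightarrow> realises (f k a) (p k a)) \<Longrightarrow> realises (s_iter f n a) (p_iter p n a)"
  by (induction n) (auto intro: realises_ret realises_bind)

text \<open>A finite range turns \<open>h (g t) \<omega>\<close> into a finite sum of products, each
  an indicator of the head times a function of the tail. This gives measurability for an arbitrary
  type of outcomes and lets the integral over the stream be split at its head.\<close>

lemma realises_draw:
  assumes g: "g \<in> uniform01 \<rightarrow>\<^sub>M count_space UNIV" and fin: "finite (range g)"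
    and p: "\<And>a. emeasure uniform01 {t. g t = a} = ennreal (pmf p a)"
  shows "realises (s_draw g) p"
  unfolding realises_def
proof (intro allI impI)
  fix h :: "'a \<Rightarrow> real stream \<Rightarrow> ennreal"
  assume h: "\<forall>a. h a \<in> borel_measurable sample_space"
  have eq: "h (g t) \<omega> = (\<Sum>a\<in>range g. indicator {t. g t = a} t * h a \<omega>)" for t \<omega>
    by (subst sum.remove[OF fin, of "g t"]) (auto simp: indicator_def intro!: sum.neutral)
  have set: "{t. g t = a} \<in> sets borel" for a
    using measurable_sets[OF g, of "{a}"] by (simp add: vimage_def)
  have meas: "(\<lambda>\<omega>. h (fst (s_draw g \<omega>)) (snd (s_draw g \<omega>))) \<in> borel_measurable sample_space"
  proof -
    note set[measurable]
    have "(\<lambda>\<omega>. h a (stl \<omega>)) \<in> borel_measurable sample_space" for a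
      using h by (intro measurable_compose[OF measurable_stl]) blast
    moreover have "(\<lambda>\<omega>. indicator {t. g t = a} (shd \<omega>) :: ennreal) \<in> borel_measurable sample_space" for a
      by (rule measurable_compose[OF measurable_shd]) (use set in simp)
    ultimately show ?thesis unfolding s_draw_def fst_conv snd_conv eq
      by (intro borel_measurable_sum borel_measurable_times_ennreal)
  qed
  have "(\<integral>\<^sup>+\<omega>. h (fst (s_draw g \<omega>)) (snd (s_draw g \<omega>)) \<partial>sample_space) =
     (\<integral>\<^sup>+t. \<integral>\<^sup>+\<omega>. h (g t) \<omega> \<partial>sample_space \<partial>uniform01)"
    by (subst uniform01.nn_integral_stream_space[OF meas]) (simp add: s_draw_def)
  also have "\<dots> = (\<integral>\<^sup>+t. (\<Sum>a\<in>range g. indicator {t. g t = a} t * (\<integral>\<^sup>+\<omega>. h a \<omega> \<partial>sample_space)) \<partial>uniform01)"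
    unfolding eq using h by (subst nn_integral_sum) (auto simp: nn_integral_cmult intro!: borel_measurable_times_ennreal)
  also have "\<dots> = (\<Sum>a\<in>range g. ennreal (pmf p a) * (\<integral>\<^sup>+\<omega>. h a \<omega> \<partial>sample_space))"
    using set by (subst nn_integral_sum) (auto simp: nn_integral_multc p)
  also have "\<dots> = (\<integral>\<^sup>+a. \<integral>\<^sup>+\<omega>. h a \<omega> \<partial>sample_space \<partial>measure_pmf p)"
  proof -
    have "set_pmf p \<subseteq> range g"
    proof
      fix a assume "a \<in> set_pmf p"
      then have "emeasure uniform01 {t. g t = a} \<noteq> 0" using p[of a] by (simp add: set_pmf_iff)
      then have "{t. g t = a} \<noteq> {}" by (metis emeasure_empty)
      then show "a \<in> range g" by auto
    qed
    then show ?thesis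
      by (subst nn_integral_measure_pmf_support[OF fin]) (auto simp: set_pmf_eq mult.commute)
  qed
  finally show "(\<lambda>\<omega>. h (fst (s_draw g \<omega>)) (snd (s_draw g \<omega>))) \<in> borel_measurable sample_space \<and>
     (\<integral>\<^sup>+\<omega>. h (fst (s_draw g \<omega>)) (snd (s_draw g \<omega>)) \<partial>sample_space) =
       (\<integral>\<^sup>+a. \<integral>\<^sup>+\<omega>. h a \<omega> \<partial>sample_space \<partial>measure_pmf p)"
    using meas by blast
qed

lemma realises_emeasure:
  assumes "realises f p"
  shows "{\<omega>. fst (f \<omega>) \<in> A} \<in> sets sample_space"
    and "emeasure sample_space {\<omega>. fst (f \<omega>) \<in> A} = emeasure (measure_pmf p) A"
proof -
  let ?h = "\<lambda>a \<omega>::real stream. indicator A a :: ennreal"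
  have m: "(\<lambda>\<omega>. indicator A (fst (f \<omega>)) :: ennreal) \<in> borel_measurable sample_space"
    using realises_measurable[OF assms, of ?h] by simp
  have "{\<omega>. fst (f \<omega>) \<in> A} = (\<lambda>\<omega>. indicator A (fst (f \<omega>)) :: ennreal) -` {1} \<inter> space sample_space"
    by (auto simp: indicator_def)
  also have "\<dots> \<in> sets sample_space" by (rule measurable_sets[OF m]) simp
  finally show s: "{\<omega>. fst (f \<omega>) \<in> A} \<in> sets sample_space" .
  have "emeasure sample_space {\<omega>. fst (f \<omega>) \<in> A} = (\<integral>\<^sup>+\<omega>. indicator {\<omega>. fst (f \<omega>) \<in> A} \<omega> \<partial>sample_space)"
    using s by simp
  also have "\<dots> = (\<integral>\<^sup>+\<omega>. ?h (fst (f \<omega>)) (snd (f \<omega>)) \<partial>sample_space)"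
    by (intro nn_integral_cong) (simp add: indicator_def)
  also have "\<dots> = (\<integral>\<^sup>+a. \<integral>\<^sup>+\<omega>. ?h a \<omega> \<partial>sample_space \<partial>measure_pmf p)"
    by (rule realises_integral[OF assms]) simp
  finally show "emeasure sample_space {\<omega>. fst (f \<omega>) \<in> A} = emeasure (measure_pmf p) A"
    by (simp add: sample_space.emeasure_space_1[simplified])
qed

text \<open>For nonnegative t and positive T, \<open>phase_upto T T t\<close> is the floor of
  \<open>real T * t\<close>, capped at \<open>T - 1\<close>. It is a scan because the machine cannot
  round reals; \<open>phase_upto T j\<close> is the invariant of the loop in
  \<open>draw_phase\<close>.\<close>

fun phase_upto :: "nat \<Rightarrow> nat \<Rightarrow> real \<Rightarrow> nat" where
  "phase_upto T 0 t = 0"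
| "phase_upto T (Suc i) t = (if real T * t < real i then phase_upto T i t else i)"

text \<open>Inverse transform sampling: the result is the first index at which the partial sums of
  \<open>p\<close> exceed \<open>t\<close>.\<close>

fun pick_upto :: "(nat \<Rightarrow> real) \<Rightarrow> nat \<Rightarrow> real \<Rightarrow> nat option" where
  "pick_upto p 0 t = None"
| "pick_upto p (Suc i) t =
     (if pick_upto p i t = None \<and> t < (\<Sum>j<Suc i. p j) then Some i else pick_upto p i t)"

lemma phase_upto_less: "0 < m \<Longrightarrow> phase_upto T m t < m"
proof (induction m)
  case (Suc m)
  then show ?case by (cases "m = 0") (auto intro: less_SucI)
qed simp

lemma phase_upto_eq_iff:
  assumes "0 \<le> t" "0 < m"
  shows "phase_upto T m t = k \<longleftrightarrow> k < m \<and> k \<le> real T * t \<and> (real T * t < k + 1 \<or> k + 1 = m)"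
  using assms(2)
proof (induction m)
  case (Suc m)
  show ?case
  proof (cases "m = 0")
    case True
    moreover have "0 \<le> real T * t" using assms by simp
    ultimately show ?thesis by auto
  next
    case False
    then have IH: "phase_upto T m t = k \<longleftrightarrow> k < m \<and> k \<le> real T * t \<and> (real T * t < k + 1 \<or> k + 1 = m)"
      using Suc.IH by (simp add: add.commute)
    show ?thesis using IH by auto
  qed
qed simp

lemma realises_phase:
  assumes T: "0 < T"
  shows "realises (s_draw (phase_upto T T)) (pmf_of_set {..<T})"
proof (rule realises_draw)
  have [measurable]: "Measurable.pred uniform01 (\<lambda>t. phase_upto T m t = k)" for m k
    by (induction m) simp_all
  show "phase_upto T T \<in> uniform01 \<rightarrow>\<^sub>M count_space UNIV"
    by (subst measurable_count_space_eq2_countable) (auto simp: vimage_def pred_def)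
  show "finite (range (phase_upto T T))"
    by (rule finite_subset[of _ "{..<T}"]) (use phase_upto_less[OF T] in auto)
  fix k
  show "emeasure uniform01 {t. phase_upto T T t = k} = ennreal (pmf (pmf_of_set {..<T}) k)"
  proof (cases "k < T")
    case True
    have "emeasure uniform01 {t. phase_upto T T t = k} = ennreal (real (k + 1) / T - real k / T)"
    proof (rule emeasure_uniform01_Ico)
      show "{t. phase_upto T T t = k} \<in> sets borel"
        using \<open>Measurable.pred uniform01 (\<lambda>t. phase_upto T T t = k)\<close> by (simp add: pred_def)
      fix t :: real assume t: "0 < t" "t < 1"
      have *: "real T * t < T" using t T by simp
      have "phase_upto T T t = k \<longleftrightarrow> k \<le> real T * t \<and> real T * t < k + 1"
        using t T True * by (subst phase_upto_eq_iff) auto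
      then show "t \<in> {t. phase_upto T T t = k} \<longleftrightarrow> real k / T \<le> t \<and> t < real (k + 1) / T"
        using T by (auto simp: field_simps)
    qed (use T True in \<open>auto simp: field_simps\<close>)
    also have "\<dots> = ennreal (pmf (pmf_of_set {..<T}) k)"
      using T True by (subst pmf_of_set) (auto simp: field_simps)
    finally show ?thesis .
  next
    case False
    then have "{t. phase_upto T T t = k} = {}" using phase_upto_less[OF T] by auto
    then show ?thesis using T False by (subst pmf_of_set) auto
  qed
qed

lemma pick_upto_eq_Some_iff:
  assumes "0 \<le> t" "\<And>j. 0 \<le> p j"
  shows "pick_upto p m t = Some k \<longleftrightarrow> k < m \<and> (\<Sum>j<k. p j) \<le> t \<and> t < (\<Sum>j<Suc k. p j)"
    and "pick_upto p m t = None \<longleftrightarrow> (\<Sum>j<m. p j) \<le> t"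
proof (induction m)
  case (Suc m)
  have mono: "(\<Sum>j<k. p j) \<le> (\<Sum>j<l. p j)" if "k \<le> l" for k l
    using that assms by (intro sum_mono2) auto
  { case 1
    show ?case
    proof (cases "pick_upto p m t = None \<and> t < (\<Sum>j<Suc m. p j)")
      case True
      then show ?thesis using Suc.IH mono[of "Suc k" m] by (auto simp: less_Suc_eq)
    next
      case False
      then show ?thesis using Suc.IH mono[of "Suc k" m] by (auto simp: less_Suc_eq)
    qed }
  { case 2
    show ?case using Suc.IH mono[of m "Suc m"] by auto }
qed (use assms in simp_all)

lemma realises_pick:
  assumes p: "\<And>j. 0 \<le> p j" "(\<Sum>j<n. p j) \<le> 1"
    and q: "\<And>k. pmf q (Some k) = (if k < n then p k else 0)"
  shows "realises (s_draw (pick_upto p n)) q"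
proof (rule realises_draw)
  have [measurable]: "Measurable.pred uniform01 (\<lambda>t. pick_upto p m t = k)" for m k
    by (induction m arbitrary: k) simp_all
  have ran: "pick_upto p m t \<in> insert None (Some ` {..<m})" for m t
    by (induction m) auto
  show fin: "finite (range (pick_upto p n))"
    by (rule finite_subset[of _ "insert None (Some ` {..<n})"]) (use ran in auto)
  show "pick_upto p n \<in> uniform01 \<rightarrow>\<^sub>M count_space UNIV"
    by (subst measurable_count_space_eq2_countable) (auto simp: vimage_def pred_def)
  have set: "{t. pick_upto p n t = a} \<in> sets borel" for a
    using \<open>Measurable.pred uniform01 (\<lambda>t. pick_upto p n t = a)\<close> by (simp add: pred_def)
  have mono: "(\<Sum>j<k. p j) \<le> (\<Sum>j<l. p j)" if "k \<le> l" for k l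
    using that p by (intro sum_mono2) auto
  have nonneg: "0 \<le> (\<Sum>j<k. p j)" for k using p by (simp add: sum_nonneg)
  have S: "emeasure uniform01 {t. pick_upto p n t = Some k} = ennreal (pmf q (Some k))" for k
  proof (cases "k < n")
    case True
    have "(\<Sum>j<Suc k. p j) \<le> 1" using mono[of "Suc k" n] True p(2) by linarith
    then have "emeasure uniform01 {t. pick_upto p n t = Some k} = ennreal ((\<Sum>j<Suc k. p j) - (\<Sum>j<k. p j))"
      using set p True nonneg[of k]
      by (intro emeasure_uniform01_Ico) (auto simp: pick_upto_eq_Some_iff simp del: sum.lessThan_Suc intro!: mono)
    then show ?thesis using True q by simp
  next
    case False
    have "pick_upto p n t \<noteq> Some k" for t using ran[of n t] False by auto
    then have "{t. pick_upto p n t = Some k} = {}" by auto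
    then show ?thesis using False q by simp
  qed
  fix a show "emeasure uniform01 {t. pick_upto p n t = a} = ennreal (pmf q a)"
  proof (cases a)
    case None
    \<comment> \<open>The mass of \<open>None\<close> is forced: the support of \<open>q\<close> is
      finite and its masses sum to 1.\<close>
    have sub: "set_pmf q \<subseteq> insert None (Some ` {..<n})"
    proof
      fix a assume "a \<in> set_pmf q"
      then show "a \<in> insert None (Some ` {..<n})"
        using q by (cases a) (auto simp: set_pmf_eq split: if_splits)
    qed
    have "1 = (\<Sum>a\<in>insert None (Some ` {..<n}). pmf q a)"
      using sum_pmf_eq_1[OF _ sub] by simp
    also have "\<dots> = pmf q None + (\<Sum>j<n. p j)" by (simp add: sum.reindex q)
    finally have "pmf q None = 1 - (\<Sum>j<n. p j)" by simp
    moreover have "emeasure uniform01 {t. pick_upto p n t = None} = ennreal (1 - (\<Sum>j<n. p j))"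
      using set p nonneg[of n]
      by (intro emeasure_uniform01_Ico) (auto simp: pick_upto_eq_Some_iff)
    ultimately show ?thesis using None by simp
  qed (use S in simp)
qed

lemma realises_less:
  assumes "0 \<le> c" "0 < b"
  shows "realises (s_draw (\<lambda>t. b * t < c)) (bernoulli_pmf (min 1 (c / b)))"
proof (rule realises_draw)
  have T: "emeasure uniform01 {t. b * t < c} = ennreal (min 1 (c / b))"
  proof -
    have "emeasure uniform01 {t. b * t < c} = ennreal (min 1 (c / b) - 0)"
    proof (rule emeasure_uniform01_Ico)
      fix t :: real assume "0 < t" "t < 1"
      then show "t \<in> {t. b * t < c} \<longleftrightarrow> 0 \<le> t \<and> t < min 1 (c / b)"
        using assms by (simp add: pos_less_divide_eq mult.commute)
    qed (use assms in auto)
    then show ?thesis by simp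
  qed
  have F: "emeasure uniform01 {t. \<not> b * t < c} = ennreal (1 - min 1 (c / b))"
  proof (rule emeasure_uniform01_Ico)
    fix t :: real assume "0 < t" "t < 1"
    then show "t \<in> {t. \<not> b * t < c} \<longleftrightarrow> min 1 (c / b) \<le> t \<and> t < 1"
      using assms by (simp add: min_le_iff_disj pos_divide_le_eq mult.commute not_less)
  qed (use assms in auto)
  fix a show "emeasure uniform01 {t. (b * t < c) = a} = ennreal (pmf (bernoulli_pmf (min 1 (c / b))) a)"
    using T F assms by (cases a) simp_all
qed simp_all

text \<open>A sample is consumed even if the outcome is certain: \<open>draw_coin\<close> draws
  before it tests whether there is anything to accept, and the sampler has to keep step with
  it.\<close>

lemma realises_const: "realises (s_draw (\<lambda>t. a)) (return_pmf a)"
  by (rule realises_draw) (auto simp: uniform01.emeasure_space_1[simplified] pmf_return)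

section \<open>Alternating paths\<close>

text \<open>
  A datum consists of the arrival phase of a vertex, the vertex it chooses, and the outcome of its
  coin. Vertices arriving in the same phase are treated simultaneously, so that one vertex may be
  selected by several others; with distinct phases this does not happen.
\<close>
type_synonym data = "nat \<Rightarrow> nat \<times> nat option \<times> bool"

abbreviation phase :: "data \<Rightarrow> nat \<Rightarrow> nat" where "phase D v \<equiv> fst (D v)"
abbreviation target :: "data \<Rightarrow> nat \<Rightarrow> nat option" where "target D v \<equiv> fst (snd (D v))"
abbreviation coin :: "data \<Rightarrow> nat \<Rightarrow> bool" where "coin D v \<equiv> snd (snd (D v))"

text \<open>The condition of \<open>sel\<close> is written out because \<open>sel\<close> is defined
  from \<open>busy\<close>; \<open>busy_Suc\<close> replaces it afterwards. Freeness is tested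
  against the state at the start of the phase, which makes the vertices of one phase
  simultaneous.\<close>

primrec busy :: "data \<Rightarrow> nat \<Rightarrow> nat set" where
  "busy D 0 = {}"
| "busy D (Suc k) = busy D k \<union>
     {w. \<exists>u v. phase D v = k \<and> target D v = Some u \<and> phase D u < k \<and> u \<notin> busy D k \<and> coin D v \<and>
        (w = u \<or> w = v)}"

definition sel :: "data \<Rightarrow> nat \<Rightarrow> nat \<Rightarrow> nat \<Rightarrow> bool" where
  "sel D k u v \<longleftrightarrow>
     phase D v = k \<and> target D v = Some u \<and> phase D u < k \<and> u \<notin> busy D k \<and> coin D v"

lemma busy_Suc: "busy D (Suc k) = busy D k \<union> {w. \<exists>u v. sel D k u v \<and> (w = u \<or> w = v)}"
  by (auto simp: sel_def)

lemma busy_iff: "w \<in> busy D k \<longleftrightarrow> (\<exists>j<k. \<exists>u v. sel D j u v \<and> (w = u \<or> w = v))"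
  by (induction k) (auto simp: busy_Suc less_Suc_eq simp del: busy.simps(2))

lemma busyE:
  assumes "w \<in> busy D k"
  obtains j u v where "j < k" "sel D j u v" "w = u \<or> w = v"
  using assms busy_iff by blast

lemma busy_phase: "w \<in> busy D k \<Longrightarrow> phase D w < k"
  by (erule busyE) (auto simp: sel_def)

lemma busy_mono: "j \<le> k \<Longrightarrow> busy D j \<subseteq> busy D k"
  using busy_iff[of _ D j] busy_iff[of _ D k] less_le_trans by blast

text \<open>What happens before phase k is decided by the vertices that arrive before phase k; later
  arrivals may be exchanged or removed.\<close>

lemma busy_cong:
  assumes "\<And>v. phase D v < k \<longleftrightarrow> phase D' v < k" "\<And>v. phase D v < k \<Longrightarrow> D v = D' v"
  shows "busy D k = busy D' k"
  using assms
proof (induction k)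
  case (Suc k)
  have eq: "D v = D' v" if "phase D v < Suc k \<or> phase D' v < Suc k" for v
    using Suc.prems that by blast
  have IH: "busy D k = busy D' k"
    using eq by (intro Suc.IH) (metis less_SucI)+
  have "sel D k u v \<longleftrightarrow> sel D' k u v" for u v
    using eq[of u] eq[of v] by (auto simp: sel_def IH)
  then show ?case by (simp only: busy_Suc IH)
qed simp

text \<open>Arrivals have phases below \<open>T\<close>, so phase \<open>T\<close> stands for a
  vertex that never arrives. It also is the default outside the vertex set in
  \<open>data_pmf\<close>.\<close>

abbreviation absent :: "nat \<Rightarrow> nat \<times> nat option \<times> bool" where
  "absent T \<equiv> (T, None, False)"

lemma busy_remove:
  "k \<le> phase D v \<Longrightarrow> k \<le> T \<Longrightarrow> busy (D(v := absent T)) k = busy D k"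
  by (rule busy_cong) auto

fun follows :: "(nat \<Rightarrow> nat option) \<Rightarrow> nat list \<Rightarrow> bool" where
  "follows F (a # b # ws) \<longleftrightarrow> F a = Some b \<and> follows F (b # ws)"
| "follows F _ \<longleftrightarrow> True"

definition decreasing :: "(nat \<Rightarrow> nat) \<Rightarrow> nat list \<Rightarrow> bool" where
  "decreasing Y ws \<longleftrightarrow> sorted_wrt (\<lambda>a b. Y b < Y a) ws"

lemma decreasing_Cons:
  "decreasing Y (w # ws) \<longleftrightarrow> decreasing Y ws \<and> (ws \<noteq> [] \<longrightarrow> Y (hd ws) < Y w)"
  by (cases ws) (auto simp: decreasing_def)

lemma decreasing_distinct: "decreasing Y ws \<Longrightarrow> distinct ws"
  by (induction ws) (auto simp: decreasing_def)

definition path_to :: "(nat \<Rightarrow> nat option) \<Rightarrow> nat \<Rightarrow> nat \<Rightarrow> nat list \<Rightarrow> bool" where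
  "path_to F v u ws \<longleftrightarrow> ws \<noteq> [] \<and> hd ws = u \<and> last ws = v \<and> follows F ws"

text \<open>The path reaches \<open>v\<close> through the choice of \<open>v\<close> instead of the
  choice of its predecessor. Placing \<open>v\<close> before \<open>w\<close> keeps the list in
  order of decreasing arrival, since \<open>v\<close> arrives after the vertex \<open>w\<close> it
  selects.\<close>

definition path_into :: "(nat \<Rightarrow> nat option) \<Rightarrow> nat \<Rightarrow> nat \<Rightarrow> nat list \<Rightarrow> bool" where
  "path_into F v u ws \<longleftrightarrow>
     (\<exists>zs w. ws = zs @ [v, w] \<and> F v = Some w \<and> path_to F w u (zs @ [w]))"

lemma follows_Cons: "follows F (a # ws) \<longleftrightarrow> (ws = [] \<or> F a = Some (hd ws) \<and> follows F ws)"
  by (cases ws) auto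

lemma path_to_Cons: "path_to F v u ws \<Longrightarrow> F w = Some u \<Longrightarrow> path_to F v w (w # ws)"
  by (auto simp: path_to_def follows_Cons)

lemma path_into_Cons:
  assumes "path_into F v u ws" "F w' = Some u"
  shows "path_into F v w' (w' # ws)"
proof -
  obtain zs w where "ws = zs @ [v, w]" "F v = Some w" "path_to F w u (zs @ [w])"
    using assms by (auto simp: path_into_def)
  moreover from this have "path_to F w w' ((w' # zs) @ [w])"
    using path_to_Cons assms(2) by fastforce
  ultimately show ?thesis
    unfolding path_into_def by (intro exI[of _ "w' # zs"] exI[of _ w]) simp
qed

text \<open>Each vertex has at most one continuation, and distinctness forces the path to stop at
  its first visit to \<open>v\<close>.\<close>

lemma path_to_unique:
  "path_to F v u ws \<Longrightarrow> path_to F v u ws' \<Longrightarrow> distinct ws \<Longrightarrow> distinct ws' \<Longrightarrow> ws = ws'"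
proof (induction ws arbitrary: u ws')
  case (Cons a ws)
  then obtain ws'' where ws': "ws' = a # ws''" by (cases ws') (auto simp: path_to_def)
  show ?case
  proof (cases "a = v")
    case True
    then have "ws = []" "ws'' = []"
      using Cons.prems last_in_set[of ws] last_in_set[of ws'']
      by (auto simp: path_to_def ws' split: if_splits)
    then show ?thesis using ws' by simp
  next
    case False
    then have ne: "ws \<noteq> []" "ws'' \<noteq> []" using Cons.prems by (auto simp: path_to_def ws')
    then have "path_to F v (hd ws) ws" "path_to F v (hd ws) ws''"
      using Cons.prems by (auto simp: path_to_def ws' follows_Cons)
    then show ?thesis using Cons.IH Cons.prems by (auto simp: ws')
  qed
qed (simp add: path_to_def)

lemma path_into_unique:
  assumes "path_into F v u ws" "path_into F v u ws'" "distinct ws" "distinct ws'"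
  shows "ws = ws'"
proof -
  obtain zs w where 1: "ws = zs @ [v, w]" "F v = Some w" "path_to F w u (zs @ [w])"
    using assms by (auto simp: path_into_def)
  obtain zs' where 2: "ws' = zs' @ [v, w]" "path_to F w u (zs' @ [w])"
    using assms 1 by (auto simp: path_into_def)
  have "zs @ [w] = zs' @ [w]" by (rule path_to_unique[OF 1(3) 2(2)]) (use assms 1 2 in auto)
  then show ?thesis using 1 2 by simp
qed

text \<open>
  Removing the vertex \<open>v\<close> changes the state of another vertex only along an alternating path that
  starts at \<open>v\<close>. Read backwards, such a path follows the choices of its vertices, and its edges
  belong alternately to the selections with and without \<open>v\<close>.
\<close>
lemma remove_vertex:
  assumes "w \<noteq> v" "k \<le> T"
  shows "(w \<in> busy (D(v := absent T)) k \<and> w \<notin> busy D k \<longrightarrow>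
            (\<exists>ws. odd (length ws) \<and> decreasing (phase D) ws \<and> phase D (hd ws) < k \<and>
               (path_to (target D) v w ws \<or> path_into (target D) v w ws))) \<and>
         (w \<in> busy D k \<and> w \<notin> busy (D(v := absent T)) k \<longrightarrow>
            (\<exists>ws. even (length ws) \<and> decreasing (phase D) ws \<and> phase D (hd ws) < k \<and>
               (path_to (target D) v w ws \<or> path_into (target D) v w ws)))"
  using assms
proof (induction k arbitrary: w)
  case 0
  show ?case by (simp only: busy.simps empty_iff simp_thms)
next
  case (Suc k)
  let ?D = "D(v := absent T)"
  have same: "?D w = D w" if "w \<noteq> v" for w using that by simp
  \<comment> \<open>A difference at the chosen vertex \<open>a\<close> is passed on to
    \<open>w\<close> with the opposite sign: \<open>w\<close> stays free in the process in which
    \<open>a\<close> is busy. Prepending \<open>w\<close> flips the parity of the length, and the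
    parity records in which of the two processes the head is busy.\<close>
  have step: "\<exists>ws. P (length ws) \<and> decreasing (phase D) ws \<and> phase D (hd ws) < Suc k \<and>
               (path_to (target D) v w ws \<or> path_into (target D) v w ws)"
    if "phase D w = k" "target D w = Some a" and
      ex: "\<exists>ws. P (Suc (length ws)) \<and> decreasing (phase D) ws \<and> phase D (hd ws) < k \<and>
               (path_to (target D) v a ws \<or> path_into (target D) v a ws)" for P w a
  proof -
    obtain ws where ws: "P (Suc (length ws))" "decreasing (phase D) ws" "phase D (hd ws) < k"
      "path_to (target D) v a ws \<or> path_into (target D) v a ws"
      using ex by blast
    have "decreasing (phase D) (w # ws)"
      using ws that by (auto simp: decreasing_Cons)
    moreover have "path_to (target D) v w (w # ws) \<or> path_into (target D) v w (w # ws)"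
      using ws(4) that(2) path_to_Cons path_into_Cons by blast
    ultimately show ?thesis using ws(1) that by (intro exI[of _ "w # ws"]) auto
  qed
  show ?case
  proof (intro conjI impI)
    assume *: "w \<in> busy ?D (Suc k) \<and> w \<notin> busy D (Suc k)"
    then have nb: "w \<notin> busy D k" by (auto simp: busy_Suc)
    show "\<exists>ws. odd (length ws) \<and> decreasing (phase D) ws \<and> phase D (hd ws) < Suc k \<and>
               (path_to (target D) v w ws \<or> path_into (target D) v w ws)"
    proof (cases "w \<in> busy ?D k")
      case True
      then obtain ws where "odd (length ws)" "decreasing (phase D) ws" "phase D (hd ws) < k"
        "path_to (target D) v w ws \<or> path_into (target D) v w ws"
        using Suc.IH[OF Suc.prems(1) Suc_leD[OF Suc.prems(2)]] nb by blast
      then show ?thesis by (intro exI[of _ ws]) simp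
    next
      case False
      then obtain a b where ab: "sel ?D k a b" "w = a \<or> w = b"
        using * by (auto simp: busy_Suc simp del: busy.simps)
      have bv: "b \<noteq> v" "a \<noteq> v" using ab Suc.prems by (auto simp: sel_def)
      have ns: "\<not> sel D k a b" using * ab by (auto simp: busy_Suc simp del: busy.simps)
      then have a: "a \<in> busy D k" "a \<notin> busy ?D k"
        using ab(1) bv by (auto simp: sel_def)
      then have "w = b" using ab nb by auto
      have ex: "\<exists>ws. odd (Suc (length ws)) \<and> decreasing (phase D) ws \<and> phase D (hd ws) < k \<and>
               (path_to (target D) v a ws \<or> path_into (target D) v a ws)"
        using Suc.IH[OF bv(2)] a Suc.prems(2) by (simp del: fun_upd_apply)
      have "phase D w = k" "target D w = Some a"
        using ab bv \<open>w = b\<close> by (auto simp: sel_def)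
      then show ?thesis by (rule step[where P = odd, OF _ _ ex])
    qed
  next
    assume *: "w \<in> busy D (Suc k) \<and> w \<notin> busy ?D (Suc k)"
    then have nb: "w \<notin> busy ?D k" by (auto simp: busy_Suc)
    show "\<exists>ws. even (length ws) \<and> decreasing (phase D) ws \<and> phase D (hd ws) < Suc k \<and>
               (path_to (target D) v w ws \<or> path_into (target D) v w ws)"
    proof (cases "w \<in> busy D k")
      case True
      then obtain ws where "even (length ws)" "decreasing (phase D) ws" "phase D (hd ws) < k"
        "path_to (target D) v w ws \<or> path_into (target D) v w ws"
        using Suc.IH[OF Suc.prems(1) Suc_leD[OF Suc.prems(2)]] nb by blast
      then show ?thesis by (intro exI[of _ ws]) simp
    next
      case False
      then obtain a b where ab: "sel D k a b" "w = a \<or> w = b"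
        using * by (auto simp: busy_Suc simp del: busy.simps)
      \<comment> \<open>A difference originates only in a selection that contains \<open>v\<close>,
        as the chosen vertex or as the choosing one; this yields a path of length 2 of either kind.
        Otherwise it is inherited from \<open>a\<close>.\<close>
      consider "a = v" | "b = v" | "a \<noteq> v" "b \<noteq> v" by blast
      then show ?thesis
      proof cases
        case 1
        then have "w = b" using ab Suc.prems by auto
        then show ?thesis using ab 1
          by (intro exI[of _ "[w, v]"]) (auto simp: sel_def decreasing_def path_to_def)
      next
        case 2
        then have "w = a" using ab Suc.prems by auto
        then show ?thesis using ab 2
          by (intro exI[of _ "[v, w]"]) (auto simp: sel_def decreasing_def path_into_def path_to_def)
      next
        case 3
        have "\<not> sel ?D k a b" using * ab by (auto simp: busy_Suc simp del: busy.simps)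
        then have a: "a \<in> busy ?D k" "a \<notin> busy D k"
          using ab(1) 3 by (auto simp: sel_def)
        then have "w = b" using ab nb by auto
        have ex: "\<exists>ws. even (Suc (length ws)) \<and> decreasing (phase D) ws \<and> phase D (hd ws) < k \<and>
               (path_to (target D) v a ws \<or> path_into (target D) v a ws)"
          using Suc.IH[OF 3(1)] a Suc.prems(2) by (simp del: fun_upd_apply)
        have "phase D w = k" "target D w = Some a"
          using ab 3 \<open>w = b\<close> by (auto simp: sel_def)
        then show ?thesis by (rule step[where P = even, OF _ _ ex])
      qed
    qed
  qed
qed

lemma follows_nth: "follows F ws \<Longrightarrow> Suc i < length ws \<Longrightarrow> F (ws ! i) = Some (ws ! Suc i)"
proof (induction F ws arbitrary: i rule: follows.induct)
  case (1 F a b ws)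
  then show ?case by (cases i) auto
qed auto

lemma odd_girth_le:
  assumes len: "odd (length ws)" and dist: "distinct ws"
    and path: "path_to F v u ws \<or> path_into F v u ws"
    and F: "\<And>a b. F a = Some b \<Longrightarrow> {a, b} \<in> {e\<in>E. x e \<noteq> 0}" and uv: "{u, v} \<in> {e\<in>E. x e \<noteq> 0}"
    and ne: "u \<noteq> v"
  shows "odd_girth E x \<le> enat (length ws)"
proof -
  have *: "odd_girth E x \<le> enat (length p)"
    if p: "odd (length p)" "distinct p" "3 \<le> length p" "{last p, hd p} \<in> {e\<in>E. x e \<noteq> 0}"
      "\<And>i. Suc i < length p \<Longrightarrow> {p ! i, p ! Suc i} \<in> {e\<in>E. x e \<noteq> 0}" for p
  proof -
    have "{p ! i, p ! (Suc i mod length p)} \<in> {e\<in>E. x e \<noteq> 0}" if "i < length p" for i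
    proof (cases "Suc i = length p")
      case True
      then have "p ! i = last p" "p ! (Suc i mod length p) = hd p"
        using p(3) by (cases p; auto simp: last_conv_nth hd_conv_nth True[symmetric])+
      then show ?thesis using p(4) by simp
    next
      case False
      then show ?thesis using p(5)[of i] that by simp
    qed
    then have "is_cycle {e\<in>E. x e \<noteq> 0} p" using p by (simp add: is_cycle_def)
    then show ?thesis unfolding odd_girth_def using p(1) by (intro Inf_lower) blast
  qed
  show ?thesis
    using path
  proof
    assume ws: "path_to F v u ws"
    \<comment> \<open>A single vertex would mean \<open>u = v\<close>. So the odd path has at least
      three vertices, and the edge between \<open>u\<close> and \<open>v\<close> closes it to a
      cycle.\<close>
    have "length ws \<noteq> 1" using ws ne by (auto simp: path_to_def length_Suc_conv)
    moreover have "length ws \<noteq> 0" "length ws \<noteq> 2" using len by auto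
    ultimately have "3 \<le> length ws" by arith
    moreover have "{last ws, hd ws} = {u, v}" using ws by (auto simp: path_to_def)
    ultimately show ?thesis
      using ws len dist uv follows_nth[of F ws] F by (intro *) (auto simp: path_to_def)
  next
    assume "path_into F v u ws"
    then obtain zs w where ws: "ws = zs @ [v, w]" "F v = Some w" "path_to F w u (zs @ [w])"
      by (auto simp: path_into_def)
    \<comment> \<open>Moving \<open>v\<close> behind \<open>w\<close> turns the order of arrival
      into a cyclic order: \<open>v\<close> is joined to \<open>w\<close> by its choice and to
      \<open>u\<close> by the given edge.\<close>
    let ?p = "(zs @ [w]) @ [v]"
    have 3: "3 \<le> length ?p" using len ws by (cases zs) auto
    have "odd_girth E x \<le> enat (length ?p)"
    proof (rule *)
      show "{last ?p, hd ?p} \<in> {e\<in>E. x e \<noteq> 0}"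
        using ws(3) uv by (cases zs) (auto simp: path_to_def insert_commute)
      fix i assume i: "Suc i < length ?p"
      show "{?p ! i, ?p ! Suc i} \<in> {e\<in>E. x e \<noteq> 0}"
      proof (cases "Suc i < length (zs @ [w])")
        case True
        then have "F ((zs @ [w]) ! i) = Some ((zs @ [w]) ! Suc i)"
          using ws(3) follows_nth by (auto simp: path_to_def)
        then have "F (?p ! i) = Some (?p ! Suc i)"
          using True by (simp add: nth_append)
        then show ?thesis by (rule F)
      next
        case False
        then have "i = length zs" using i by simp
        then have "?p ! i = w" "?p ! Suc i = v" by (auto simp: nth_append)
        then show ?thesis using F[OF ws(2)] by (simp add: insert_commute)
      qed
    qed (use len dist ws 3 in auto)
    then show ?thesis using ws by simp
  qed
qed

text \<open>For k vertices, y^k / k! is the probability of arriving by time y in a prescribed order;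
  the factor 2 accounts for \<open>path_to\<close> and \<open>path_into\<close>.\<close>

definition odd_cycle_loss :: "enat \<Rightarrow> real \<Rightarrow> real" where
  "odd_cycle_loss g y = (case g of enat k \<Rightarrow> 2 * y ^ k / fact k | \<infinity> \<Rightarrow> 0)"

section \<open>The constant\<close>

text \<open>Common ground for finite and infinite \<open>g\<close>. The bound
  \<open>y ^ 3 / 3\<close> is the loss of triangles, the largest that occurs.\<close>

locale limit_equation =
  fixes h \<rho> :: "real \<Rightarrow> real"
  assumes deriv: "\<And>y. y \<in> {0..1} \<Longrightarrow> (h has_real_derivative (y - 2 * h y - \<rho> y)) (at y within {0..1})"
    and zero: "h 0 = 0"
    and \<rho>_nonneg: "\<And>y. y \<in> {0..1} \<Longrightarrow> 0 \<le> \<rho> y"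
    and \<rho>_le: "\<And>y. y \<in> {0..1} \<Longrightarrow> \<rho> y \<le> y ^ 3 / 3"
    and \<rho>_mono: "\<And>y z. 0 \<le> y \<Longrightarrow> y \<le> z \<Longrightarrow> z \<le> 1 \<Longrightarrow> \<rho> y \<le> \<rho> z"
begin

lemma continuous: "continuous_on {0..1} h"
  by (rule DERIV_continuous_on) (rule deriv)

lemma deriv_at: "0 < y \<Longrightarrow> y < 1 \<Longrightarrow> (h has_real_derivative (y - 2 * h y - \<rho> y)) (at y)"
  using deriv[of y] at_within_interior[of y "{0..1::real}"] by (simp add: interior_atLeastAtMost_real)

lemma mean_value:
  assumes "0 \<le> a" "a < b" "b \<le> 1"
  shows "\<exists>z. a < z \<and> z < b \<and> h b - h a = (b - a) * (z - 2 * h z - \<rho> z)"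
proof -
  have "\<exists>l z. a < z \<and> z < b \<and> DERIV h z :> l \<and> h b - h a = (b - a) * l"
  proof (rule MVT)
    show "continuous_on {a..b} h"
      using assms by (intro continuous_on_subset[OF continuous]) auto
    show "h differentiable (at z)" if "a < z" "z < b" for z
      using deriv_at[of z] assms that unfolding real_differentiable_def by auto
  qed fact
  then obtain l z where z: "a < z" "z < b" "DERIV h z :> l" "h b - h a = (b - a) * l" by blast
  moreover have "l = z - 2 * h z - \<rho> z"
    using DERIV_unique[OF z(3) deriv_at] z assms by auto
  ultimately show ?thesis by blast
qed

text \<open>The integrating factor \<open>exp (2 * y)\<close> makes the difference between
  \<open>h\<close> and a sub- or supersolution \<open>l\<close> monotone, and this difference
  vanishes at 0. The sign \<open>s\<close> treats both cases at once: 1 gives lower bounds on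
  \<open>h\<close>, and -1 gives upper bounds.\<close>

lemma compare:
  assumes l: "\<And>y. (l has_real_derivative l' y) (at y)" and l0: "l 0 = 0" and y: "y \<in> {0..1}"
    and s: "s = 1 \<or> s = - 1" "\<And>z. 0 < z \<Longrightarrow> z < 1 \<Longrightarrow> s * (l' z + 2 * l z) \<le> s * (z - \<rho> z)"
  shows "s * l y \<le> s * h y"
proof (cases "y = 0")
  case False
  let ?f = "\<lambda>y. exp (2 * y) * (s * (h y - l y))"
  have "?f 0 \<le> ?f y"
  proof (rule DERIV_nonneg_imp_increasing_open[where f = ?f])
    fix z assume z: "0 < z" "z < y"
    then have "z < 1" using y by auto
    have "(?f has_real_derivative
        exp (2 * z) * 2 * (s * (h z - l z)) + exp (2 * z) * (s * ((z - 2 * h z - \<rho> z) - l' z))) (at z)"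
      by (rule derivative_eq_intros deriv_at l z \<open>z < 1\<close> refl | simp)+
    also have "exp (2 * z) * 2 * (s * (h z - l z)) + exp (2 * z) * (s * ((z - 2 * h z - \<rho> z) - l' z)) =
       exp (2 * z) * (s * (z - \<rho> z) - s * (l' z + 2 * l z))"
      by (simp add: algebra_simps)
    finally show "\<exists>D. (?f has_real_derivative D) (at z) \<and> 0 \<le> D"
      using s(2)[OF z(1) \<open>z < 1\<close>] by (intro exI conjI) auto
  next
    have "continuous_on {0..y} h" using y by (auto intro: continuous_on_subset[OF continuous])
    moreover have "continuous_on {0..y} l" using l by (meson DERIV_continuous_on has_field_derivative_at_within)
    ultimately show "continuous_on {0..y} ?f" by (intro continuous_intros)
  qed (use y False in auto)
  then have "exp (2 * y) * 0 \<le> exp (2 * y) * (s * (h y - l y))" by (simp add: zero l0)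
  then have "0 \<le> s * (h y - l y)" by (rule mult_left_le_imp_le) simp
  then show ?thesis by (simp add: algebra_simps)
qed (simp add: zero l0)

lemma h_ge: "y \<in> {0..1} \<Longrightarrow> y\<^sup>2 / 6 \<le> h y"
proof -
  assume y: "y \<in> {0..1}"
  have "1 * (y\<^sup>2 / 6) \<le> 1 * h y"
  proof (rule compare[where l' = "\<lambda>y. y / 3"])
    show "((\<lambda>y. y\<^sup>2 / 6) has_real_derivative z / 3) (at z)" for z :: real
      by (auto intro!: derivative_eq_intros)
    fix z :: real assume z: "0 < z" "z < 1"
    have "z ^ 2 \<le> z ^ 1" "z ^ 3 \<le> z ^ 1" using z by (intro power_decreasing; simp)+
    then have "z / 3 + 2 * (z\<^sup>2 / 6) \<le> z - z ^ 3 / 3" by simp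
    then show "1 * (z / 3 + 2 * (z\<^sup>2 / 6)) \<le> 1 * (z - \<rho> z)"
      using \<rho>_le[of z] z by simp
  qed (use y in auto)
  then show ?thesis by simp
qed

lemma h_le: "y \<in> {0..1} \<Longrightarrow> h y \<le> y\<^sup>2 / 2"
proof -
  assume y: "y \<in> {0..1}"
  have "- 1 * (y\<^sup>2 / 2) \<le> - 1 * h y"
  proof (rule compare[where l' = "\<lambda>y. y"])
    show "((\<lambda>y. y\<^sup>2 / 2) has_real_derivative z) (at z)" for z :: real
      by (auto intro!: derivative_eq_intros)
    fix z :: real assume z: "0 < z" "z < 1"
    then have "0 \<le> \<rho> z" using \<rho>_nonneg[of z] by simp
    then have "- z\<^sup>2 \<le> \<rho> z" by (rule order_trans[rotated]) simp
    then show "- 1 * (z + 2 * (z\<^sup>2 / 2)) \<le> - 1 * (z - \<rho> z)" by simp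
  qed (use y in auto)
  then show ?thesis by simp
qed

text \<open>The mean value theorem is applied twice, to \<open>h\<close> over the step and to the
  change of \<open>h\<close> inside its own derivative. As the bound is one-sided, monotonicity of
  \<rho> takes the place of differentiability.\<close>

lemma euler_step:
  assumes "0 \<le> y" "0 < d" "y + d \<le> 1"
  shows "h (y + d) \<le> h y + d * (y - 2 * h y - \<rho> y) + 4 * d\<^sup>2"
proof -
  obtain z where z: "y < z" "z < y + d" "h (y + d) - h y = d * (z - 2 * h z - \<rho> z)"
    using mean_value[of y "y + d"] assms by auto
  have z1: "0 \<le> z" "z \<le> 1" using z assms by auto
  obtain t where t: "y < t" "t < z" "h z - h y = (z - y) * (t - 2 * h t - \<rho> t)"
    using mean_value[of y z] assms z by auto
  have t1: "0 \<le> t" "t \<le> 1" using t z assms by auto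
  have "t\<^sup>2 \<le> 1" "t ^ 3 \<le> 1" using t1 by (auto intro: power_le_one)
  \<comment> \<open>This follows from \<open>h t \<le> t\<^sup>2 / 2\<close> and
    \<open>\<rho> t \<le> t ^ 3 / 3\<close>. Over a step of length \<open>d\<close> the slope then
    grows by at most d + 2 * (4/3) * d, which is below 4 * d.\<close>
  then have "- 4 / 3 \<le> t - 2 * h t - \<rho> t"
    using h_le[of t] \<rho>_le[of t] t1 by simp
  then have "(z - y) * (- 4 / 3) \<le> h z - h y"
    unfolding t(3) using t by (intro mult_left_mono) auto
  moreover have "\<rho> y \<le> \<rho> z" using assms z by (intro \<rho>_mono) auto
  ultimately have "z - 2 * h z - \<rho> z \<le> (y - 2 * h y - \<rho> y) + 4 * d"
    using z by argo
  then have "d * (z - 2 * h z - \<rho> z) \<le> d * ((y - 2 * h y - \<rho> y) + 4 * d)"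
    using assms by (intro mult_left_mono) auto
  then show ?thesis using z(3) by (simp add: power2_eq_square algebra_simps)
qed

text \<open>The partial sums of \<open>K\<close> divided by \<open>T\<close> satisfy the Euler
  recursion for \<open>h\<close> as a lower bound, up to \<delta>. The factor
  \<open>1 - 2 / T\<close> lies between 0 and 1 because \<open>2 \<le> T\<close>, so the step errors
  4 / T^2 + \<delta> / T merely add up to \<open>4 / T + \<delta>\<close>.\<close>

lemma euler:
  fixes T :: nat
  assumes T: "2 \<le> T" and \<delta>: "0 \<le> \<delta>"
    and K: "\<And>k. k < T \<Longrightarrow> real k / T - 2 / T * (\<Sum>j<k. K j) - \<rho> (real k / T) - \<delta> \<le> K k"
  shows "2 * h 1 - 8 / T - 2 * \<delta> \<le> 2 / T * (\<Sum>k<T. K k)"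
proof -
  let ?H = "\<lambda>k. 1 / real T * (\<Sum>j<k. K j)"
  let ?e = "4 * (1 / real T)\<^sup>2 + \<delta> / T"
  have "h (real k / T) - ?H k \<le> k * ?e" if "k \<le> T" for k
    using that
  proof (induction k)
    case (Suc k)
    let ?y = "real k / T" and ?d = "1 / real T"
    have e: "0 \<le> ?e" using \<delta> by simp
    have "h (?y + ?d) \<le> h ?y + ?d * (?y - 2 * h ?y - \<rho> ?y) + 4 * ?d\<^sup>2"
      using Suc.prems T by (intro euler_step) (auto simp: field_simps)
    moreover have "?d * (?y - 2 * ?H k - \<rho> ?y - \<delta>) \<le> ?d * K k"
      using K[of k] Suc.prems T by (intro mult_left_mono) auto
    ultimately have "h (?y + ?d) - ?H (Suc k) \<le> (1 - 2 * ?d) * (h ?y - ?H k) + ?e"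
      by (simp add: algebra_simps)
    also have "\<dots> \<le> (1 - 2 * ?d) * (k * ?e) + ?e"
      using Suc T by (intro add_right_mono mult_left_mono) (auto simp: field_simps)
    also have "\<dots> \<le> 1 * (k * ?e) + ?e"
      using e by (intro add_right_mono mult_right_mono) auto
    also have "\<dots> = Suc k * ?e" by (simp add: algebra_simps add_divide_distrib)
    also have "?y + ?d = real (Suc k) / T" by (simp add: add_divide_distrib)
    finally show ?case .
  qed (simp add: zero)
  from this[of T] have "h 1 - ?H T \<le> T * ?e" using T by simp
  also have "T * ?e = 4 / T + \<delta>" using T by (simp add: power2_eq_square field_simps)
  finally show ?thesis by (simp add: algebra_simps)
qed

end

section \<open>The incomplete gamma function and the differential equation for the constant\<close>

lemma has_integral_Gamma_nat: "((\<lambda>t. t ^ (s - 1) * exp (- t)) has_integral Gamma (real s)) {0..}"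
  if "0 < s" for s :: nat
proof -
  have "((\<lambda>t. t powr (real s - 1) / exp t) has_integral Gamma (real s)) {0..}"
    using Gamma_integral_real[of "real s"] that by simp
  then show ?thesis
  proof (rule has_integral_spike[of "{0}", rotated 2])
    fix t :: real assume "t \<in> {0..} - {0}"
    then show "t ^ (s - 1) * exp (- t) = t powr (real s - 1) / exp t"
      using that powr_realpow[of t "s - 1"] by (simp add: exp_minus divide_inverse of_nat_diff)
  qed simp
qed

lemma upper_Gamma_diff:
  assumes "0 < s" "z \<le> 0"
  shows "upper_Gamma s z - upper_Gamma s 0 = integral {z..0} (\<lambda>t. t ^ (s - 1) * exp (- t))"
proof -
  let ?f = "\<lambda>t. t ^ (s - 1) * exp (- t) :: real"
  have "(?f has_integral integral {z..0} ?f) {z..0}"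
    by (intro integrable_integral integrable_continuous_real continuous_intros)
  moreover have G: "(?f has_integral integral {0..} ?f) {0..}"
    using has_integral_Gamma_nat[OF assms(1)] by (intro integrable_integral) blast
  ultimately have "(?f has_integral integral {z..0} ?f + integral {0..} ?f) ({z..0} \<union> {0..})"
    by (rule has_integral_Un) (rule negligible_subset[of "{0}"], auto)
  moreover have "{z..0} \<union> {0..} = {z..}" using assms by auto
  ultimately show ?thesis unfolding upper_Gamma_def by (simp add: integral_unique)
qed

text \<open>Explicit differentiation shows that the product k y = c(y) * y satisfies k' = 1 - 2 k -
  2 y^(g-1) / (g-1)!. This is the derivative of the equation k = y - 2 h - 2 y^g / g!, whose two
  sides vanish at 0 and therefore agree.\<close>

lemma c_fun_equation:
  assumes g: "odd g" "3 \<le> g" and y: "y \<in> {0..1}"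
  defines "h \<equiv> \<lambda>y. integral {0..y} (\<lambda>z. c_fun g z * z)"
  shows "(h has_real_derivative (y - 2 * h y - odd_cycle_loss (enat g) y)) (at y within {0..1})"
proof -
  let ?f = "\<lambda>t. t ^ (g - 1) * exp (- t) :: real"
  let ?c = "2 ^ (g - 1) * fact (g - 1) :: real"
  \<comment> \<open>The base point -2 is the least value of \<open>- 2 * y\<close>, so that
    \<open>A\<close> is an antiderivative on the whole range.\<close>
  define A where "A = (\<lambda>t. integral {-2..t} ?f)"
  define J where "J = (\<lambda>y. A 0 - A (- 2 * y))"
  define k where "k = (\<lambda>y. 1 / 2 - exp (- 2 * y) / 2 - exp (- 2 * y) * J y / ?c)"
  have int: "?f integrable_on {a..b}" for a b
    by (intro integrable_continuous_real continuous_intros)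
  have J: "J y = upper_Gamma g (- 2 * y) - upper_Gamma g 0" if "y \<in> {0..1}" for y
  proof -
    have "integral {-2..- 2 * y} ?f + integral {- 2 * y..0} ?f = integral {-2..0} ?f"
      using that int by (intro Henstock_Kurzweil_Integration.integral_combine) auto
    then show ?thesis using upper_Gamma_diff[of g "- 2 * y"] g that by (simp add: J_def A_def)
  qed
  have k: "c_fun g y * y = k y" if "y \<in> {0..1}" for y
  proof (cases "y = 0")
    case False
    then show ?thesis using that
      by (simp only: c_fun_def if_False k_def J[OF that]) (simp add: field_simps)
  qed (simp add: c_fun_def k_def J_def)
  have A': "(A has_real_derivative ?f t) (at t within {-2..0})" if "t \<in> {-2..0}" for t
    unfolding A_def using that by (intro integral_has_real_derivative continuous_intros) auto
  have J': "(J has_real_derivative 2 * ?f (- 2 * y)) (at y within {0..1})" if "y \<in> {0..1}" for y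
  proof -
    have "((A \<circ> (\<lambda>y. - 2 * y)) has_real_derivative ?f (- 2 * y) * (- 2)) (at y within {0..1})"
    proof (rule DERIV_image_chain)
      show "(A has_real_derivative ?f (- 2 * y)) (at (- 2 * y) within (\<lambda>y. - 2 * y) ` {0..1})"
        by (rule DERIV_subset[OF A']) (use that in auto)
      show "((\<lambda>y. - 2 * y) has_real_derivative - 2) (at y within {0..1})"
        by (auto intro!: derivative_eq_intros)
    qed
    then show ?thesis unfolding J_def o_def by (auto intro!: derivative_eq_intros)
  qed
  have k': "(k has_real_derivative 1 - 2 * k y - 2 * y ^ (g - 1) / fact (g - 1)) (at y within {0..1})"
    if y: "y \<in> {0..1}" for y
  proof -
    have "(k has_real_derivative exp (- 2 * y) - (- 2 * exp (- 2 * y) * J y + exp (- 2 * y) * (2 * ?f (- 2 * y))) / ?c)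
        (at y within {0..1})"
      unfolding k_def by (rule derivative_eq_intros J' y refl | simp)+
    also have "exp (- 2 * y) * (2 * ?f (- 2 * y)) / ?c = 2 * y ^ (g - 1) / fact (g - 1)"
    proof -
      \<comment> \<open>Here the oddness of \<open>g\<close> enters: \<open>g - 1\<close> is even,
        so the sign disappears.\<close>
      have "(- 2 * y) ^ (g - 1) = 2 ^ (g - 1) * y ^ (g - 1)"
        using g by (simp add: power_mult_distrib)
      moreover have "exp (- 2 * y) * exp (2 * y) = 1" by (simp flip: exp_add)
      ultimately show ?thesis by (simp add: field_simps)
    qed
    then have "exp (- 2 * y) - (- 2 * exp (- 2 * y) * J y + exp (- 2 * y) * (2 * ?f (- 2 * y))) / ?c =
        1 - 2 * k y - 2 * y ^ (g - 1) / fact (g - 1)"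
      unfolding k_def add_divide_distrib by (simp add: algebra_simps)
    finally show ?thesis .
  qed
  have h_eq: "h y = integral {0..y} k" if "y \<in> {0..1}" for y
    unfolding h_def using that k by (intro integral_cong) auto
  have h': "(h has_real_derivative k y) (at y within {0..1})" if "y \<in> {0..1}" for y
  proof -
    have "continuous_on {0..1} k" by (rule DERIV_continuous_on) (rule k')
    then have "((\<lambda>y. integral {0..y} k) has_real_derivative k y) (at y within {0..1})"
      using that by (intro integral_has_real_derivative) auto
    then show ?thesis using h_eq that
      by (subst has_field_derivative_cong_eventually[where g = "\<lambda>y. integral {0..y} k"])
        (auto simp: eventually_at_filter)
  qed
  have fact: "real g * fact (g - 1) = fact g" using g by (simp add: fact_reduce)
  have "\<exists>c. \<forall>y\<in>{0..1}. y - 2 * h y - 2 * y ^ g / fact g - k y = c"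
  proof (rule has_field_derivative_zero_constant)
    fix y :: real assume y: "y \<in> {0..1}"
    have "2 * (real g * y ^ (g - 1)) / fact g = 2 * y ^ (g - 1) / fact (g - 1)"
      using g by (simp add: fact[symmetric])
    moreover have "((\<lambda>y. y - 2 * h y - 2 * y ^ g / fact g - k y) has_real_derivative
        1 - 2 * k y - 2 * (real g * y ^ (g - 1)) / fact g - (1 - 2 * k y - 2 * y ^ (g - 1) / fact (g - 1)))
        (at y within {0..1})"
      by (rule derivative_eq_intros h' k' y refl | simp)+
    ultimately show "((\<lambda>y. y - 2 * h y - 2 * y ^ g / fact g - k y) has_real_derivative 0) (at y within {0..1})"
      by simp
  qed simp
  then obtain c where c: "y - 2 * h y - 2 * y ^ g / fact g - k y = c" if "y \<in> {0..1}" for y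
    by blast
  have "c = 0" using c[of 0] g by (simp add: h_def k_def J_def power_0_left)
  then have "k y = y - 2 * h y - odd_cycle_loss (enat g) y"
    using c[OF y] by (simp add: odd_cycle_loss_def)
  then show ?thesis using h'[OF y] by simp
qed

lemma odd_cycle_loss_bounds:
  assumes g: "g = \<infinity> \<or> (\<exists>k. g = enat k \<and> odd k \<and> 3 \<le> k)"
  shows "y \<in> {0..1} \<Longrightarrow> 0 \<le> odd_cycle_loss g y"
    and "y \<in> {0..1} \<Longrightarrow> odd_cycle_loss g y \<le> y ^ 3 / 3"
    and "0 \<le> y \<Longrightarrow> y \<le> z \<Longrightarrow> z \<le> 1 \<Longrightarrow> odd_cycle_loss g y \<le> odd_cycle_loss g z"
proof -
  show "y \<in> {0..1} \<Longrightarrow> 0 \<le> odd_cycle_loss g y"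
    by (auto simp: odd_cycle_loss_def split: enat.splits)
  show "0 \<le> y \<Longrightarrow> y \<le> z \<Longrightarrow> z \<le> 1 \<Longrightarrow> odd_cycle_loss g y \<le> odd_cycle_loss g z"
    by (auto simp: odd_cycle_loss_def split: enat.splits intro!: divide_right_mono power_mono)
  assume y: "y \<in> {0..1}"
  show "odd_cycle_loss g y \<le> y ^ 3 / 3"
  proof (cases g)
    case (enat k)
    then have k: "3 \<le> k" using g by simp
    have "2 * (y ^ k / fact k) \<le> 2 * (y ^ 3 / fact 3)"
      using y k by (intro mult_left_mono frac_le power_decreasing fact_mono) auto
    then show ?thesis by (simp add: odd_cycle_loss_def enat fact_numeral)
  qed (use y in \<open>simp add: odd_cycle_loss_def\<close>)
qed

lemma alpha_equation:
  assumes g: "g = \<infinity> \<or> (\<exists>k. g = enat k \<and> odd k \<and> 3 \<le> k)"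
  obtains h where "limit_equation h (odd_cycle_loss g)" "alpha g = 2 * h 1"
proof (cases g)
  case (enat k)
  then have k: "odd k" "3 \<le> k" using g by auto
  let ?h = "\<lambda>y. integral {0..y} (\<lambda>z. c_fun k z * z)"
  have "limit_equation ?h (odd_cycle_loss g)"
    using odd_cycle_loss_bounds[OF g] c_fun_equation[OF k] by unfold_locales (auto simp: enat)
  then show ?thesis using that[of ?h] by (simp add: alpha_def enat)
next
  case infinity
  \<comment> \<open>The solution of h' = y - 2 h with initial value 0, which is the equation without
    odd cycles.\<close>
  let ?h = "\<lambda>y::real. y / 2 - 1 / 4 + exp (- 2 * y) / 4"
  have "limit_equation ?h (odd_cycle_loss g)"
  proof
    fix y :: real assume "y \<in> {0..1}"
    show "(?h has_real_derivative y - 2 * ?h y - odd_cycle_loss g y) (at y within {0..1})"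
      by (auto intro!: derivative_eq_intros simp: odd_cycle_loss_def infinity field_simps)
  qed (use odd_cycle_loss_bounds[OF g] in auto)
  then show ?thesis using that[of ?h] by (simp add: alpha_def infinity field_simps)
qed

text \<open>A lower bound that is uniform in \<open>g\<close> allows additive errors to be absorbed
  in a factor 1 - \<epsilon>.\<close>

lemma alpha_ge:
  assumes g: "g = \<infinity> \<or> (\<exists>k. g = enat k \<and> odd k \<and> 3 \<le> k)"
  shows "1 / 3 \<le> alpha g"
proof -
  obtain h where "limit_equation h (odd_cycle_loss g)" "alpha g = 2 * h 1"
    by (rule alpha_equation[OF g])
  moreover from this have "1 / 6 \<le> h 1" using limit_equation.h_ge[of h "odd_cycle_loss g" 1] by simp
  ultimately show ?thesis by simp
qed

section \<open>The laws of phases, choices and coins\<close>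

lemma prob_pair_pmf_Times:
  "measure_pmf.prob (pair_pmf p q) (A \<times> B) = measure_pmf.prob p A * measure_pmf.prob q B"
proof -
  have "emeasure (pair_pmf p q) (A \<times> B) = (\<integral>\<^sup>+a. \<integral>\<^sup>+b. indicator A a * indicator B b \<partial>q \<partial>p)"
    by (subst nn_integral_indicator[symmetric])
      (simp_all add: nn_integral_pair_pmf' indicator_times del: nn_integral_indicator)
  also have "\<dots> = emeasure p A * emeasure q B"
    by (simp add: nn_integral_cmult nn_integral_multc)
  finally show ?thesis
    by (simp add: measure_pmf.emeasure_eq_measure flip: ennreal_mult)
qed

lemma Pi_pmf_pair:
  assumes "finite A"
  shows "Pi_pmf A (d, d') (\<lambda>v. pair_pmf (p v) (q v)) =
    map_pmf (\<lambda>(f, g) v. (f v, g v)) (pair_pmf (Pi_pmf A d p) (Pi_pmf A d' q))"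
proof (rule pmf_eqI)
  fix h :: "'a \<Rightarrow> 'b \<times> 'c"
  let ?m = "\<lambda>(f :: 'a \<Rightarrow> 'b, g :: 'a \<Rightarrow> 'c) v. (f v, g v)"
  have inj: "inj ?m" by (auto simp: inj_on_def fun_eq_iff)
  have h: "h = ?m (fst \<circ> h, snd \<circ> h)" by auto
  have "pmf (map_pmf ?m (pair_pmf (Pi_pmf A d p) (Pi_pmf A d' q))) h =
      pmf (Pi_pmf A d p) (fst \<circ> h) * pmf (Pi_pmf A d' q) (snd \<circ> h)"
    by (subst h, subst pmf_map_inj'[OF inj]) (simp add: pmf_pair)
  also have "\<dots> = pmf (Pi_pmf A (d, d') (\<lambda>v. pair_pmf (p v) (q v))) h"
  proof -
    have "pmf (pair_pmf (p v) (q v)) (h v) = pmf (p v) (fst (h v)) * pmf (q v) (snd (h v))" for v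
      using pmf_pair[of "p v" "q v" "fst (h v)" "snd (h v)"] by simp
    moreover have "(\<forall>v. v \<notin> A \<longrightarrow> h v = (d, d')) \<longleftrightarrow>
        (\<forall>v. v \<notin> A \<longrightarrow> fst (h v) = d) \<and> (\<forall>v. v \<notin> A \<longrightarrow> snd (h v) = d')"
      by (auto simp: prod_eq_iff)
    ultimately show ?thesis by (auto simp: pmf_Pi[OF assms] prod.distrib)
  qed
  finally show "pmf (Pi_pmf A (d, d') (\<lambda>v. pair_pmf (p v) (q v))) h =
     pmf (map_pmf ?m (pair_pmf (Pi_pmf A d p) (Pi_pmf A d' q))) h" by simp
qed

lemma prob_pair_pmf_le:
  assumes "\<And>a. measure_pmf.prob q {b. (a, b) \<in> S} \<le> c" "0 \<le> c"
  shows "measure_pmf.prob (pair_pmf p q) S \<le> c"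
proof -
  have "emeasure (pair_pmf p q) S = (\<integral>\<^sup>+a. emeasure q {b. (a, b) \<in> S} \<partial>p)"
  proof -
    have "emeasure (pair_pmf p q) S = (\<integral>\<^sup>+a. \<integral>\<^sup>+b. indicator S (a, b) \<partial>q \<partial>p)"
      by (simp flip: nn_integral_pair_pmf')
    also have "\<dots> = (\<integral>\<^sup>+a. \<integral>\<^sup>+b. indicator {b. (a, b) \<in> S} b \<partial>q \<partial>p)"
      by (simp add: indicator_def)
    finally show ?thesis by simp
  qed
  also have "\<dots> \<le> (\<integral>\<^sup>+a. ennreal c \<partial>p)"
    using assms by (intro nn_integral_mono) (simp add: measure_pmf.emeasure_eq_measure)
  also have "\<dots> = ennreal c" by (simp add: measure_pmf.emeasure_space_1[simplified])
  finally show ?thesis using assms(2) by (simp add: measure_pmf.emeasure_eq_measure)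
qed

lemma power_Suc_ge: "0 \<le> k \<Longrightarrow> k ^ Suc m + real (Suc m) * k ^ m \<le> (k + 1) ^ Suc m" for k :: real
proof (induction m)
  case (Suc m)
  have "k ^ Suc (Suc m) + real (Suc (Suc m)) * k ^ Suc m \<le> (k + 1) * (k ^ Suc m + real (Suc m) * k ^ m)"
    using Suc.prems by (simp add: algebra_simps)
  also have "\<dots> \<le> (k + 1) * (k + 1) ^ Suc m"
    using Suc by (intro mult_left_mono) auto
  finally show ?case by simp
qed simp

text \<open>A left Riemann sum of an increasing function lies below its integral. Hence phases obey
  the same bound as continuous times in \<open>prob_decreasing\<close>, with no discretisation
  error.\<close>

lemma sum_powers_le: "(\<Sum>j<k. real j ^ m) \<le> real k ^ Suc m / Suc m"
proof (induction k)
  case (Suc k)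
  have "(\<Sum>j<Suc k. real j ^ m) \<le> (real k ^ Suc m + real (Suc m) * real k ^ m) / Suc m"
    using Suc by (simp add: add_divide_distrib)
  also have "\<dots> \<le> real (Suc k) ^ Suc m / Suc m"
    using power_Suc_ge[of "real k" m] by (intro divide_right_mono) (auto simp: add.commute)
  finally show ?case .
qed simp

lemma decreasing_cong: "(\<And>w. w \<in> set ws \<Longrightarrow> Y w = Y' w) \<Longrightarrow> decreasing Y ws = decreasing Y' ws"
  by (induction ws) (auto simp: decreasing_def)

text \<open>Given the phase y < k of the first vertex, the others have to decrease strictly below y;
  averaging the inductive bound over y is the Riemann sum of \<open>sum_powers_le\<close>.\<close>

lemma prob_decreasing:
  fixes k T :: nat
  assumes T: "0 < T" and "k \<le> T" "distinct ws" "finite A"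
  shows "measure_pmf.prob (Pi_pmf A T (\<lambda>_. pmf_of_set {..<T}))
           {Y. decreasing Y ws \<and> (ws = [] \<or> Y (hd ws) < k)} \<le> (k / T) ^ length ws / fact (length ws)"
  using assms(2-)
proof (induction ws arbitrary: k A)
  case (Cons w ws)
  let ?p = "\<lambda>_::nat. pmf_of_set {..<T}"
  let ?S = "{Y. decreasing Y (w # ws) \<and> (w # ws = [] \<or> Y (hd (w # ws)) < k)}"
  let ?m = "length ws"
  show ?case
  proof (cases "w \<in> A")
    case False
    \<comment> \<open>A vertex outside \<open>A\<close> has the default phase \<open>T\<close>,
      which is not below \<open>k\<close>.\<close>
    have "measure_pmf.prob (Pi_pmf A T ?p) ?S = 0"
    proof -
      have "set_pmf (Pi_pmf A T ?p) \<inter> ?S = {}"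
        using set_Pi_pmf_subset[OF Cons.prems(3), of T ?p] False Cons.prems(1) by auto
      then show ?thesis by (simp only: measure_pmf_zero_iff)
    qed
    then show ?thesis by (simp only:) simp
  next
    case True
    let ?A = "A - {w}"
    have "emeasure (Pi_pmf A T ?p) ?S =
        (\<integral>\<^sup>+y. emeasure (Pi_pmf ?A T ?p) {Y. Y(w := y) \<in> ?S} \<partial>pmf_of_set {..<T})"
      using Pi_pmf_insert'[of ?A w T ?p] Cons.prems True
      by (simp add: insert_absorb indicator_def flip: nn_integral_indicator)
    also have "\<dots> \<le> (\<integral>\<^sup>+y. ennreal (if y < k then (real y / T) ^ ?m / fact ?m else 0) \<partial>pmf_of_set {..<T})"
    proof (rule nn_integral_mono)
      fix y
      show "emeasure (Pi_pmf ?A T ?p) {Y. Y(w := y) \<in> ?S} \<le> ennreal (if y < k then (real y / T) ^ ?m / fact ?m else 0)"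
      proof (cases "y < k")
        case True
        have dec: "decreasing (Y(w := y)) ws = decreasing Y ws" for Y
          using Cons.prems(2) by (intro decreasing_cong) auto
        have "{Y. Y(w := y) \<in> ?S} \<subseteq> {Y. decreasing Y ws \<and> (ws = [] \<or> Y (hd ws) < y)}"
          using Cons.prems(2) by (auto simp: decreasing_Cons dec split: if_splits)
        then have "emeasure (Pi_pmf ?A T ?p) {Y. Y(w := y) \<in> ?S} \<le>
            emeasure (Pi_pmf ?A T ?p) {Y. decreasing Y ws \<and> (ws = [] \<or> Y (hd ws) < y)}"
          by (intro emeasure_mono) auto
        also have "\<dots> \<le> ennreal ((real y / T) ^ ?m / fact ?m)"
          using Cons.IH[of y ?A] Cons.prems True
          by (simp add: measure_pmf.emeasure_eq_measure)
        finally show ?thesis using True by simp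
      qed simp
    qed
    also have "\<dots> = (\<Sum>y<T. ennreal (if y < k then (real y / T) ^ ?m / fact ?m else 0) * ennreal (1 / T))"
      using T by (subst nn_integral_measure_pmf_support[of "{..<T}"]) (auto simp: pmf_of_set set_pmf_of_set lessThan_empty_iff)
    also have "\<dots> = ennreal (\<Sum>y<T. (if y < k then (real y / T) ^ ?m / fact ?m else 0) * (1 / T))"
      by (subst sum_ennreal[symmetric]) (auto simp flip: ennreal_mult intro!: sum.cong)
    also have "(\<Sum>y<T. (if y < k then (real y / T) ^ ?m / fact ?m else 0) * (1 / T)) =
        (\<Sum>y<k. (real y / T) ^ ?m / fact ?m * (1 / T))"
      using Cons.prems(1) by (intro sum.mono_neutral_cong_right) auto
    also have "\<dots> = (\<Sum>y<k. real y ^ ?m) / (fact ?m * real T ^ Suc ?m)"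
      by (simp add: sum_divide_distrib power_divide field_simps)
    also have "\<dots> \<le> (real k ^ Suc ?m / Suc ?m) / (fact ?m * real T ^ Suc ?m)"
      by (intro divide_right_mono sum_powers_le) auto
    also have "\<dots> = (k / T) ^ length (w # ws) / fact (length (w # ws))"
      by (simp add: power_divide field_simps)
    finally show ?thesis by (simp add: measure_pmf.emeasure_eq_measure ennreal_leI)
  qed
qed simp

locale rcrs_input =
  fixes n :: nat and E :: "nat set set" and x :: "nat set \<Rightarrow> real" and T :: nat
  assumes graph: "graph n E" and fm: "fractional_matching n E x" and T: "0 < T"
begin

text \<open>Extending the weights by 0 off the edges lets sums over neighbours run over all
  vertices.\<close>

definition xv :: "nat \<Rightarrow> nat \<Rightarrow> real" where
  "xv u v = (if {u, v} \<in> E then x {u, v} else 0)"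

lemma xv_commute: "xv u v = xv v u"
  by (simp add: xv_def insert_commute)

lemma xv_nonneg: "0 \<le> xv u v"
  using fm by (auto simp: xv_def fractional_matching_def)

lemma edge_less: "{u, v} \<in> E \<Longrightarrow> u < n \<and> v < n \<and> u \<noteq> v"
  using graph by (fastforce simp: graph_def doubleton_eq_iff)

lemma pmf_choice: "v < n \<Longrightarrow> pmf (choice_pmf E x v) (Some u) = xv u v"
  using pmf_choice_pmf(1)[OF graph fm] by (simp add: neighbours_def xv_def)

lemma xv_outside: "\<not> u < n \<Longrightarrow> xv u v = 0" "\<not> v < n \<Longrightarrow> xv u v = 0"
  using edge_less by (auto simp: xv_def)

lemma choice_support: "v < n \<Longrightarrow> r \<in> set_pmf (choice_pmf E x v) \<Longrightarrow> r = Some u \<Longrightarrow> 0 < xv u v"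
  using pmf_choice[of v u] pmf_positive[of r "choice_pmf E x v"] by auto

lemma sum_xv: assumes "v < n" shows "(\<Sum>u<n. xv u v) \<le> 1"
proof -
  have "(\<Sum>u<n. xv u v) = (\<Sum>a\<in>Some ` {..<n}. pmf (choice_pmf E x v) a)"
    by (simp add: sum.reindex pmf_choice assms)
  also have "\<dots> = measure_pmf.prob (choice_pmf E x v) (Some ` {..<n})"
    by (rule measure_measure_pmf_finite[symmetric]) simp
  finally show ?thesis by simp
qed

lemma realises_choice: "v < n \<Longrightarrow> realises (s_draw (pick_upto (\<lambda>u. xv u v) n)) (choice_pmf E x v)"
  by (rule realises_pick) (auto simp: xv_nonneg sum_xv pmf_choice xv_outside)

text \<open>The coin is drawn together with the phase and the choice, whether or not the chosen
  vertex turns out to be free; in this way the data of distinct vertices are independent.\<close>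

definition vertex_pmf :: "(nat \<Rightarrow> nat option \<Rightarrow> nat \<Rightarrow> real) \<Rightarrow> nat \<Rightarrow> (nat \<times> nat option \<times> bool) pmf" where
  "vertex_pmf \<theta> v = do {
     y \<leftarrow> pmf_of_set {..<T};
     r \<leftarrow> choice_pmf E x v;
     b \<leftarrow> bernoulli_pmf (\<theta> y r v);
     return_pmf (y, r, b)}"

definition data_pmf :: "nat set \<Rightarrow> (nat \<Rightarrow> nat option \<Rightarrow> nat \<Rightarrow> real) \<Rightarrow> data pmf" where
  "data_pmf A \<theta> = Pi_pmf A (absent T) (vertex_pmf \<theta>)"

abbreviation all_data where "all_data \<theta> \<equiv> data_pmf {..<n} \<theta>"

definition free_prob :: "(nat \<Rightarrow> nat option \<Rightarrow> nat \<Rightarrow> real) \<Rightarrow> nat \<Rightarrow> nat \<Rightarrow> nat \<Rightarrow> real" where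
  "free_prob \<theta> k u v =
     measure_pmf.prob (data_pmf ({..<n} - {v}) \<theta>) {D. phase D u < k \<and> u \<notin> busy D k}"

lemma prob_phase_less: "k \<le> T \<Longrightarrow> measure_pmf.prob (pmf_of_set {..<T}) {..<k} = k / T"
  using T by (subst measure_pmf_of_set) (auto simp: min_def Int_absorb1)

lemma map_vertex: "map_pmf (\<lambda>(y, r, b). (y, r)) (vertex_pmf \<theta> v) = pair_pmf (pmf_of_set {..<T}) (choice_pmf E x v)"
  by (simp add: vertex_pmf_def map_bind_pmf pair_pmf_def)

lemma map_vertex_phase: "map_pmf fst (vertex_pmf \<theta> v) = pmf_of_set {..<T}"
proof -
  have "map_pmf fst (vertex_pmf \<theta> v) = map_pmf fst (map_pmf (\<lambda>(y, r, b). (y, r)) (vertex_pmf \<theta> v))"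
    by (simp add: map_pmf_comp case_prod_unfold)
  then show ?thesis by (simp only: map_vertex map_fst_pair_pmf)
qed

lemma set_phase: "set_pmf (pmf_of_set {..<T}) = {..<T}"
  using T by (intro set_pmf_of_set) auto

lemma pmf_phase: "k < T \<Longrightarrow> pmf (pmf_of_set {..<T}) k = 1 / T"
  using T by (subst pmf_of_set) auto

lemma vertex_support:
  "(y, r, b) \<in> set_pmf (vertex_pmf \<theta> v) \<Longrightarrow> y < T \<and> r \<in> set_pmf (choice_pmf E x v)"
  by (auto simp: vertex_pmf_def set_phase)

lemma data_support:
  assumes "D \<in> set_pmf (data_pmf A \<theta>)" "A \<subseteq> {..<n}"
  shows "v \<notin> A \<Longrightarrow> D v = absent T" and "v \<in> A \<Longrightarrow> phase D v < T"
    and "target D v = Some u \<Longrightarrow> 0 < xv u v"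
proof -
  have fin: "finite A" using assms(2) finite_subset by blast
  have *: "D v \<in> set_pmf (vertex_pmf \<theta> v)" if "v \<in> A" for v
    using assms(1) that fin by (auto simp: data_pmf_def set_Pi_pmf PiE_dflt_def)
  show out: "v \<notin> A \<Longrightarrow> D v = absent T"
    using assms(1) fin by (auto simp: data_pmf_def set_Pi_pmf PiE_dflt_def)
  show "v \<in> A \<Longrightarrow> phase D v < T"
    using * vertex_support by (metis prod.collapse)
  assume t: "target D v = Some u"
  then have v: "v \<in> A" using out by (cases "v \<in> A") auto
  then have "Some u \<in> set_pmf (choice_pmf E x v)"
    using * vertex_support t by (metis prod.collapse)
  then show "0 < xv u v" using v assms(2) choice_support by auto
qed

lemma data_split:
  assumes "v \<in> A" "finite A"
  shows "data_pmf A \<theta> = map_pmf (\<lambda>(d, D). D(v := d)) (pair_pmf (vertex_pmf \<theta> v) (data_pmf (A - {v}) \<theta>))"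
  using Pi_pmf_insert[of "A - {v}" v "absent T" "vertex_pmf \<theta>"] assms
  by (simp add: data_pmf_def insert_absorb)

lemma pmf_vertex:
  "pmf (vertex_pmf \<theta> v) (y, r, b) =
     pmf (pmf_of_set {..<T}) y * (pmf (choice_pmf E x v) r * pmf (bernoulli_pmf (\<theta> y r v)) b)"
proof -
  let ?p = "pmf_of_set {..<T}" and ?q = "choice_pmf E x v" and ?f = "\<lambda>y r. bernoulli_pmf (\<theta> y r v)"
  have ind: "indicator {(y, r, b)} (y', r', b') = (indicator {y} y' * (indicator {r} r' * indicator {b} b') :: ennreal)"
    for y' r' b' by (simp add: indicator_def)
  have "emeasure (vertex_pmf \<theta> v) {(y, r, b)} =
      (\<integral>\<^sup>+y'. indicator {y} y' * (\<integral>\<^sup>+r'. indicator {r} r' * emeasure (?f y' r') {b} \<partial>?q) \<partial>?p)"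
    unfolding vertex_pmf_def
    by (subst nn_integral_indicator[symmetric])
      (simp_all add: ind nn_integral_cmult nn_integral_return del: nn_integral_indicator nn_integral_bernoulli_pmf,
       simp)
  also have "\<dots> = (\<integral>\<^sup>+y'. indicator {y} y' * (\<integral>\<^sup>+r'. indicator {r} r' * emeasure (?f y r) {b} \<partial>?q) \<partial>?p)"
    by (intro nn_integral_cong) (auto simp: indicator_def intro!: nn_integral_cong)
  also have "\<dots> = emeasure ?p {y} * (emeasure ?q {r} * emeasure (?f y r) {b})"
    by (simp add: nn_integral_multc)
  finally show ?thesis
    by (simp add: emeasure_pmf_single flip: ennreal_mult)
qed

text \<open>A vertex \<open>v\<close> that arrives in phase k has had no influence on the state
  before phase k. So the event is the conjunction of two independent ones: the data of
  \<open>v\<close> are \<open>(k, Some u, True)\<close>, and \<open>u\<close> is free in the process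
  without \<open>v\<close>.\<close>

lemma prob_sel:
  assumes v: "v < n" and k: "k < T" and \<theta>: "0 \<le> \<theta> k (Some u) v" "\<theta> k (Some u) v \<le> 1" and uv: "u \<noteq> v"
  shows "measure_pmf.prob (all_data \<theta>) {D. sel D k u v} = xv u v * \<theta> k (Some u) v * free_prob \<theta> k u v / T"
proof -
  let ?P = "data_pmf ({..<n} - {v}) \<theta>"
  let ?G = "{D. phase D u < k \<and> u \<notin> busy D k}"
  have "measure_pmf.prob (all_data \<theta>) {D. sel D k u v} =
      measure_pmf.prob (pair_pmf (vertex_pmf \<theta> v) ?P) {(d, D). sel (D(v := d)) k u v}"
    by (subst data_split[of v]) (use v in \<open>simp_all add: vimage_def case_prod_unfold\<close>)
  also have "\<dots> = measure_pmf.prob (pair_pmf (vertex_pmf \<theta> v) ?P) ({(k, Some u, True)} \<times> ?G)"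
  proof (rule measure_pmf.finite_measure_eq_AE)
    have "busy (D(v := d)) k = busy D k" if "D \<in> set_pmf ?P" "fst d = k" for D d
    proof -
      have "D v = absent T" using data_support(1)[OF that(1), of v] by auto
      then have "D = (D(v := d))(v := absent T)" by auto
      then show ?thesis using busy_remove[of k "D(v := d)" v T] that(2) k by simp
    qed
    then show "AE z in measure_pmf (pair_pmf (vertex_pmf \<theta> v) ?P).
       (z \<in> {(d, D). sel (D(v := d)) k u v}) = (z \<in> {(k, Some u, True)} \<times> ?G)"
      using uv by (auto simp: AE_measure_pmf_iff sel_def)
  qed simp_all
  also have "\<dots> = measure_pmf.prob (vertex_pmf \<theta> v) {(k, Some u, True)} * measure_pmf.prob ?P ?G"
    by (rule prob_pair_pmf_Times)
  also have "measure_pmf.prob (vertex_pmf \<theta> v) {(k, Some u, True)} = xv u v * \<theta> k (Some u) v / T"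
    using k \<theta> v by (simp add: measure_pmf_single pmf_vertex pmf_choice pmf_phase)
  finally show ?thesis by (simp add: free_prob_def)
qed

lemma map_data_pair:
  assumes "finite A"
  shows "map_pmf (\<lambda>D. (target D, phase D)) (data_pmf A \<theta>) =
    pair_pmf (Pi_pmf A None (choice_pmf E x)) (Pi_pmf A T (\<lambda>_. pmf_of_set {..<T}))"
    (is "?lhs = pair_pmf ?F ?Y")
proof -
  have "map_pmf (\<lambda>D v. (target D v, phase D v)) (data_pmf A \<theta>) =
      Pi_pmf A (None, T) (\<lambda>v. map_pmf (\<lambda>(y, r, b). (r, y)) (vertex_pmf \<theta> v))"
    unfolding data_pmf_def
    by (subst Pi_pmf_map[where dflt = "absent T"]) (auto simp: assms case_prod_unfold intro!: map_pmf_cong)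
  also have "(\<lambda>v. map_pmf (\<lambda>(y, r, b). (r, y)) (vertex_pmf \<theta> v)) =
      (\<lambda>v. pair_pmf (choice_pmf E x v) (pmf_of_set {..<T}))"
  proof
    fix v
    have "map_pmf (\<lambda>(y, r, b). (r, y)) (vertex_pmf \<theta> v) =
        map_pmf (\<lambda>(y, r). (r, y)) (map_pmf (\<lambda>(y, r, b). (y, r)) (vertex_pmf \<theta> v))"
      by (simp add: map_pmf_comp case_prod_unfold)
    then show "map_pmf (\<lambda>(y, r, b). (r, y)) (vertex_pmf \<theta> v) = pair_pmf (choice_pmf E x v) (pmf_of_set {..<T})"
      by (simp only: map_vertex) (subst pair_commute_pmf, simp)
  qed
  also have "Pi_pmf A (None, T) \<dots> = map_pmf (\<lambda>(f, g) v. (f v, g v)) (pair_pmf ?F ?Y)"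
    by (rule Pi_pmf_pair[OF assms])
  finally have "map_pmf (\<lambda>h. (fst \<circ> h, snd \<circ> h)) (map_pmf (\<lambda>D v. (target D v, phase D v)) (data_pmf A \<theta>)) =
      map_pmf (\<lambda>h. (fst \<circ> h, snd \<circ> h)) (map_pmf (\<lambda>(f, g) v. (f v, g v)) (pair_pmf ?F ?Y))"
    by (rule arg_cong)
  then show ?thesis by (simp add: map_pmf_comp o_def case_prod_unfold)
qed

lemma prob_phase_u: "u < n \<Longrightarrow> k \<le> T \<Longrightarrow> measure_pmf.prob (all_data \<theta>) {D. phase D u < k} = k / T"
proof -
  assume u: "u < n" "k \<le> T"
  have "map_pmf (\<lambda>D. fst (D u)) (all_data \<theta>) = map_pmf fst (map_pmf (\<lambda>D. D u) (all_data \<theta>))"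
    by (simp add: map_pmf_comp)
  also have "\<dots> = pmf_of_set {..<T}"
    using u by (simp add: data_pmf_def Pi_pmf_component map_vertex_phase)
  finally have "measure_pmf.prob (map_pmf (\<lambda>D. fst (D u)) (all_data \<theta>)) {..<k} = k / T"
    using prob_phase_less u by simp
  then show ?thesis by (simp add: vimage_def)
qed

text \<open>
  Given the choices of all vertices, there is at most one path of each of the two kinds, and its
  at least \<open>g\<close> vertices must arrive in a prescribed order.
\<close>
lemma prob_alternating_path:
  assumes k: "k \<le> T" and uv: "0 < xv u v" and g: "odd_girth E x = g"
  shows "measure_pmf.prob (all_data \<theta>)
     {D. \<exists>ws. odd (length ws) \<and> decreasing (phase D) ws \<and> phase D (hd ws) < k \<and>
        (path_to (target D) v u ws \<or> path_into (target D) v u ws)} \<le> odd_cycle_loss g (k / T)"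
proof -
  let ?P = "\<lambda>F Y ws. odd (length ws) \<and> decreasing Y ws \<and> Y (hd ws) < k \<and>
        (path_to F v u ws \<or> path_into F v u ws)"
  have uvE: "{u, v} \<in> {e\<in>E. x e \<noteq> 0}" and ne: "u \<noteq> v"
    using uv edge_less by (auto simp: xv_def split: if_splits)
  \<comment> \<open>Almost surely all choices are edges of positive weight, so the cycle closed by
    the path is one that the odd girth takes into account.\<close>
  have len: "g \<le> enat (length ws)" if "D \<in> set_pmf (all_data \<theta>)" "?P (target D) (phase D) ws" for D ws
  proof -
    have "{a, b} \<in> {e\<in>E. x e \<noteq> 0}" if "target D a = Some b" for a b
      using data_support(3)[OF \<open>D \<in> _\<close> _ that] by (auto simp: xv_def insert_commute split: if_splits)
    then show ?thesis
      using that uvE ne unfolding g[symmetric] by (intro odd_girth_le[where F = "target D"]) (auto dest: decreasing_distinct)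
  qed
  show ?thesis
  proof (cases g)
    case infinity
    have "measure_pmf.prob (all_data \<theta>) {D. \<exists>ws. ?P (target D) (phase D) ws} = 0"
      using len infinity by (subst measure_pmf_zero_iff) auto
    then show ?thesis by (simp add: odd_cycle_loss_def infinity)
  next
    case (enat m)
    let ?y = "real k / T"
    let ?S = "\<lambda>path. {(F, Y). \<exists>ws. m \<le> length ws \<and> decreasing Y ws \<and> Y (hd ws) < k \<and> path F v u ws}"
    let ?Q = "pair_pmf (Pi_pmf {..<n} None (choice_pmf E x)) (Pi_pmf {..<n} T (\<lambda>_. pmf_of_set {..<T}))"
    have y: "0 \<le> ?y" "?y \<le> 1" using k T by auto
    have *: "measure_pmf.prob ?Q (?S path) \<le> ?y ^ m / fact m"
      if unique: "\<And>F ws ws'. path F v u ws \<Longrightarrow> path F v u ws' \<Longrightarrow> distinct ws \<Longrightarrow> distinct ws' \<Longrightarrow> ws = ws'"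
      for path
    proof (rule prob_pair_pmf_le)
      fix F
      show "measure_pmf.prob (Pi_pmf {..<n} T (\<lambda>_. pmf_of_set {..<T})) {Y. (F, Y) \<in> ?S path} \<le> ?y ^ m / fact m"
      proof (cases "\<exists>ws. m \<le> length ws \<and> distinct ws \<and> path F v u ws")
        case True
        then obtain ws where ws: "m \<le> length ws" "distinct ws" "path F v u ws" by blast
        have "{Y. (F, Y) \<in> ?S path} \<subseteq> {Y. decreasing Y ws \<and> (ws = [] \<or> Y (hd ws) < k)}"
        proof
          fix Y assume "Y \<in> {Y. (F, Y) \<in> ?S path}"
          then obtain ws' where ws': "decreasing Y ws'" "path F v u ws'" "Y (hd ws') < k" by blast
          then have "ws' = ws" using unique[of F ws' ws] ws decreasing_distinct by blast
          then show "Y \<in> {Y. decreasing Y ws \<and> (ws = [] \<or> Y (hd ws) < k)}" using ws' by simp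
        qed
        then have "measure_pmf.prob (Pi_pmf {..<n} T (\<lambda>_. pmf_of_set {..<T})) {Y. (F, Y) \<in> ?S path} \<le>
            measure_pmf.prob (Pi_pmf {..<n} T (\<lambda>_. pmf_of_set {..<T}))
              {Y. decreasing Y ws \<and> (ws = [] \<or> Y (hd ws) < k)}"
          by (intro measure_pmf.finite_measure_mono) auto
        also have "\<dots> \<le> ?y ^ length ws / fact (length ws)"
          by (rule prob_decreasing) (use T k ws in auto)
        also have "\<dots> \<le> ?y ^ m / fact m"
          using y ws(1) by (intro frac_le power_decreasing fact_mono) auto
        finally show ?thesis .
      next
        case False
        then have "{Y. (F, Y) \<in> ?S path} = {}" by (auto dest: decreasing_distinct)
        then show ?thesis by (simp only: measure_empty) (use y in simp)
      qed
    qed (use y in auto)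
    have "measure_pmf.prob (all_data \<theta>) {D. \<exists>ws. ?P (target D) (phase D) ws} \<le>
        measure_pmf.prob (all_data \<theta>) {D. (target D, phase D) \<in> ?S path_to \<union> ?S path_into}"
    proof (rule measure_pmf.finite_measure_mono_AE)
      show "AE D in measure_pmf (all_data \<theta>). D \<in> {D. \<exists>ws. ?P (target D) (phase D) ws} \<longrightarrow>
          D \<in> {D. (target D, phase D) \<in> ?S path_to \<union> ?S path_into}"
        using len by (fastforce simp: AE_measure_pmf_iff enat)
    qed simp
    also have "\<dots> = measure_pmf.prob (map_pmf (\<lambda>D. (target D, phase D)) (all_data \<theta>)) (?S path_to \<union> ?S path_into)"
      by (simp add: vimage_def)
    also have "\<dots> = measure_pmf.prob ?Q (?S path_to \<union> ?S path_into)"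
      by (simp only: map_data_pair[OF finite_lessThan])
    also have "\<dots> \<le> measure_pmf.prob ?Q (?S path_to) + measure_pmf.prob ?Q (?S path_into)"
      by (rule measure_Un_le) auto
    also have "\<dots> \<le> ?y ^ m / fact m + ?y ^ m / fact m"
      by (intro add_mono *) (auto dest: path_to_unique path_into_unique)
    finally show ?thesis by (simp add: odd_cycle_loss_def enat)
  qed
qed

text \<open>The process without \<open>v\<close> is realised on the data of all vertices, where it
  can be compared with the full process outcome by outcome.\<close>

lemma free_prob_alt:
  assumes "u \<noteq> v"
  shows "free_prob \<theta> k u v =
    measure_pmf.prob (all_data \<theta>) {D. phase D u < k \<and> u \<notin> busy (D(v := absent T)) k}"
  unfolding free_prob_def data_pmf_def
  by (subst Pi_pmf_remove) (use assms in \<open>auto simp: vimage_def\<close>)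

lemma free_prob_bounds: "0 \<le> free_prob \<theta> k u v" "free_prob \<theta> k u v \<le> 1"
  by (simp_all add: free_prob_def)

text \<open>Union bound: if \<open>u\<close> has arrived before phase k, then it is free without
  \<open>v\<close>, or busy with \<open>v\<close> present, or an odd alternating path leads from
  \<open>v\<close> to \<open>u\<close>. The second event is controlled by the rates \<open>K\<close>
  of the earlier phases, since the weights at \<open>u\<close> sum to at most 1.\<close>

lemma free_prob_ge:
  assumes k: "k \<le> T" and uv: "0 < xv u v" and g: "odd_girth E x = g"
    and \<theta>: "\<And>j u v. j < k \<Longrightarrow> 0 \<le> \<theta> j (Some u) v \<and> \<theta> j (Some u) v \<le> 1"
    and K: "\<And>j u v. j < k \<Longrightarrow> 0 < xv u v \<Longrightarrow> \<theta> j (Some u) v * free_prob \<theta> j u v \<le> K j"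
      "\<And>j. j < k \<Longrightarrow> 0 \<le> K j"
  shows "k / T - 2 / T * (\<Sum>j<k. K j) - odd_cycle_loss g (k / T) \<le> free_prob \<theta> k u v"
proof -
  let ?M = "all_data \<theta>"
  let ?bad = "{D. \<exists>ws. odd (length ws) \<and> decreasing (phase D) ws \<and> phase D (hd ws) < k \<and>
        (path_to (target D) v u ws \<or> path_into (target D) v u ws)}"
  have u: "u < n" "v < n" "u \<noteq> v"
    using uv edge_less by (auto simp: xv_def split: if_splits)
  have sel: "measure_pmf.prob ?M {D. sel D j a b} \<le> xv a b * K j / T" if j: "j < k" for j a b
  proof (cases "0 < xv a b")
    case True
    then have ab: "b < n" "a \<noteq> b" using edge_less by (auto simp: xv_def split: if_splits)
    have "xv a b * \<theta> j (Some a) b * free_prob \<theta> j a b \<le> xv a b * K j"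
      using K(1)[OF j True] True by (simp add: mult.assoc)
    moreover have "measure_pmf.prob ?M {D. sel D j a b} = xv a b * \<theta> j (Some a) b * free_prob \<theta> j a b / T"
      using \<theta>[OF j] ab k j by (intro prob_sel) auto
    ultimately show ?thesis by (simp add: divide_right_mono)
  next
    case False
    then have "xv a b = 0" using xv_nonneg[of a b] by linarith
    moreover have "measure_pmf.prob ?M {D. sel D j a b} = 0"
      using False data_support(3)[of _ "{..<n}" \<theta> b a]
      by (subst measure_pmf_zero_iff) (auto simp: sel_def)
    ultimately show ?thesis by simp
  qed
  have "measure_pmf.prob ?M {D. u \<in> busy D k} \<le>
      measure_pmf.prob ?M (\<Union>j<k. \<Union>w<n. {D. sel D j u w} \<union> {D. sel D j w u})"
  proof (rule measure_pmf.finite_measure_mono_AE)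
    have "w < n" if "D \<in> set_pmf ?M" "sel D j u w \<or> sel D j w u" for D j w
      using data_support(3)[OF that(1), of w u] data_support(3)[OF that(1), of u w] that(2) xv_outside
      by (cases "w < n") (auto simp: sel_def)
    then show "AE D in measure_pmf ?M. D \<in> {D. u \<in> busy D k} \<longrightarrow>
        D \<in> (\<Union>j<k. \<Union>w<n. {D. sel D j u w} \<union> {D. sel D j w u})"
      by (fastforce simp: AE_measure_pmf_iff elim!: busyE)
  qed simp
  also have "\<dots> \<le> (\<Sum>j<k. measure_pmf.prob ?M (\<Union>w<n. {D. sel D j u w} \<union> {D. sel D j w u}))"
    by (rule measure_pmf.finite_measure_subadditive_finite) auto
  also have "\<dots> \<le> (\<Sum>j<k. \<Sum>w<n. measure_pmf.prob ?M ({D. sel D j u w} \<union> {D. sel D j w u}))"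
    by (intro sum_mono measure_pmf.finite_measure_subadditive_finite) auto
  \<comment> \<open>The factor 2 arises because \<open>u\<close> may be chosen by \<open>w\<close>
    or choose \<open>w\<close>.\<close>
  also have "\<dots> \<le> (\<Sum>j<k. \<Sum>w<n. xv w u * (2 * K j / T))"
  proof (intro sum_mono)
    fix j w assume j: "j \<in> {..<k}"
    have "measure_pmf.prob ?M ({D. sel D j u w} \<union> {D. sel D j w u}) \<le>
        measure_pmf.prob ?M {D. sel D j u w} + measure_pmf.prob ?M {D. sel D j w u}"
      by (rule measure_Un_le) auto
    also have "\<dots> \<le> xv w u * (2 * K j / T)"
    proof -
      have "xv w u * (2 * K j / T) = xv w u * K j / T + xv w u * K j / T"
        by (simp add: field_simps)
      moreover have "measure_pmf.prob ?M {D. sel D j u w} \<le> xv w u * K j / T"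
        "measure_pmf.prob ?M {D. sel D j w u} \<le> xv w u * K j / T"
        using sel[of j u w] sel[of j w u] j by (simp_all add: xv_commute[of u w])
      ultimately show ?thesis by linarith
    qed
    finally show "measure_pmf.prob ?M ({D. sel D j u w} \<union> {D. sel D j w u}) \<le> xv w u * (2 * K j / T)" .
  qed
  also have "\<dots> = (\<Sum>j<k. (\<Sum>w<n. xv w u) * (2 * K j / T))"
    by (simp only: sum_distrib_right)
  also have "\<dots> \<le> (\<Sum>j<k. 1 * (2 * K j / T))"
    using K(2) u by (intro sum_mono mult_right_mono sum_xv) auto
  also have "\<dots> = 2 / T * (\<Sum>j<k. K j)"
    by (simp add: sum_distrib_left)
  finally have busy: "measure_pmf.prob ?M {D. u \<in> busy D k} \<le> 2 / T * (\<Sum>j<k. K j)" .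
  have bad: "measure_pmf.prob ?M ?bad \<le> odd_cycle_loss g (k / T)"
    by (rule prob_alternating_path[OF k uv g])
  have "k / T = measure_pmf.prob ?M {D. phase D u < k}"
    using prob_phase_u u k by simp
  also have "\<dots> \<le> measure_pmf.prob ?M
      (({D. phase D u < k \<and> u \<notin> busy (D(v := absent T)) k} \<union> {D. u \<in> busy D k}) \<union> ?bad)"
    by (intro measure_pmf.finite_measure_mono) (use remove_vertex[OF u(3) k] in blast, simp)
  also have "\<dots> \<le> measure_pmf.prob ?M ({D. phase D u < k \<and> u \<notin> busy (D(v := absent T)) k} \<union> {D. u \<in> busy D k}) +
      measure_pmf.prob ?M ?bad"
    by (rule measure_Un_le) auto
  also have "\<dots> \<le> measure_pmf.prob ?M {D. phase D u < k \<and> u \<notin> busy (D(v := absent T)) k} +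
      measure_pmf.prob ?M {D. u \<in> busy D k} + measure_pmf.prob ?M ?bad"
    by (intro add_right_mono measure_Un_le) auto
  finally show ?thesis using busy bad free_prob_alt[OF u(3), of \<theta> k] by linarith
qed

text \<open>The state before phase k ignores the coins of later arrivals, and clearing these coins
  makes the two distributions equal. So estimates for phase k made while later rows of the table are
  missing remain correct for the completed table.\<close>

lemma free_prob_cong:
  assumes "k \<le> T" "\<And>j r w. j < k \<Longrightarrow> \<theta> j r w = \<theta>' j r w"
  shows "free_prob \<theta> k u v = free_prob \<theta>' k u v"
proof -
  let ?f = "\<lambda>d :: nat \<times> nat option \<times> bool. (fst d, fst (snd d), snd (snd d) \<and> fst d < k)"
  let ?A = "{..<n} - {v}"
  let ?S = "{D. phase D u < k \<and> u \<notin> busy D k}"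
  have busy: "busy (?f \<circ> D) k = busy D k" for D
    by (rule busy_cong) (auto simp: prod_eq_iff)
  have cut: "bind_pmf (bernoulli_pmf (\<theta> y r w)) (\<lambda>b. return_pmf (y, r, b \<and> y < k)) =
      bind_pmf (bernoulli_pmf (\<theta>' y r w)) (\<lambda>b. return_pmf (y, r, b \<and> y < k))" for y r w
    using assms(2) by (cases "y < k") simp_all
  have "map_pmf ?f (vertex_pmf \<theta> w) = map_pmf ?f (vertex_pmf \<theta>' w)" for w
    unfolding vertex_pmf_def by (simp add: map_bind_pmf cut)
  then have "map_pmf (\<lambda>D. ?f \<circ> D) (data_pmf ?A \<theta>) = map_pmf (\<lambda>D. ?f \<circ> D) (data_pmf ?A \<theta>')"
    unfolding data_pmf_def
    by (subst (1 2) Pi_pmf_map[symmetric, where dflt' = "absent T"]) simp_all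
  then have "measure_pmf.prob (map_pmf (\<lambda>D. ?f \<circ> D) (data_pmf ?A \<theta>)) ?S =
      measure_pmf.prob (map_pmf (\<lambda>D. ?f \<circ> D) (data_pmf ?A \<theta>')) ?S" by (simp only:)
  then show ?thesis by (simp add: free_prob_def busy vimage_def)
qed

end

section \<open>The tables of the scheme\<close>

lemma prob_bind_le:
  assumes "\<And>a. a \<notin> A \<Longrightarrow> measure_pmf.prob (f a) B \<le> c" "0 \<le> c"
  shows "measure_pmf.prob (bind_pmf p f) B \<le> measure_pmf.prob p A + c"
proof -
  have "emeasure (bind_pmf p f) B = (\<integral>\<^sup>+a. emeasure (f a) B \<partial>p)" by simp
  also have "\<dots> \<le> (\<integral>\<^sup>+a. indicator A a + ennreal c \<partial>p)"
  proof (rule nn_integral_mono)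
    fix a
    show "emeasure (f a) B \<le> indicator A a + ennreal c"
      using assms(1)[of a] measure_pmf.prob_le_1[of "f a" B]
      by (cases "a \<in> A") (auto simp: measure_pmf.emeasure_eq_measure intro: order_trans[of _ 1] ennreal_leI)
  qed
  also have "\<dots> = emeasure p A + ennreal c"
    by (subst nn_integral_add) (simp_all add: measure_pmf.emeasure_space_1[simplified])
  finally show ?thesis
    using assms(2) by (simp add: measure_pmf.emeasure_eq_measure flip: ennreal_plus)
qed

lemma bernoulli_0: "bernoulli_pmf 0 = return_pmf False"
  by (rule pmf_eqI) (auto simp: pmf_return indicator_def split: bool.splits)

text \<open>Hoeffding's inequality, weakened through t <= exp t to a rational bound that integer
  parameters can meet without logarithms.\<close>

lemma binomial_concentration:
  assumes "q \<in> {0..1}" "0 < R" "0 < h"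
  shows "measure_pmf.prob (binomial_pmf R q) {m. real h < \<bar>real m - R * q\<bar>} \<le> real R / (real h)\<^sup>2"
proof -
  interpret binomial_distribution R q by unfold_locales fact
  have "measure_pmf.prob (binomial_pmf R q) {m. real h < \<bar>real m - R * q\<bar>} \<le>
      measure_pmf.prob (binomial_pmf R q) {m. \<bar>real m - R * q\<bar> \<ge> real h}"
    by (rule measure_pmf.finite_measure_mono) auto
  also have "\<dots> \<le> 2 * exp (- 2 * (real h)\<^sup>2 / R)"
    using prob_abs_ge[of "real h"] assms by simp
  also have "exp (- 2 * (real h)\<^sup>2 / R) \<le> R / (2 * (real h)\<^sup>2)"
  proof -
    let ?t = "2 * (real h)\<^sup>2 / R"
    have "0 < ?t" using assms by simp
    moreover have "?t \<le> exp ?t" using exp_ge_add_one_self[of ?t] by linarith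
    ultimately have "inverse (exp ?t) \<le> inverse ?t" by (intro le_imp_inverse_le)
    then have "exp (- ?t) \<le> 1 / ?t" by (simp only: exp_minus inverse_eq_divide)
    then show ?thesis by simp
  qed
  finally show ?thesis by simp
qed

type_synonym counts = "nat \<Rightarrow> nat \<Rightarrow> nat"
type_synonym tables = "(nat \<Rightarrow> counts) \<times> (nat \<Rightarrow> nat)"

text \<open>
  For a phase \<open>k\<close>, \<open>fst tab k u v\<close> is the number of simulations without \<open>v\<close> in which \<open>u\<close> has arrived
  before phase \<open>k\<close> and is still free, and \<open>snd tab k\<close> is the smallest of these numbers.
\<close>
locale scheme = rcrs_input +
  fixes R h :: nat
  assumes h: "0 < h" "h \<le> R"
begin

text \<open>\<open>k\<close> is the number of rows already filled; in later phases nothing is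
  accepted. The count is raised by \<open>h\<close> and the minimum lowered by \<open>h\<close>
  (truncated at 0), so that estimates with errors up to \<open>h\<close> never push the selection
  rate above the common level.\<close>

definition accepts :: "tables \<Rightarrow> nat \<Rightarrow> nat \<Rightarrow> nat option \<Rightarrow> nat \<Rightarrow> real \<Rightarrow> bool" where
  "accepts tab k y r v t \<longleftrightarrow> (case r of None \<Rightarrow> False | Some u \<Rightarrow>
     u < n \<and> y < k \<and> real (fst tab y u v + h) * t < real (snd tab y - h))"

definition threshold :: "tables \<Rightarrow> nat \<Rightarrow> nat \<Rightarrow> nat option \<Rightarrow> nat \<Rightarrow> real" where
  "threshold tab k y r v = (case r of None \<Rightarrow> 0 | Some u \<Rightarrow>
     if u < n \<and> y < k then min 1 (real (snd tab y - h) / real (fst tab y u v + h)) else 0)"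

lemma threshold_bounds: "0 \<le> threshold tab k y r v" "threshold tab k y r v \<le> 1"
  by (auto simp: threshold_def split: option.splits)

lemma realises_accepts:
  "realises (s_draw (accepts tab k y r v)) (bernoulli_pmf (threshold tab k y r v))"
proof (cases "\<exists>u. r = Some u \<and> u < n \<and> y < k")
  case False
  then have "accepts tab k y r v = (\<lambda>t. False)" "threshold tab k y r v = 0"
    by (auto simp: accepts_def threshold_def fun_eq_iff split: option.splits)
  then show ?thesis using realises_const[of False] by (simp add: bernoulli_0)
next
  case True
  then obtain u where "r = Some u" "u < n" "y < k" by auto
  then show ?thesis
    using realises_less[of "real (snd tab y - h)" "real (fst tab y u v + h)"] h
    by (simp add: accepts_def[abs_def] threshold_def)
qed

definition s_vertex :: "tables \<Rightarrow> nat \<Rightarrow> nat \<Rightarrow> (nat \<times> nat option \<times> bool) sampler" where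
  "s_vertex tab k v = s_bind (s_draw (phase_upto T T)) (\<lambda>y.
     s_bind (s_draw (pick_upto (\<lambda>u. xv u v) n)) (\<lambda>r.
     s_bind (s_draw (accepts tab k y r v)) (\<lambda>b. s_ret (y, r, b))))"

lemma realises_vertex: "v < n \<Longrightarrow> realises (s_vertex tab k v) (vertex_pmf (threshold tab k) v)"
  unfolding s_vertex_def vertex_pmf_def
  by (intro realises_bind realises_phase[OF T] realises_choice realises_accepts realises_ret)

definition s_all :: "tables \<Rightarrow> nat \<Rightarrow> nat \<Rightarrow> data sampler" where
  "s_all tab k m = s_iter (\<lambda>w D. s_bind (s_vertex tab k w) (\<lambda>d. s_ret (D(w := d)))) m (\<lambda>_. absent T)"

text \<open>The data of \<open>v\<close> are drawn as well and then overwritten, because the program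
  draws all vertices in one loop and erases \<open>q\<close> afterwards.\<close>

definition s_data :: "tables \<Rightarrow> nat \<Rightarrow> nat \<Rightarrow> data sampler" where
  "s_data tab k v = s_bind (s_all tab k n) (\<lambda>D. s_ret (D(v := absent T)))"

lemma p_iter_Pi_pmf:
  "p_iter (\<lambda>w D. bind_pmf (p w) (\<lambda>d. return_pmf (D(w := d)))) m (\<lambda>_. dflt) = Pi_pmf {..<m} dflt p"
proof (induction m)
  case (Suc m)
  show ?case
    unfolding lessThan_Suc p_iter.simps Suc.IH
    by (subst Pi_pmf_insert') (simp_all, rule bind_commute_pmf)
qed simp

lemma realises_all: "realises (s_all tab k n) (all_data (threshold tab k))"
  unfolding s_all_def data_pmf_def p_iter_Pi_pmf[symmetric]
  by (intro realises_iter realises_bind realises_vertex realises_ret)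

lemma realises_data: "realises (s_data tab k v) (data_pmf ({..<n} - {v}) (threshold tab k))"
proof -
  have "data_pmf ({..<n} - {v}) (threshold tab k) =
      bind_pmf (all_data (threshold tab k)) (\<lambda>D. return_pmf (D(v := absent T)))"
    unfolding data_pmf_def by (subst Pi_pmf_remove) (simp_all add: map_pmf_def)
  then show ?thesis unfolding s_data_def
    by (simp only:) (intro realises_bind realises_all realises_ret)
qed

definition add_free :: "nat \<Rightarrow> data \<Rightarrow> (nat \<Rightarrow> nat) \<Rightarrow> nat \<Rightarrow> nat" where
  "add_free k D c = (\<lambda>u. if phase D u < k \<and> u \<notin> busy D k then Suc (c u) else c u)"

definition s_count :: "tables \<Rightarrow> nat \<Rightarrow> nat \<Rightarrow> nat \<Rightarrow> (nat \<Rightarrow> nat) sampler" where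
  "s_count tab k v m = s_iter (\<lambda>i c. s_bind (s_data tab k v) (\<lambda>D. s_ret (add_free k D c))) m (\<lambda>_. 0)"

definition count_pmf :: "tables \<Rightarrow> nat \<Rightarrow> nat \<Rightarrow> nat \<Rightarrow> (nat \<Rightarrow> nat) pmf" where
  "count_pmf tab k v m = p_iter (\<lambda>i c. bind_pmf (data_pmf ({..<n} - {v}) (threshold tab k))
     (\<lambda>D. return_pmf (add_free k D c))) m (\<lambda>_. 0)"

lemma realises_count: "realises (s_count tab k v m) (count_pmf tab k v m)"
  unfolding s_count_def count_pmf_def
  by (intro realises_iter realises_bind realises_data realises_ret)

definition set_column :: "nat \<Rightarrow> (nat \<Rightarrow> nat) \<Rightarrow> counts \<Rightarrow> counts" where
  "set_column v c0 c = (\<lambda>u w. if w = v then c0 u else c u w)"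

definition s_row :: "tables \<Rightarrow> nat \<Rightarrow> nat \<Rightarrow> counts sampler" where
  "s_row tab k m = s_iter (\<lambda>v c. s_bind (s_count tab k v R) (\<lambda>c0. s_ret (set_column v c0 c))) m (\<lambda>_ _. 0)"

definition row_pmf :: "tables \<Rightarrow> nat \<Rightarrow> nat \<Rightarrow> counts pmf" where
  "row_pmf tab k m = p_iter (\<lambda>v c. bind_pmf (count_pmf tab k v R) (\<lambda>c0. return_pmf (set_column v c0 c))) m (\<lambda>_ _. 0)"

lemma realises_row: "realises (s_row tab k m) (row_pmf tab k m)"
  unfolding s_row_def row_pmf_def
  by (intro realises_iter realises_bind realises_count realises_ret)

text \<open>\<open>R\<close> keeps the set nonempty for a graph without edges. The minimum ranges
  over pairs of positive weight because these are the pairs for which \<open>free_prob_ge\<close>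
  bounds the estimated probability from below.\<close>

definition row_min :: "counts \<Rightarrow> nat" where
  "row_min c = Min (insert R {c u v |u v. u < n \<and> v < n \<and> 0 < xv u v})"

definition set_row :: "nat \<Rightarrow> counts \<Rightarrow> tables \<Rightarrow> tables" where
  "set_row k c tab = ((fst tab)(k := c), (snd tab)(k := row_min c))"

definition s_tables :: "nat \<Rightarrow> tables sampler" where
  "s_tables m = s_iter (\<lambda>k tab. s_bind (s_row tab k n) (\<lambda>c. s_ret (set_row k c tab))) m (\<lambda>_ _ _. 0, \<lambda>_. 0)"

definition tables_pmf :: "nat \<Rightarrow> tables pmf" where
  "tables_pmf m = p_iter (\<lambda>k tab. bind_pmf (row_pmf tab k n) (\<lambda>c. return_pmf (set_row k c tab))) m (\<lambda>_ _ _. 0, \<lambda>_. 0)"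

lemma realises_tables: "realises (s_tables m) (tables_pmf m)"
  unfolding s_tables_def tables_pmf_def
  by (intro realises_iter realises_bind realises_row realises_ret)

text \<open>The counts of different vertices in one column come from the same simulations and are
  dependent; the union bound in \<open>prob_bad_row\<close> uses their marginals.\<close>

lemma count_binomial:
  "map_pmf (\<lambda>c. c u) (count_pmf tab k v m) = binomial_pmf m (free_prob (threshold tab k) k u v)"
proof (induction m)
  case (Suc m)
  let ?M = "data_pmf ({..<n} - {v}) (threshold tab k)"
  let ?q = "free_prob (threshold tab k) k u v"
  have q: "?q \<in> {0..1}" using free_prob_bounds by auto
  have bern: "map_pmf (\<lambda>D. phase D u < k \<and> u \<notin> busy D k) ?M = bernoulli_pmf ?q"
  proof (rule pmf_eqI)
    fix b
    have "measure_pmf.prob ?M {D. \<not> (phase D u < k \<and> u \<notin> busy D k)} = 1 - ?q"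
      unfolding free_prob_def using measure_pmf.prob_compl[of "{D. phase D u < k \<and> u \<notin> busy D k}" ?M]
      by (simp add: Compl_eq_Diff_UNIV[symmetric] Collect_neg_eq[symmetric] del: not_less de_Morgan_conj)
    then show "pmf (map_pmf (\<lambda>D. phase D u < k \<and> u \<notin> busy D k) ?M) b = pmf (bernoulli_pmf ?q) b"
      using q by (cases b) (simp_all add: pmf_map vimage_def free_prob_def[symmetric])
  qed
  have "map_pmf (\<lambda>c. c u) (count_pmf tab k v (Suc m)) =
      bind_pmf (count_pmf tab k v m) (\<lambda>c. bind_pmf ?M (\<lambda>D. return_pmf (add_free k D c u)))"
    by (simp add: count_pmf_def map_bind_pmf)
  also have "\<dots> = bind_pmf (map_pmf (\<lambda>c. c u) (count_pmf tab k v m)) (\<lambda>c.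
      bind_pmf (map_pmf (\<lambda>D. phase D u < k \<and> u \<notin> busy D k) ?M) (\<lambda>b. return_pmf (c + of_bool b)))"
    by (auto simp: bind_map_pmf add_free_def intro!: bind_pmf_cong)
  also have "\<dots> = bind_pmf (binomial_pmf m ?q) (\<lambda>c. bind_pmf (bernoulli_pmf ?q) (\<lambda>b. return_pmf (c + of_bool b)))"
    by (simp only: Suc.IH bern)
  also have "\<dots> = binomial_pmf (Suc m) ?q"
    using q by (subst binomial_pmf_Suc) (simp_all, subst bind_commute_pmf, simp add: add.commute of_bool_def)
  finally show ?case .
qed (use free_prob_bounds in \<open>simp add: count_pmf_def binomial_pmf_0\<close>)

lemma row_column:
  "v < m \<Longrightarrow> map_pmf (\<lambda>c u. c u v) (row_pmf tab k m) = count_pmf tab k v R"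
proof (induction m)
  case (Suc m)
  show ?case
  proof (cases "v = m")
    case True
    then show ?thesis by (simp add: row_pmf_def map_bind_pmf set_column_def bind_return_pmf')
  next
    case False
    then show ?thesis using Suc
      by (simp add: row_pmf_def map_bind_pmf set_column_def map_pmf_def bind_assoc_pmf bind_return_pmf)
  qed
qed simp

definition good_row :: "tables \<Rightarrow> nat \<Rightarrow> bool" where
  "good_row tab k \<longleftrightarrow>
     (\<forall>u<n. \<forall>v<n. \<bar>real (fst tab k u v) - R * free_prob (threshold tab k) k u v\<bar> \<le> h) \<and>
     snd tab k = row_min (fst tab k)"

lemma prob_bad_row:
  "measure_pmf.prob (row_pmf tab k n)
     {c. \<not> (\<forall>u<n. \<forall>v<n. \<bar>real (c u v) - R * free_prob (threshold tab k) k u v\<bar> \<le> h)} \<le>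
     (real n)\<^sup>2 * (R / (real h)\<^sup>2)"
proof -
  let ?q = "\<lambda>u v. free_prob (threshold tab k) k u v"
  let ?B = "\<lambda>u v. {c. real h < \<bar>real (c u v) - R * ?q u v\<bar>}"
  have col: "measure_pmf.prob (row_pmf tab k n) (?B u v) \<le> R / (real h)\<^sup>2" if "v < n" for u v
  proof -
    have "map_pmf (\<lambda>c. c u v) (row_pmf tab k n) = map_pmf (\<lambda>c. c u) (map_pmf (\<lambda>c u. c u v) (row_pmf tab k n))"
      by (simp add: map_pmf_comp)
    also have "\<dots> = binomial_pmf R (?q u v)" using that by (simp add: row_column count_binomial)
    finally have "measure_pmf.prob (map_pmf (\<lambda>c. c u v) (row_pmf tab k n)) {m. real h < \<bar>real m - R * ?q u v\<bar>}
        \<le> R / (real h)\<^sup>2"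
      using binomial_concentration[of "?q u v" R h] free_prob_bounds h by simp
    then show ?thesis by (simp add: vimage_def)
  qed
  have "measure_pmf.prob (row_pmf tab k n) {c. \<not> (\<forall>u<n. \<forall>v<n. \<bar>real (c u v) - R * ?q u v\<bar> \<le> h)} \<le>
      measure_pmf.prob (row_pmf tab k n) (\<Union>u<n. \<Union>v<n. ?B u v)"
    by (rule measure_pmf.finite_measure_mono) (auto simp: not_le)
  also have "\<dots> \<le> (\<Sum>u<n. measure_pmf.prob (row_pmf tab k n) (\<Union>v<n. ?B u v))"
    by (rule measure_pmf.finite_measure_subadditive_finite) auto
  also have "\<dots> \<le> (\<Sum>u<n. \<Sum>v<n. measure_pmf.prob (row_pmf tab k n) (?B u v))"
    by (intro sum_mono measure_pmf.finite_measure_subadditive_finite) auto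
  also have "\<dots> \<le> (\<Sum>u<n. \<Sum>v<n. R / (real h)\<^sup>2)"
    by (intro sum_mono col) auto
  finally show ?thesis by (simp add: power2_eq_square mult.assoc)
qed

lemma threshold_set_row: "k \<le> m \<Longrightarrow> threshold (set_row m c tab) k = threshold tab k"
  by (intro ext) (auto simp: threshold_def set_row_def split: option.splits)

text \<open>A row is judged against the probabilities under the thresholds of the rows actually
  filled before it. The conditional failure bound is therefore the same for all earlier rows, and
  the bounds add up.\<close>

lemma prob_bad_tables:
  "measure_pmf.prob (tables_pmf m) {tab. \<not> (\<forall>k<m. good_row tab k)} \<le> m * ((real n)\<^sup>2 * (R / (real h)\<^sup>2))"
proof (induction m)
  case (Suc m)
  let ?\<beta> = "(real n)\<^sup>2 * (R / (real h)\<^sup>2)"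
  have "measure_pmf.prob (tables_pmf (Suc m)) {tab. \<not> (\<forall>k<Suc m. good_row tab k)} \<le>
      measure_pmf.prob (tables_pmf m) {tab. \<not> (\<forall>k<m. good_row tab k)} + ?\<beta>"
    unfolding tables_pmf_def p_iter.simps
  proof (rule prob_bind_le)
    fix tab assume tab: "tab \<notin> {tab. \<not> (\<forall>k<m. good_row tab k)}"
    have "good_row (set_row m c tab) k" if "k < m" for k c
      using tab that threshold_set_row[of k m c tab] by (simp add: good_row_def) (simp add: set_row_def)
    moreover have "good_row (set_row m c tab) m \<longleftrightarrow>
        (\<forall>u<n. \<forall>v<n. \<bar>real (c u v) - R * free_prob (threshold tab m) m u v\<bar> \<le> h)" for c
      using threshold_set_row[of m m c tab] by (simp add: good_row_def) (simp add: set_row_def)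
    ultimately have "\<not> (\<forall>k<Suc m. good_row (set_row m c tab) k) \<longleftrightarrow>
        \<not> (\<forall>u<n. \<forall>v<n. \<bar>real (c u v) - R * free_prob (threshold tab m) m u v\<bar> \<le> h)" for c
      by (auto simp: less_Suc_eq)
    then show "measure_pmf.prob (bind_pmf (row_pmf tab m n) (\<lambda>c. return_pmf (set_row m c tab)))
        {tab. \<not> (\<forall>k<Suc m. good_row tab k)} \<le> ?\<beta>"
      using prob_bad_row[of tab m] by (simp flip: map_pmf_def add: vimage_def)
  qed simp
  also have "\<dots> \<le> m * ?\<beta> + ?\<beta>" using Suc by simp
  also have "\<dots> = Suc m * ?\<beta>" by (simp only: of_nat_Suc distrib_right mult_1)
  finally show ?case .
qed simp

section \<open>Selection rates under accurate tables\<close>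

context
  fixes tab :: tables and g :: enat
  assumes good: "\<And>k. k < T \<Longrightarrow> good_row tab k"
    and g: "odd_girth E x = g"
begin

definition level :: "nat \<Rightarrow> real" where
  "level k = real (snd tab k - h) / R"

lemma level_nonneg: "0 \<le> level k"
  by (simp add: level_def)

lemma count_close:
  assumes "k < T" "u < n" "v < n"
  shows "\<bar>real (fst tab k u v) - R * free_prob (threshold tab T) k u v\<bar> \<le> h"
proof -
  have "free_prob (threshold tab T) k u v = free_prob (threshold tab k) k u v"
    using assms by (intro free_prob_cong) (auto simp: threshold_def split: option.splits)
  then show ?thesis using good[OF assms(1)] assms by (simp add: good_row_def)
qed

lemma xv_pos_less: "0 < xv u v \<Longrightarrow> u < n \<and> v < n \<and> u \<noteq> v"
  using edge_less by (auto simp: xv_def split: if_splits)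

lemma row_min_finite: "finite {c u v |u v. u < n \<and> v < n \<and> 0 < xv u v}"
  by (rule finite_subset[of _ "(\<lambda>(u, v). c u v) ` ({..<n} \<times> {..<n})"]) auto

lemma row_min_le:
  assumes "0 < xv u v"
  shows "row_min c \<le> c u v"
proof -
  have "c u v \<in> {c u v |u v. u < n \<and> v < n \<and> 0 < xv u v}"
    using xv_pos_less[OF assms] assms by blast
  then show ?thesis unfolding row_min_def using row_min_finite[of c] by (intro Min_le) simp_all
qed

lemma row_min_cases: "row_min c = R \<or> (\<exists>u v. 0 < xv u v \<and> row_min c = c u v)"
proof -
  have "row_min c \<in> insert R {c u v |u v. u < n \<and> v < n \<and> 0 < xv u v}"
    unfolding row_min_def using row_min_finite[of c] by (intro Min_in) simp_all
  then show ?thesis by blast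
qed

text \<open>Let m be the lowered minimum, c the count and q the true probability, so that R q is
  within h of c. From q <= (c + h) / R the rate is at most m / (c + h) * (c + h) / R, which is the
  level. From q >= (c - h) / R it falls short by at most 2 h / R * m / (c + h), and m <= c +
  h.\<close>

lemma selection_rate:
  assumes k: "k < T" and uv: "0 < xv u v"
  shows "threshold tab T k (Some u) v * free_prob (threshold tab T) k u v \<le> level k"
    and "level k - 2 * h / R \<le> threshold tab T k (Some u) v * free_prob (threshold tab T) k u v"
proof -
  let ?q = "free_prob (threshold tab T) k u v" and ?c = "real (fst tab k u v)" and ?m = "real (snd tab k - h)"
  have R: "0 < R" using h by linarith
  have "\<bar>?c - R * ?q\<bar> \<le> h" using count_close[OF k] xv_pos_less[OF uv] by blast
  then have q: "R * ?q \<le> ?c + h" "?c - h \<le> R * ?q" "0 \<le> ?q"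
    using free_prob_bounds(1)[of "threshold tab T" k u v] by linarith+
  have \<theta>: "threshold tab T k (Some u) v = min 1 (?m / (?c + h))"
    using k xv_pos_less[OF uv] by (simp add: threshold_def)
  have "threshold tab T k (Some u) v * ?q \<le> ?m / (?c + h) * ((?c + h) / R)"
    unfolding \<theta> using q R h by (intro mult_mono) (auto simp: field_simps)
  also have "\<dots> = level k" using h by (simp add: level_def)
  finally show "threshold tab T k (Some u) v * ?q \<le> level k" .
  show "level k - 2 * h / R \<le> threshold tab T k (Some u) v * ?q"
  proof (cases "snd tab k \<le> h")
    case True
    then have "level k = 0" by (simp add: level_def)
    then show ?thesis using threshold_bounds q by (simp add: field_simps order_trans[of _ 0])
  next
    case False
    have "snd tab k \<le> fst tab k u v"
      using good[OF k] row_min_le[OF uv] by (simp add: good_row_def)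
    then have m: "?m \<le> ?c - h" "0 \<le> ?m" using False by linarith+
    have ch: "0 < ?c + h" using h by simp
    have 1: "?m / (?c + h) \<le> 1" using m ch by (simp add: field_simps)
    have "level k - 2 * h / R = (?m - 2 * real h * 1) / R" by (simp add: level_def diff_divide_distrib)
    also have "\<dots> \<le> (?m - 2 * real h * (?m / (?c + h))) / R"
      by (intro divide_right_mono diff_left_mono mult_left_mono 1) simp_all
    also have "\<dots> = ?m / (?c + h) * ((?c - h) / R)"
    proof -
      have *: "m = a * (c + b) \<Longrightarrow> m - 2 * b * a = a * (c - b)" for m a c b :: real
        by (simp add: algebra_simps)
      have "?m = ?m / (?c + h) * (?c + h)" using ch by simp
      then have "?m - 2 * real h * (?m / (?c + h)) = ?m / (?c + h) * (?c - h)"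
        using *[of ?m "?m / (?c + h)" ?c h] by blast
      then show ?thesis by simp
    qed
    also have "\<dots> \<le> ?m / (?c + h) * ?q"
      using q R m ch by (intro mult_left_mono) (auto simp: field_simps)
    also have "\<dots> = threshold tab T k (Some u) v * ?q" using 1 by (simp add: \<theta>)
    finally show ?thesis .
  qed
qed

text \<open>If the minimum is attained at an edge, its count is within h of R times a probability
  that \<open>free_prob_ge\<close> bounds in terms of the earlier levels; another h is subtracted in
  \<open>level\<close>. If the minimum is \<open>R\<close>, the level is at least 1 - h/R, while the
  claimed bound is at most 1 - 2 h/R.\<close>

lemma level_ge:
  assumes gg: "g = \<infinity> \<or> (\<exists>k. g = enat k \<and> odd k \<and> 3 \<le> k)" and k: "k < T"
  shows "real k / T - 2 / T * (\<Sum>j<k. level j) - odd_cycle_loss g (real k / T) - 2 * h / R \<le> level k"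
proof -
  have R: "0 < R" using h by linarith
  have min: "snd tab k = row_min (fst tab k)" using good[OF k] by (simp add: good_row_def)
  have sub: "(real (snd tab k) - h) / R \<le> level k"
    unfolding level_def by (intro divide_right_mono) linarith+
  consider "snd tab k = R" | u v where "0 < xv u v" "snd tab k = fst tab k u v"
    using row_min_cases[of "fst tab k"] min by auto
  then show ?thesis
  proof cases
    case 1
    have "0 \<le> odd_cycle_loss g (real k / T)"
      using k odd_cycle_loss_bounds(1)[OF gg] by (simp add: field_simps)
    moreover have "0 \<le> 2 / T * (\<Sum>j<k. level j)" using level_nonneg by (simp add: sum_nonneg)
    moreover have "real k / T \<le> 1" using k by simp
    moreover have "1 - h / R \<le> level k" using sub 1 R by (simp add: diff_divide_distrib)
    moreover have "0 \<le> h / R" by simp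
    ultimately show ?thesis by linarith
  next
    case 2
    let ?q = "free_prob (threshold tab T) k u v"
    have ge: "real k / T - 2 / T * (\<Sum>j<k. level j) - odd_cycle_loss g (real k / T) \<le> ?q"
      using k selection_rate(1) threshold_bounds level_nonneg by (intro free_prob_ge[OF _ 2(1) g]) auto
    have "\<bar>real (snd tab k) - R * ?q\<bar> \<le> h"
      using count_close[OF k] xv_pos_less[OF 2(1)] 2(2) by metis
    then have "R * ?q - 2 * h \<le> real (snd tab k) - h" by linarith
    then have "(R * ?q - 2 * h) / R \<le> (real (snd tab k) - h) / R"
      by (rule divide_right_mono) simp
    then have "?q - 2 * h / R \<le> (real (snd tab k) - h) / R"
      using R by (simp add: diff_divide_distrib)
    then show ?thesis using sub ge by linarith
  qed
qed

text \<open>Selections in different phases or directions are disjoint, since the later endpoint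
  arrives in the phase of the selection. The term 8 h/R is composed of 4 h/R from
  \<open>euler\<close> with \<delta> = 2 h/R, and of 4 h/R because the rates of both directions may
  lie 2 h/R below the level.\<close>

lemma prob_selected:
  assumes gg: "g = \<infinity> \<or> (\<exists>k. g = enat k \<and> odd k \<and> 3 \<le> k)" and uv: "0 < xv u v" and T2: "2 \<le> T"
  shows "xv u v * (alpha g - 8 / T - 8 * h / R) \<le>
    measure_pmf.prob (all_data (threshold tab T)) {D. \<exists>k<T. sel D k u v \<or> sel D k v u}"
proof -
  let ?M = "all_data (threshold tab T)"
  let ?A = "\<lambda>k. {D. sel D k u v} \<union> {D. sel D k v u}"
  have R: "0 < R" using h by linarith
  have lt: "u < n" "v < n" "u \<noteq> v" using xv_pos_less[OF uv] by auto
  have vu: "0 < xv v u" using uv by (simp add: xv_commute)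
  obtain H where H: "limit_equation H (odd_cycle_loss g)" "alpha g = 2 * H 1"
    by (rule alpha_equation[OF gg])
  have "2 * H 1 - 8 / T - 2 * (2 * h / R) \<le> 2 / T * (\<Sum>k<T. level k)"
    by (rule limit_equation.euler[OF H(1) T2 _ level_ge[OF gg]]) simp_all
  moreover have "(\<Sum>k<T. 2 / T * (level k - 2 * h / R)) = 2 / T * (\<Sum>k<T. level k) - 4 * h / R"
  proof -
    have "(\<Sum>k<T. 2 / T * (level k - 2 * h / R)) = 2 / T * ((\<Sum>k<T. level k) - (\<Sum>k<T. 2 * h / R))"
      by (simp only: sum_distrib_left[symmetric] sum_subtractf)
    then show ?thesis using T by (simp add: right_diff_distrib)
  qed
  ultimately have "alpha g - 8 / T - 8 * h / R \<le> (\<Sum>k<T. 2 / T * (level k - 2 * h / R))"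
    using H(2) by simp
  then have "xv u v * (alpha g - 8 / T - 8 * h / R) \<le> xv u v * (\<Sum>k<T. 2 / T * (level k - 2 * h / R))"
    using uv by (intro mult_left_mono) auto
  also have "\<dots> = (\<Sum>k<T. xv u v * (2 / T * (level k - 2 * h / R)))"
    by (rule sum_distrib_left)
  also have "\<dots> \<le> (\<Sum>k<T. measure_pmf.prob ?M (?A k))"
  proof (rule sum_mono)
    fix k assume "k \<in> {..<T}"
    then have k: "k < T" by simp
    have a: "xv u v * (level k - 2 * h / R) / T \<le> measure_pmf.prob ?M {D. sel D k u v}"
      using prob_sel[OF lt(2) k _ _ lt(3), of "threshold tab T"] selection_rate(2)[OF k uv] uv threshold_bounds
      by (simp add: divide_right_mono mult.assoc)
    have b: "xv u v * (level k - 2 * h / R) / T \<le> measure_pmf.prob ?M {D. sel D k v u}"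
      using prob_sel[OF lt(1) k _ _ lt(3)[symmetric], of "threshold tab T"] selection_rate(2)[OF k vu] uv threshold_bounds
      by (simp add: divide_right_mono mult.assoc xv_commute[of v u])
    have "measure_pmf.prob ?M (?A k) = measure_pmf.prob ?M {D. sel D k u v} + measure_pmf.prob ?M {D. sel D k v u}"
      by (rule measure_pmf.finite_measure_Union) (auto simp: sel_def)
    moreover have "xv u v * (2 / T * (level k - 2 * h / R)) = 2 * (xv u v * (level k - 2 * h / R) / T)" by simp
    ultimately show "xv u v * (2 / T * (level k - 2 * h / R)) \<le> measure_pmf.prob ?M (?A k)"
      using a b by linarith
  qed
  also have "\<dots> = measure_pmf.prob ?M (\<Union>k<T. ?A k)"
    by (rule measure_pmf.finite_measure_finite_Union[symmetric])
      (auto simp: disjoint_family_on_def sel_def)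
  also have "(\<Union>k<T. ?A k) = {D. \<exists>k<T. sel D k u v \<or> sel D k v u}" by auto
  finally show ?thesis .
qed

end

section \<open>Ties between phases\<close>

lemma prob_tie:
  assumes "u < n" "v < n" "u \<noteq> v"
  shows "measure_pmf.prob (Pi_pmf {..<n} T (\<lambda>_. pmf_of_set {..<T})) {Y. Y u = Y v} \<le> 1 / T"
proof -
  let ?P = "\<lambda>A. Pi_pmf A T (\<lambda>_. pmf_of_set {..<T})"
  have "?P {..<n} = map_pmf (\<lambda>(f, y). f(u := y)) (pair_pmf (?P ({..<n} - {u})) (pmf_of_set {..<T}))"
    using Pi_pmf_insert[of "{..<n} - {u}" u T "\<lambda>_. pmf_of_set {..<T}"] assms(1)
    by (subst pair_commute_pmf) (simp add: insert_absorb map_pmf_comp case_prod_unfold)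
  then have "measure_pmf.prob (?P {..<n}) {Y. Y u = Y v} =
      measure_pmf.prob (pair_pmf (?P ({..<n} - {u})) (pmf_of_set {..<T})) {(f, y). y = f v}"
    using assms by (simp add: vimage_def case_prod_unfold)
  also have "\<dots> \<le> 1 / T"
  proof (rule prob_pair_pmf_le)
    fix f
    have "measure_pmf.prob (pmf_of_set {..<T}) {f v} \<le> 1 / T"
      using T by (cases "f v < T") (auto simp: measure_pmf_single pmf_phase pmf_of_set lessThan_empty_iff)
    then show "measure_pmf.prob (pmf_of_set {..<T}) {y. (f, y) \<in> {(f, y). y = f v}} \<le> 1 / T"
      by simp
  qed simp
  finally show ?thesis .
qed

lemma prob_not_inj:
  "measure_pmf.prob (Pi_pmf {..<n} T (\<lambda>_. pmf_of_set {..<T})) {Y. \<not> inj_on Y {..<n}} \<le> (real n)\<^sup>2 / T"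
proof -
  let ?P = "Pi_pmf {..<n} T (\<lambda>_. pmf_of_set {..<T})"
  let ?B = "\<lambda>u v. {Y. u \<noteq> v \<and> Y u = Y v}"
  have b: "measure_pmf.prob ?P (?B u v) \<le> 1 / T" if "u < n" "v < n" for u v
    using prob_tie[OF that] by (cases "u = v") auto
  have "measure_pmf.prob ?P {Y. \<not> inj_on Y {..<n}} \<le> measure_pmf.prob ?P (\<Union>u<n. \<Union>v<n. ?B u v)"
    by (rule measure_pmf.finite_measure_mono) (auto simp: inj_on_def)
  also have "\<dots> \<le> (\<Sum>u<n. measure_pmf.prob ?P (\<Union>v<n. ?B u v))"
    by (rule measure_pmf.finite_measure_subadditive_finite) auto
  also have "\<dots> \<le> (\<Sum>u<n. \<Sum>v<n. measure_pmf.prob ?P (?B u v))"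
    by (intro sum_mono measure_pmf.finite_measure_subadditive_finite) auto
  also have "\<dots> \<le> (\<Sum>u<n. \<Sum>v<n. 1 / T)"
    by (intro sum_mono b) auto
  finally show ?thesis by (simp add: power2_eq_square)
qed

text \<open>Ties have to be charged in proportion to the weight of the edge, or light edges would
  lose everything. This works because choices are independent of phases.\<close>

lemma prob_choice_tie:
  assumes "u < n" "v < n"
  shows "measure_pmf.prob (all_data \<theta>)
    {D. (target D v = Some u \<or> target D u = Some v) \<and> \<not> inj_on (phase D) {..<n}} \<le>
    xv u v * (2 * (real n)\<^sup>2 / T)"
proof -
  let ?F = "Pi_pmf {..<n} None (choice_pmf E x)"
  let ?Y = "Pi_pmf {..<n} T (\<lambda>_. pmf_of_set {..<T})"
  let ?A = "{F. F v = Some u} \<union> {F. F u = Some v}"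
  have c: "measure_pmf.prob ?F {F. F b = Some a} = xv a b" if "b < n" for a b
  proof -
    have "measure_pmf.prob ?F {F. F b = Some a} = measure_pmf.prob (map_pmf (\<lambda>F. F b) ?F) {Some a}"
      by (simp add: vimage_def)
    also have "\<dots> = xv a b" using that by (simp add: Pi_pmf_component measure_pmf_single pmf_choice)
    finally show ?thesis .
  qed
  have "measure_pmf.prob (all_data \<theta>)
      {D. (target D v = Some u \<or> target D u = Some v) \<and> \<not> inj_on (phase D) {..<n}} =
      measure_pmf.prob (map_pmf (\<lambda>D. (target D, phase D)) (all_data \<theta>)) (?A \<times> {Y. \<not> inj_on Y {..<n}})"
    by (simp add: vimage_def)
  also have "\<dots> = measure_pmf.prob ?F ?A * measure_pmf.prob ?Y {Y. \<not> inj_on Y {..<n}}"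
    by (simp only: map_data_pair[OF finite_lessThan] prob_pair_pmf_Times)
  also have "\<dots> \<le> (2 * xv u v) * ((real n)\<^sup>2 / T)"
  proof (rule mult_mono)
    have "measure_pmf.prob ?F ?A \<le> measure_pmf.prob ?F {F. F v = Some u} + measure_pmf.prob ?F {F. F u = Some v}"
      by (rule measure_Un_le) auto
    then show "measure_pmf.prob ?F ?A \<le> 2 * xv u v"
      using c assms by (simp add: xv_commute[of v u])
  qed (use xv_nonneg prob_not_inj in auto)
  finally show ?thesis by (simp add: mult_ac)
qed

text \<open>With tied phases the simultaneous process may select conflicting edges and differ from
  the treatment of arrivals one by one; hence the demand for distinct phases.\<close>

definition selects :: "nat \<Rightarrow> nat \<Rightarrow> data \<Rightarrow> bool" where
  "selects u v D \<longleftrightarrow> (\<exists>k<T. sel D k u v \<or> sel D k v u) \<and> inj_on (phase D) {..<n}"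

lemma prob_selects:
  assumes good: "\<And>k. k < T \<Longrightarrow> good_row tab k" and g: "odd_girth E x = g"
    and gg: "g = \<infinity> \<or> (\<exists>k. g = enat k \<and> odd k \<and> 3 \<le> k)" and uv: "0 < xv u v" and T2: "2 \<le> T"
  shows "xv u v * (alpha g - 8 / T - 8 * h / R - 2 * (real n)\<^sup>2 / T) \<le>
    measure_pmf.prob (all_data (threshold tab T)) {D. selects u v D}"
proof -
  let ?M = "all_data (threshold tab T)"
  let ?S = "{D. \<exists>k<T. sel D k u v \<or> sel D k v u}"
  let ?B = "{D. (target D v = Some u \<or> target D u = Some v) \<and> \<not> inj_on (phase D) {..<n}}"
  have lt: "u < n" "v < n" using uv edge_less by (auto simp: xv_def split: if_splits)
  have "xv u v * (alpha g - 8 / T - 8 * h / R) \<le> measure_pmf.prob ?M ?S"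
    by (rule prob_selected[OF good g gg uv T2])
  also have "\<dots> \<le> measure_pmf.prob ?M ({D. selects u v D} \<union> ?B)"
    by (rule measure_pmf.finite_measure_mono) (auto simp: selects_def sel_def)
  also have "\<dots> \<le> measure_pmf.prob ?M {D. selects u v D} + measure_pmf.prob ?M ?B"
    by (rule measure_Un_le) auto
  also have "measure_pmf.prob ?M ?B \<le> xv u v * (2 * (real n)\<^sup>2 / T)"
    by (rule prob_choice_tie[OF lt])
  finally show ?thesis by (simp add: algebra_simps)
qed

end

section \<open>Reasoning about programs\<close>

definition runs :: "com \<Rightarrow> state \<Rightarrow> nat \<Rightarrow> (state \<Rightarrow> bool) \<Rightarrow> bool" where
  "runs c s B Q \<longleftrightarrow> (\<exists>t s'. exec c s t s' \<and> t \<le> B \<and> Q s')"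

lemma runs_mono: "runs c s B Q \<Longrightarrow> B \<le> B' \<Longrightarrow> (\<And>s'. Q s' \<Longrightarrow> Q' s') \<Longrightarrow> runs c s B' Q'"
  unfolding runs_def by (meson order_trans)

lemma nat_mem_set_nat [simp]:
  "nat_mem (set_nat a js k s) = (nat_mem s)(a := (nat_mem s a)(js := k))"
  and real_mem_set_nat [simp]: "real_mem (set_nat a js k s) = real_mem s"
  and samples_set_nat [simp]: "samples (set_nat a js k s) = samples s"
  and nat_mem_set_real [simp]: "nat_mem (set_real a js z s) = nat_mem s"
  and real_mem_set_real [simp]: "real_mem (set_real a js z s) = (real_mem s)(a := (real_mem s a)(js := z))"
  and samples_set_real [simp]: "samples (set_real a js z s) = samples s"
  by (simp_all add: set_nat_def set_real_def store_at_def)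

fun nat_writes :: "com \<Rightarrow> string set" where
  "nat_writes (NAssign a js i) = {a}"
| "nat_writes (Seq c d) = nat_writes c \<union> nat_writes d"
| "nat_writes (If b c d) = nat_writes c \<union> nat_writes d"
| "nat_writes (While b c) = nat_writes c"
| "nat_writes _ = {}"

fun real_writes :: "com \<Rightarrow> string set" where
  "real_writes (RAssign a js p) = {a}"
| "real_writes (Draw a js) = {a}"
| "real_writes (Seq c d) = real_writes c \<union> real_writes d"
| "real_writes (If b c d) = real_writes c \<union> real_writes d"
| "real_writes (While b c) = real_writes c"
| "real_writes _ = {}"

lemma exec_frame:
  "exec c s t s' \<Longrightarrow> (\<forall>a. a \<notin> nat_writes c \<longrightarrow> nat_mem s' a = nat_mem s a) \<and>
     (\<forall>a. a \<notin> real_writes c \<longrightarrow> real_mem s' a = real_mem s a)"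
  by (induction rule: exec.induct) auto

lemma runs_Skip: "Q s \<Longrightarrow> 1 \<le> B \<Longrightarrow> runs Skip s B Q"
  unfolding runs_def using exec.Skip by blast

lemma floorlog_le: "floorlog 2 k \<le> k"
proof (cases "k = 0")
  case False
  then have "2 ^ (floorlog 2 k - 1) \<le> k" using floorlog_bounds[of k 2] by simp
  moreover have "floorlog 2 k - 1 < 2 ^ (floorlog 2 k - 1)" by (rule less_exp)
  ultimately show ?thesis by linarith
qed (simp add: floorlog_def)

text \<open>The bit length is bounded by the value itself. This crude charge stays polynomial
  because all numbers that the program stores are polynomially bounded.\<close>

lemma runs_NAssign:
  assumes "Q (set_nat a (map (\<lambda>j. nval j s) js) (nval i s) s)" "1 + nval i s \<le> B"
  shows "runs (NAssign a js i) s B Q"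
proof -
  have "1 + floorlog 2 (nval i s) \<le> B" using floorlog_le[of "nval i s"] assms(2) by linarith
  then show ?thesis unfolding runs_def using exec.NAssign assms(1) by blast
qed

lemma runs_RAssign:
  "Q (set_real a (map (\<lambda>j. nval j s) js) (rval p s) s) \<Longrightarrow> 1 \<le> B \<Longrightarrow> runs (RAssign a js p) s B Q"
  unfolding runs_def using exec.RAssign by blast

lemma runs_Draw:
  "Q ((set_real a (map (\<lambda>j. nval j s) js) (shd (samples s)) s)\<lparr>samples := stl (samples s)\<rparr>) \<Longrightarrow>
   1 \<le> B \<Longrightarrow> runs (Draw a js) s B Q"
  unfolding runs_def using exec.Draw by blast

lemma runs_Seq:
  "runs c s B P \<Longrightarrow> (\<And>s'. P s' \<Longrightarrow> runs d s' B' Q) \<Longrightarrow> B + B' \<le> C \<Longrightarrow> runs (Seq c d) s C Q"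
  unfolding runs_def by (meson add_mono exec.Seq order_trans)

lemma runs_Seq_NAssign:
  "runs d (set_nat a (map (\<lambda>j. nval j s) js) (nval i s) s) B' Q \<Longrightarrow> 1 + nval i s \<le> B \<Longrightarrow> B + B' \<le> C \<Longrightarrow>
   runs (Seq (NAssign a js i) d) s C Q"
  by (rule runs_Seq[where P = "\<lambda>s'. s' = set_nat a (map (\<lambda>j. nval j s) js) (nval i s) s"])
    (auto intro: runs_NAssign)

lemma runs_Seq_RAssign:
  "runs d (set_real a (map (\<lambda>j. nval j s) js) (rval p s) s) B' Q \<Longrightarrow> 1 + B' \<le> C \<Longrightarrow>
   runs (Seq (RAssign a js p) d) s C Q"
  by (rule runs_Seq[where P = "\<lambda>s'. s' = set_real a (map (\<lambda>j. nval j s) js) (rval p s) s" and B = 1])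
    (auto intro: runs_RAssign)

lemma runs_Seq_Draw:
  "runs d ((set_real a (map (\<lambda>j. nval j s) js) (shd (samples s)) s)\<lparr>samples := stl (samples s)\<rparr>) B' Q \<Longrightarrow>
   1 + B' \<le> C \<Longrightarrow> runs (Seq (Draw a js) d) s C Q"
  by (rule runs_Seq[where B = 1 and P = "\<lambda>s'. s' = (set_real a (map (\<lambda>j. nval j s) js) (shd (samples s)) s)
      \<lparr>samples := stl (samples s)\<rparr>"])
    (auto intro: runs_Draw)

text \<open>The second program receives the frame condition of the first, with the written arrays
  read off the syntax. Specifications of blocks thus mention only what they change.\<close>

lemma runs_Seq_block:
  assumes c: "runs c s B P"
    and d: "\<And>s'. P s' \<Longrightarrow> (\<And>a. a \<notin> nat_writes c \<Longrightarrow> nat_mem s' a = nat_mem s a) \<Longrightarrow>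
      (\<And>a. a \<notin> real_writes c \<Longrightarrow> real_mem s' a = real_mem s a) \<Longrightarrow> runs d s' B' Q"
    and C: "B + B' \<le> C"
  shows "runs (Seq c d) s C Q"
proof -
  obtain t s' where s': "exec c s t s'" "t \<le> B" "P s'" using c by (auto simp: runs_def)
  then obtain t' s'' where "exec d s' t' s''" "t' \<le> B'" "Q s''"
    using d[of s'] exec_frame[OF s'(1)] by (auto simp: runs_def)
  then show ?thesis unfolding runs_def using s' C exec.Seq[of c s t s' d t' s'']
    by (meson add_mono order_trans)
qed

lemma runs_frame:
  assumes c: "runs c s B P"
    and d: "\<And>s'. P s' \<Longrightarrow> (\<And>a. a \<notin> nat_writes c \<Longrightarrow> nat_mem s' a = nat_mem s a) \<Longrightarrow>
      (\<And>a. a \<notin> real_writes c \<Longrightarrow> real_mem s' a = real_mem s a) \<Longrightarrow> Q s'"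
  shows "runs c s B Q"
  using c d exec_frame unfolding runs_def by meson

lemma runs_If:
  "(bval b s \<Longrightarrow> runs c s B Q) \<Longrightarrow> (\<not> bval b s \<Longrightarrow> runs d s B Q) \<Longrightarrow> 1 + B \<le> C \<Longrightarrow> runs (If b c d) s C Q"
  unfolding runs_def by (cases "bval b s") (meson add_left_mono exec.IfTrue exec.IfFalse order_trans)+

abbreviation N :: "string \<Rightarrow> nexp" where "N a \<equiv> NCell a []"

definition For :: "string \<Rightarrow> nexp \<Rightarrow> com \<Rightarrow> com" where
  "For i b c = Seq (NAssign i [] (NConst 0))
     (While (NLess (N i) b) (Seq c (NAssign i [] (NAdd (N i) (NConst 1)))))"

lemma writes_For [simp]:
  "nat_writes (For i b c) = insert i (nat_writes c)" "real_writes (For i b c) = real_writes c"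
  by (auto simp: For_def)

text \<open>Costs are monomials in one quantity \<open>X\<close>, so nested loops compose
  mechanically: a loop raises the degree by 1 and the coefficient by 5. The 5 covers the term X^2
  for up to \<open>X\<close> counter updates of cost up to about \<open>X\<close>, the term 2 X for
  tests, and 2 for the start and the end.\<close>

lemma runs_For:
  assumes init: "Inv 0 (set_nat i [] 0 s)"
    and step: "\<And>j s. j < m \<Longrightarrow> nat_mem s i [] = j \<Longrightarrow> Inv j s \<Longrightarrow>
      runs c s B (\<lambda>s'. nat_mem s' i [] = j \<and> Inv (Suc j) (set_nat i [] (Suc j) s'))"
    and bound: "\<And>j s. Inv j s \<Longrightarrow> nval b s = m"
    and X: "m \<le> X" "1 \<le> X" "B \<le> p * X ^ d" "1 \<le> d" "(p + 5) * X ^ Suc d \<le> C"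
  shows "runs (For i b c) s C (\<lambda>s'. Inv m s' \<and> nat_mem s' i [] = m)"
proof -
  let ?W = "While (NLess (N i) b) (Seq c (NAssign i [] (NAdd (N i) (NConst 1))))"
  have loop: "nat_mem s i [] = j \<Longrightarrow> Inv j s \<Longrightarrow>
      runs ?W s (1 + (m - j) * (B + m + 2)) (\<lambda>s'. Inv m s' \<and> nat_mem s' i [] = m)"
    if "j \<le> m" for j s
    using that
  proof (induction j arbitrary: s rule: inc_induct)
    case base
    then have "\<not> bval (NLess (N i) b) s" using bound by auto
    then have "exec ?W s 1 s" by (rule exec.WhileFalse)
    then show ?case using base unfolding runs_def by (intro exI[of _ 1] exI[of _ s]) auto
  next
    case (step j)
    have b: "bval (NLess (N i) b) s" using bound[OF step.prems(2)] step by simp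
    have "runs (Seq c (NAssign i [] (NAdd (N i) (NConst 1)))) s (B + (1 + Suc j))
        (\<lambda>s'. nat_mem s' i [] = Suc j \<and> Inv (Suc j) s')"
      by (rule runs_Seq[OF assms(2)]) (use step in \<open>auto intro!: runs_NAssign\<close>)
    then obtain t s' where s': "exec (Seq c (NAssign i [] (NAdd (N i) (NConst 1)))) s t s'"
      "t \<le> B + (1 + Suc j)" "nat_mem s' i [] = Suc j" "Inv (Suc j) s'"
      by (auto simp: runs_def)
    have "runs ?W s' (1 + (m - Suc j) * (B + m + 2)) (\<lambda>s'. Inv m s' \<and> nat_mem s' i [] = m)"
      by (rule step.IH) fact+
    then obtain t' s'' where s'': "exec ?W s' t' s''" "t' \<le> 1 + (m - Suc j) * (B + m + 2)"
      "Inv m s''" "nat_mem s'' i [] = m"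
      unfolding runs_def by blast
    have "1 + t + t' \<le> 1 + (B + m + 2) + (m - Suc j) * (B + m + 2)"
      using s'(2) s''(2) step by linarith
    also have "\<dots> = 1 + (m - j) * (B + m + 2)"
    proof -
      have "m - j = Suc (m - Suc j)" using step by simp
      then show ?thesis by (simp only: mult_Suc add.assoc)
    qed
    finally show ?case
      unfolding runs_def using exec.WhileTrue[OF b s'(1) s''(1)] s''(3,4) by blast
  qed
  have XX: "X \<le> X ^ Suc d" "1 \<le> X ^ Suc d" "X ^ 2 \<le> X ^ Suc d"
    using X self_le_power[of X "Suc d"] power_increasing[of 2 "Suc d" X] by auto
  have "m * (B + m + 2) \<le> X * (p * X ^ d + X + 2)" using X by (intro mult_mono add_mono) auto
  also have "\<dots> = p * X ^ Suc d + X ^ 2 + 2 * X" by (simp add: algebra_simps power2_eq_square)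
  finally have le: "m * (B + m + 2) \<le> p * X ^ Suc d + X ^ 2 + 2 * X" .
  have C: "1 + (1 + (m - 0) * (B + m + 2)) \<le> C"
  proof -
    have "(p + 5) * X ^ Suc d = p * X ^ Suc d + 5 * X ^ Suc d" by (rule distrib_right)
    then show ?thesis using XX X(5) le unfolding diff_zero by linarith
  qed
  show ?thesis unfolding For_def
  proof (rule runs_Seq[OF _ _ C])
    show "runs (NAssign i [] (NConst 0)) s 1 (\<lambda>s'. nat_mem s' i [] = 0 \<and> Inv 0 s')"
      by (rule runs_NAssign) (use init in simp_all)
    show "runs ?W s' (1 + (m - 0) * (B + m + 2)) (\<lambda>s'. Inv m s' \<and> nat_mem s' i [] = m)"
      if "nat_mem s' i [] = 0 \<and> Inv 0 s'" for s'
      using that by (intro loop) simp_all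
  qed
qed

section \<open>The program\<close>

abbreviation inc :: "string \<Rightarrow> com" where
  "inc a \<equiv> NAssign a [] (NAdd (N a) (NConst 1))"

abbreviation cell_at :: "string \<Rightarrow> string \<Rightarrow> nexp" where "cell_at a i \<equiv> NCell a [N i]"

text \<open>A choice u is stored as u + 1 and no choice as 0, as in the cell \<open>partner\<close>;
  hence the subtraction.\<close>

abbreviation target_at :: "string \<Rightarrow> string \<Rightarrow> nexp" where
  "target_at a i \<equiv> NCell a [NSub (NCell ''F'' [N i]) (NConst 1)]"

definition draw_phase :: com where
  "draw_phase = Seq (Draw ''U'' []) (Seq (NAssign ''Y'' [N ''w''] (NConst 0))
     (For ''i'' (N ''T'') (If (RLess (RScale (N ''T'') (RCell ''U'' [])) (RNat (N ''i'')))
        Skip (NAssign ''Y'' [N ''w''] (N ''i'')))))"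

definition draw_target :: com where
  "draw_target = Seq (Draw ''U'' []) (Seq (NAssign ''F'' [N ''w''] (NConst 0))
     (Seq (RAssign ''S'' [] (RNat (NConst 0)))
     (For ''i'' (N ''n'') (Seq (RAssign ''S'' [] (RAdd (RCell ''S'' []) (RCell ''x'' [N ''i'', N ''w''])))
        (If (BAnd (NLess (cell_at ''F'' ''w'') (NConst 1)) (RLess (RCell ''U'' []) (RCell ''S'' [])))
           (NAssign ''F'' [N ''w''] (NAdd (N ''i'') (NConst 1))) Skip)))))"

definition draw_coin :: com where
  "draw_coin = Seq (Draw ''U'' [])
     (If (BAnd (NLess (NConst 0) (cell_at ''F'' ''w''))
         (BAnd (BNot (NLess (N ''n'') (cell_at ''F'' ''w'')))
         (BAnd (NLess (cell_at ''Y'' ''w'') (N ''k''))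
           (RLess (RScale (NAdd (NCell ''cnt'' [cell_at ''Y'' ''w'', NSub (cell_at ''F'' ''w'') (NConst 1), N ''w'']) (N ''h''))
               (RCell ''U'' []))
             (RNat (NSub (NCell ''mn'' [cell_at ''Y'' ''w'']) (N ''h'')))))))
        (NAssign ''b'' [N ''w''] (NConst 1)) (NAssign ''b'' [N ''w''] (NConst 0)))"

definition draw_vertices :: com where
  "draw_vertices = For ''w'' (N ''n'') (Seq draw_phase (Seq draw_target draw_coin))"

definition remove_vertex_q :: com where
  "remove_vertex_q = Seq (NAssign ''Y'' [N ''q''] (N ''T''))
     (Seq (NAssign ''F'' [N ''q''] (NConst 0)) (NAssign ''b'' [N ''q''] (NConst 0)))"

definition reset_times :: com where
  "reset_times = For ''w'' (N ''n'') (NAssign ''mt'' [N ''w''] (N ''T''))"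

text \<open>\<open>mt\<close> records the phase in which a vertex becomes busy.\<close>
definition simulate :: com where
  "simulate = For ''j'' (N ''k'') (For ''w'' (N ''n'')
     (If (BAnd (BNot (NLess (cell_at ''Y'' ''w'') (N ''j'')))
         (BAnd (BNot (NLess (N ''j'') (cell_at ''Y'' ''w'')))
         (BAnd (NLess (NConst 0) (cell_at ''F'' ''w''))
         (BAnd (NLess (NConst 0) (cell_at ''b'' ''w''))
         (BAnd (NLess (target_at ''Y'' ''w'') (N ''j'')) (BNot (NLess (target_at ''mt'' ''w'') (N ''j''))))))))
        (Seq (NAssign ''mt'' [NSub (cell_at ''F'' ''w'') (NConst 1)] (N ''j'')) (NAssign ''mt'' [N ''w''] (N ''j'')))
        Skip))"

definition count_free :: com where
  "count_free = For ''w'' (N ''n'')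
     (If (BAnd (NLess (cell_at ''Y'' ''w'') (N ''k'')) (BNot (NLess (cell_at ''mt'' ''w'') (N ''k''))))
        (NAssign ''cnt'' [N ''k'', N ''w'', N ''q'']
          (NAdd (NCell ''cnt'' [N ''k'', N ''w'', N ''q'']) (NConst 1)))
        Skip)"

definition sample_free :: com where
  "sample_free = Seq draw_vertices (Seq remove_vertex_q (Seq reset_times (Seq simulate count_free)))"

definition fill_row :: com where
  "fill_row = For ''q'' (N ''n'') (For ''r'' (N ''R'') sample_free)"

definition fill_min :: com where
  "fill_min = Seq (NAssign ''mn'' [N ''k''] (N ''R''))
     (For ''w'' (N ''n'') (For ''i'' (N ''n'')
       (If (BAnd (RLess (RNat (NConst 0)) (RCell ''x'' [N ''w'', N ''i'']))
             (NLess (NCell ''cnt'' [N ''k'', N ''w'', N ''i'']) (cell_at ''mn'' ''k'')))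
          (NAssign ''mn'' [N ''k''] (NCell ''cnt'' [N ''k'', N ''w'', N ''i'']))
          Skip)))"

definition fill_tables :: com where
  "fill_tables = For ''k'' (N ''T'') (Seq fill_row fill_min)"

definition draw_order :: com where
  "draw_order = For ''w'' (N ''n'') draw_phase"

text \<open>Counting sort: every value below \<open>T\<close> is tried in turn, which is affordable
  as \<open>T\<close> is polynomial.\<close>

definition sort_phases :: com where
  "sort_phases = Seq (NAssign ''pos'' [] (NConst 0))
     (For ''j'' (N ''T'') (For ''w'' (N ''n'')
        (If (BAnd (BNot (NLess (cell_at ''Y'' ''w'') (N ''j''))) (BNot (NLess (N ''j'') (cell_at ''Y'' ''w''))))
          (Seq (NAssign ''srt'' [N ''pos''] (N ''j'')) (inc ''pos'')) Skip)))"

text \<open>Reals cannot be rounded, so m = ceiling of 1/\<epsilon> is found by counting up. With N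
  = (n + 1)^2, the choice T = 60 N m makes the cost of discretisation and ties 8/T + 2 n^2/T at most
  1/(6 m); R = 48 m h makes the margin 8 h/R equal to 1/(6 m); and h = 48 T N m^2 makes the failure
  probability T n^2 R/h^2 at most 1/m.\<close>

definition compute_params :: com where
  "compute_params = Seq (NAssign ''m'' [] (NConst 1))
     (Seq (While (RLess (RScale (N ''m'') (RCell ''eps'' [])) (RNat (NConst 1))) (inc ''m''))
     (Seq (NAssign ''T'' [] (NMul (NConst 60) (NMul (NMul (NAdd (N ''n'') (NConst 1)) (NAdd (N ''n'') (NConst 1))) (N ''m''))))
     (Seq (NAssign ''h'' [] (NMul (NMul (NMul (NConst 48) (N ''T'')) (NMul (NAdd (N ''n'') (NConst 1)) (NAdd (N ''n'') (NConst 1))))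
         (NMul (N ''m'') (N ''m''))))
        (NAssign ''R'' [] (NMul (NMul (NConst 48) (N ''m'')) (N ''h''))))))"

definition preprocess_com :: com where
  "preprocess_com = Seq compute_params (Seq fill_tables (Seq draw_order (Seq sort_phases
     (NAssign ''pos'' [] (NConst 0)))))"

text \<open>An earlier vertex may have been assigned the same phase; the last test then rejects it,
  in agreement with the strict inequality in \<open>sel\<close>.\<close>

definition arrival_com :: com where
  "arrival_com = Seq (NAssign ''w'' [] (N ''v'')) (Seq (NAssign ''F'' [N ''w''] (N ''partner''))
     (Seq (NAssign ''Y'' [N ''w''] (cell_at ''srt'' ''pos'')) (Seq (inc ''pos'') (Seq draw_coin
     (If (BAnd (NLess (NConst 0) (cell_at ''b'' ''w'')) (NLess (target_at ''Y'' ''w'') (cell_at ''Y'' ''w'')))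
        (NAssign ''accept'' [] (NConst 1)) (NAssign ''accept'' [] (NConst 0)))))))"

definition the_rcrs :: rcrs where "the_rcrs = RCRS preprocess_com arrival_com"

definition code :: "nat option \<Rightarrow> nat" where
  "code r = (case r of None \<Rightarrow> 0 | Some u \<Rightarrow> Suc u)"

lemma code_simps [simp]: "code None = 0" "code (Some u) = Suc u" "code r = 0 \<longleftrightarrow> r = None" "0 < code r \<longleftrightarrow> r \<noteq> None"
  by (auto simp: code_def split: option.splits)

section \<open>Correctness and cost of one simulation\<close>

context scheme
begin

definition base :: "state \<Rightarrow> bool" where
  "base s \<longleftrightarrow> nat_mem s ''n'' [] = n \<and> nat_mem s ''T'' [] = T \<and> nat_mem s ''h'' [] = h \<and>
     nat_mem s ''R'' [] = R \<and> (\<forall>u v. real_mem s ''x'' [u, v] = xv u v)"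

definition has_tables :: "nat \<Rightarrow> tables \<Rightarrow> state \<Rightarrow> bool" where
  "has_tables k tab s \<longleftrightarrow> (\<forall>j<k. \<forall>u v. nat_mem s ''cnt'' [j, u, v] = fst tab j u v) \<and>
     (\<forall>j<k. nat_mem s ''mn'' [j] = snd tab j)"

definition bound :: nat where "bound = n + T + R + h + 1"

lemma bounds: "n \<le> bound" "T \<le> bound" "R \<le> bound" "h \<le> bound" "1 \<le> bound"
  by (simp_all add: bound_def)

lemma runs_draw_phase:
  assumes "nat_mem s ''T'' [] = T" "nat_mem s ''w'' [] = w" "T \<le> X" "1 \<le> X"
  shows "runs draw_phase s (15 * X ^ 2) (\<lambda>s'.
    nat_mem s' ''Y'' = (nat_mem s ''Y'')([w] := phase_upto T T (shd (samples s))) \<and>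
    samples s' = stl (samples s))"
proof -
  let ?U = "shd (samples s)"
  let ?I = "\<lambda>j s'. nat_mem s' ''T'' [] = T \<and> nat_mem s' ''w'' [] = w \<and> real_mem s' ''U'' [] = ?U \<and>
    nat_mem s' ''Y'' = (nat_mem s ''Y'')([w] := phase_upto T j ?U) \<and> samples s' = stl (samples s)"
  have "X \<le> X ^ 2" "1 \<le> X ^ 2" using assms(4) by (auto simp: power2_eq_square)
  with assms show ?thesis unfolding draw_phase_def
    by (intro runs_Seq_Draw[where B' = "13 * X ^ 2"]
        runs_Seq_NAssign[where B = 1 and B' = "10 * X ^ 2"])
      (auto simp: power2_eq_square intro!: runs_mono[OF runs_For[where Inv = ?I and m = T and p = 5 and d = 1 and X = X and B = "X + 2"]]
        runs_If[where B = "X + 1"] runs_Skip runs_NAssign)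
qed

lemma runs_draw_target:
  assumes "nat_mem s ''n'' [] = n" "nat_mem s ''w'' [] = w" "n \<le> X" "1 \<le> X"
    "\<And>u. real_mem s ''x'' [u, w] = xv u w"
  shows "runs draw_target s (15 * X ^ 2) (\<lambda>s'.
    nat_mem s' ''F'' = (nat_mem s ''F'')([w] := code (pick_upto (\<lambda>u. xv u w) n (shd (samples s)))) \<and>
    samples s' = stl (samples s))"
proof -
  let ?U = "shd (samples s)" and ?p = "\<lambda>u. xv u w"
  let ?I = "\<lambda>j s'. nat_mem s' ''n'' [] = n \<and> nat_mem s' ''w'' [] = w \<and> real_mem s' ''U'' [] = ?U \<and>
    real_mem s' ''x'' = real_mem s ''x'' \<and> real_mem s' ''S'' [] = (\<Sum>i<j. xv i w) \<and>
    nat_mem s' ''F'' = (nat_mem s ''F'')([w] := code (pick_upto ?p j ?U)) \<and> samples s' = stl (samples s)"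
  have "X \<le> X ^ 2" "1 \<le> X ^ 2" using assms(4) by (auto simp: power2_eq_square)
  with assms show ?thesis unfolding draw_target_def
    by (intro runs_Seq_Draw[where B' = "14 * X ^ 2"]
        runs_Seq_NAssign[where B = 1 and B' = "13 * X ^ 2"]
        runs_Seq_RAssign[where B' = "12 * X ^ 2"])
      (auto simp: power2_eq_square intro!: runs_mono[OF runs_For[where Inv = ?I and m = n and p = 5 and d = 1 and X = X and B = "X + 4"]]
        runs_Seq_RAssign[where B' = "X + 3"]
        runs_If[where B = "X + 2"] runs_Skip runs_NAssign)
qed

lemma runs_draw_coin:
  assumes "nat_mem s ''n'' [] = n" "nat_mem s ''h'' [] = h" "nat_mem s ''w'' [] = w" "nat_mem s ''k'' [] = k"
    "nat_mem s ''F'' [w] = code r" "nat_mem s ''Y'' [w] = y" "has_tables k tab s"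
  shows "runs draw_coin s 4 (\<lambda>s'.
    nat_mem s' ''b'' = (nat_mem s ''b'')([w] := of_bool (accepts tab k y r w (shd (samples s)))) \<and>
    samples s' = stl (samples s))"
proof (cases r)
  case None
  then show ?thesis unfolding draw_coin_def
    by (intro runs_Seq_Draw[where B' = 3])
      (auto simp: assms accepts_def intro!: runs_If[where B = 2] runs_NAssign)
next
  case (Some u)
  then show ?thesis using assms(7) unfolding draw_coin_def
    by (intro runs_Seq_Draw[where B' = 3])
      (auto simp: assms(1-6) accepts_def has_tables_def algebra_simps intro!: runs_If[where B = 2] runs_NAssign)
qed

lemma writes_draw [simp]:
  "nat_writes draw_phase = {''Y'', ''i''}" "real_writes draw_phase = {''U''}"
  "nat_writes draw_target = {''F'', ''i''}" "real_writes draw_target = {''U'', ''S''}"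
  "nat_writes draw_coin = {''b''}" "real_writes draw_coin = {''U''}"
  by (auto simp: draw_phase_def draw_target_def draw_coin_def)

definition has_vertex :: "state \<Rightarrow> nat \<Rightarrow> nat \<times> nat option \<times> bool \<Rightarrow> bool" where
  "has_vertex s w d \<longleftrightarrow> nat_mem s ''Y'' [w] = fst d \<and> nat_mem s ''F'' [w] = code (fst (snd d)) \<and>
     nat_mem s ''b'' [w] = of_bool (snd (snd d))"

lemma runs_draw_vertex:
  assumes s: "base s" "nat_mem s ''w'' [] = w" "nat_mem s ''k'' [] = k" "has_tables k tab s"
    and X: "bound \<le> X"
  shows "runs (Seq draw_phase (Seq draw_target draw_coin)) s (34 * X ^ 2) (\<lambda>s'.
    base s' \<and> nat_mem s' ''w'' [] = w \<and> nat_mem s' ''k'' [] = k \<and> has_tables k tab s' \<and>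
    has_vertex s' w (fst (s_vertex tab k w (samples s))) \<and>
    (\<forall>v. v \<noteq> w \<longrightarrow> (\<forall>d. has_vertex s v d \<longrightarrow> has_vertex s' v d)) \<and>
    samples s' = snd (s_vertex tab k w (samples s)))"
proof -
  have X1: "n \<le> X" "T \<le> X" "1 \<le> X" using X bounds by linarith+
  then have XX: "1 \<le> X ^ 2" by simp
  show ?thesis
  proof (rule runs_Seq_block[where B = "15 * X ^ 2" and B' = "19 * X ^ 2", OF runs_draw_phase])
    fix s1 :: state assume s1: "nat_mem s1 ''Y'' = (nat_mem s ''Y'')([w] := phase_upto T T (shd (samples s))) \<and>
        samples s1 = stl (samples s)"
      and f1: "\<And>a. a \<notin> nat_writes draw_phase \<Longrightarrow> nat_mem s1 a = nat_mem s a"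
      "\<And>a. a \<notin> real_writes draw_phase \<Longrightarrow> real_mem s1 a = real_mem s a"
    show "runs (Seq draw_target draw_coin) s1 (19 * X ^ 2) (\<lambda>s'.
      base s' \<and> nat_mem s' ''w'' [] = w \<and> nat_mem s' ''k'' [] = k \<and> has_tables k tab s' \<and>
      has_vertex s' w (fst (s_vertex tab k w (samples s))) \<and>
      (\<forall>v. v \<noteq> w \<longrightarrow> (\<forall>d. has_vertex s v d \<longrightarrow> has_vertex s' v d)) \<and>
      samples s' = snd (s_vertex tab k w (samples s)))"
    proof (rule runs_Seq_block[where B = "15 * X ^ 2" and B' = 4, OF runs_draw_target])
      fix s2 :: state assume s2: "nat_mem s2 ''F'' = (nat_mem s1 ''F'')([w] := code (pick_upto (\<lambda>u. xv u w) n (shd (samples s1)))) \<and>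
          samples s2 = stl (samples s1)"
        and f2: "\<And>a. a \<notin> nat_writes draw_target \<Longrightarrow> nat_mem s2 a = nat_mem s1 a"
        "\<And>a. a \<notin> real_writes draw_target \<Longrightarrow> real_mem s2 a = real_mem s1 a"
      show "runs draw_coin s2 4 (\<lambda>s'.
        base s' \<and> nat_mem s' ''w'' [] = w \<and> nat_mem s' ''k'' [] = k \<and> has_tables k tab s' \<and>
        has_vertex s' w (fst (s_vertex tab k w (samples s))) \<and>
        (\<forall>v. v \<noteq> w \<longrightarrow> (\<forall>d. has_vertex s v d \<longrightarrow> has_vertex s' v d)) \<and>
        samples s' = snd (s_vertex tab k w (samples s)))"
        by (rule runs_frame[OF runs_draw_coin[where w = w and k = k and tab = tab
              and r = "pick_upto (\<lambda>u. xv u w) n (shd (samples s1))" and y = "phase_upto T T (shd (samples s))"]])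
          (use s s1 s2 in \<open>auto simp: f1 f2 base_def has_tables_def has_vertex_def s_vertex_def s_bind_def s_draw_def s_ret_def\<close>)
    qed (use s s1 X1 XX in \<open>auto simp: f1 base_def\<close>)
  qed (use s X1 in \<open>auto simp: base_def\<close>)
qed

definition wf_data :: "data \<Rightarrow> bool" where
  "wf_data D \<longleftrightarrow> (\<forall>w\<ge>n. D w = absent T) \<and> (\<forall>w u. target D w = Some u \<longrightarrow> u < n)"

lemma pick_upto_less: "pick_upto p m t = Some u \<Longrightarrow> u < m"
  by (induction m) (auto split: if_splits)

lemma wf_all: "m \<le> n \<Longrightarrow> wf_data (fst (s_all tab k m \<omega>))"
  by (induction m)
    (auto simp: s_all_def s_bind_def s_ret_def s_vertex_def s_draw_def wf_data_def dest: pick_upto_less)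

lemma s_all_Suc: "s_all tab k (Suc m) \<omega> =
    (let (D, \<omega>') = s_all tab k m \<omega>; (d, \<omega>'') = s_vertex tab k m \<omega>' in (D(m := d), \<omega>''))"
  by (simp add: s_all_def s_bind_def s_ret_def case_prod_unfold Let_def)

lemma wf_data: "v < n \<Longrightarrow> wf_data (fst (s_data tab k v \<omega>))"
  using wf_all[of n tab k \<omega>] by (auto simp: s_data_def s_bind_def s_ret_def wf_data_def)

lemma runs_draw_vertices:
  assumes s: "base s" "nat_mem s ''k'' [] = k" "has_tables k tab s" and X: "bound \<le> X"
  shows "runs draw_vertices s (39 * X ^ 3) (\<lambda>s'.
    (\<forall>w<n. has_vertex s' w (fst (s_all tab k n (samples s)) w)) \<and>
    samples s' = snd (s_all tab k n (samples s)))"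
proof -
  let ?I = "\<lambda>j s'. base s' \<and> nat_mem s' ''k'' [] = k \<and> has_tables k tab s' \<and>
    (\<forall>w<j. has_vertex s' w (fst (s_all tab k j (samples s)) w)) \<and> samples s' = snd (s_all tab k j (samples s))"
  have X1: "n \<le> X" "1 \<le> X" using X bounds by linarith+
  show ?thesis unfolding draw_vertices_def
  proof (rule runs_mono[OF runs_For[where Inv = ?I and m = n and p = 34 and d = 2 and X = X and B = "34 * X ^ 2"]])
    fix j and s1 :: state assume j: "j < n" "nat_mem s1 ''w'' [] = j" "?I j s1"
    show "runs (Seq draw_phase (Seq draw_target draw_coin)) s1 (34 * X ^ 2)
        (\<lambda>s'. nat_mem s' ''w'' [] = j \<and> ?I (Suc j) (set_nat ''w'' [] (Suc j) s'))"
      by (rule runs_mono[OF runs_draw_vertex[where k = k and w = j and tab = tab and X = X]])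
        (use j X in \<open>auto simp: base_def has_tables_def has_vertex_def s_all_Suc Let_def case_prod_unfold less_Suc_eq\<close>)
  qed (use s X1 in \<open>auto simp: base_def has_tables_def s_all_def s_ret_def eval_nat_numeral\<close>)
qed

lemma sel_Suc_iff:
  assumes D: "wf_data D" and j: "j < T"
  shows "w \<in> busy D (Suc j) \<longleftrightarrow> w \<in> busy D j \<or> (\<exists>v<n. \<exists>u. sel D j u v \<and> (w = u \<or> w = v))"
proof -
  have "v < n" if "sel D j u v" for u v
    using D j that by (cases "v < n") (auto simp: wf_data_def sel_def)
  then show ?thesis unfolding busy_Suc by blast
qed

text \<open>The state in the middle of phase \<open>j\<close>, after the vertices below
  \<open>m\<close>. The program tests \<open>mt\<close> against \<open>j\<close> strictly, so an
  entry set to \<open>j\<close> does not yet count as busy: the vertices are scanned one by one, yet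
  the phase is treated simultaneously. The value \<open>T\<close> means not busy so far.\<close>

definition times_ok :: "data \<Rightarrow> nat \<Rightarrow> nat \<Rightarrow> (nat list \<Rightarrow> nat) \<Rightarrow> bool" where
  "times_ok D j m mt \<longleftrightarrow> (\<forall>w<n. (\<forall>i\<le>j. mt [w] < i \<longleftrightarrow> w \<in> busy D i) \<and>
     (mt [w] \<le> j \<longleftrightarrow> w \<in> busy D j \<or> (\<exists>v<m. \<exists>u. sel D j u v \<and> (w = u \<or> w = v))) \<and>
     (mt [w] \<le> j \<or> mt [w] = T))"

lemma times_ok_skip:
  "times_ok D j m mt \<Longrightarrow> (\<And>u. \<not> sel D j u m) \<Longrightarrow> times_ok D j (Suc m) mt"
  unfolding times_ok_def less_Suc_eq by blast

lemma times_ok_sel: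
  assumes t: "times_ok D j m mt" and sel: "sel D j u m"
  shows "times_ok D j (Suc m) (mt([u] := j, [m] := j))"
proof -
  \<comment> \<open>\<open>u\<close> is still free and \<open>m\<close> arrives in phase
    \<open>j\<close>, so neither is busy at a time up to \<open>j\<close>. Overwriting their entries
    by \<open>j\<close> therefore preserves all comparisons with such times.\<close>
  have nb: "u \<notin> busy D i" "m \<notin> busy D i" if "i \<le> j" for i
    using sel busy_mono[OF that, of D] busy_phase[of m D i] that by (auto simp: sel_def)
  have other: "\<not> sel D j u' m" if "u' \<noteq> u" for u'
    using sel that by (auto simp: sel_def)
  show ?thesis
    unfolding times_ok_def
  proof (intro allI impI)
    fix w assume w: "w < n"
    show "(\<forall>i\<le>j. (mt([u] := j, [m] := j)) [w] < i \<longleftrightarrow> w \<in> busy D i) \<and>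
     ((mt([u] := j, [m] := j)) [w] \<le> j \<longleftrightarrow> w \<in> busy D j \<or> (\<exists>v<Suc m. \<exists>u. sel D j u v \<and> (w = u \<or> w = v))) \<and>
     ((mt([u] := j, [m] := j)) [w] \<le> j \<or> (mt([u] := j, [m] := j)) [w] = T)"
    proof (cases "w = u \<or> w = m")
      case True
      then have "(mt([u] := j, [m] := j)) [w] = j" by auto
      then show ?thesis using True nb sel by auto
    next
      case False
      then have 1: "(mt([u] := j, [m] := j)) [w] = mt [w]" by auto
      have 2: "(\<exists>v<Suc m. \<exists>u. sel D j u v \<and> (w = u \<or> w = v)) \<longleftrightarrow>
          (\<exists>v<m. \<exists>u. sel D j u v \<and> (w = u \<or> w = v))"
        using False other unfolding less_Suc_eq by blast
      have "(\<forall>i\<le>j. mt [w] < i \<longleftrightarrow> w \<in> busy D i) \<and>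
          (mt [w] \<le> j \<longleftrightarrow> w \<in> busy D j \<or> (\<exists>v<m. \<exists>u. sel D j u v \<and> (w = u \<or> w = v))) \<and>
          (mt [w] \<le> j \<or> mt [w] = T)"
        using t w unfolding times_ok_def by blast
      then show ?thesis unfolding 1 2 .
    qed
  qed
qed

definition times_before :: "data \<Rightarrow> nat \<Rightarrow> (nat list \<Rightarrow> nat) \<Rightarrow> bool" where
  "times_before D j mt \<longleftrightarrow> (\<forall>w<n. (\<forall>i\<le>j. mt [w] < i \<longleftrightarrow> w \<in> busy D i) \<and> (mt [w] < j \<or> mt [w] = T))"

lemma times_ok_start:
  assumes "times_before D j mt" "j < T"
  shows "times_ok D j 0 mt"
  unfolding times_ok_def
proof (intro allI impI)
  fix w assume "w < n"
  then have "\<forall>i\<le>j. mt [w] < i \<longleftrightarrow> w \<in> busy D i" "mt [w] < j \<or> mt [w] = T"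
    using assms unfolding times_before_def by blast+
  moreover from this assms(2) have "mt [w] \<le> j \<longleftrightarrow> w \<in> busy D j" by auto
  ultimately show "(\<forall>i\<le>j. mt [w] < i \<longleftrightarrow> w \<in> busy D i) \<and>
     (mt [w] \<le> j \<longleftrightarrow> w \<in> busy D j \<or> (\<exists>v<0. \<exists>u. sel D j u v \<and> (w = u \<or> w = v))) \<and>
     (mt [w] \<le> j \<or> mt [w] = T)" by auto
qed

lemma times_ok_next:
  assumes D: "wf_data D" and j: "j < T" and t: "times_ok D j n mt"
  shows "times_before D (Suc j) mt"
  unfolding times_before_def
proof (intro allI impI)
  fix w assume w: "w < n"
  have 1: "mt [w] < Suc j \<longleftrightarrow> w \<in> busy D (Suc j)"
    using t w unfolding times_ok_def sel_Suc_iff[OF D j] less_Suc_eq_le by blast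
  have 2: "\<forall>i\<le>j. mt [w] < i \<longleftrightarrow> w \<in> busy D i" "mt [w] \<le> j \<or> mt [w] = T"
    using t w unfolding times_ok_def by blast+
  show "(\<forall>i\<le>Suc j. mt [w] < i \<longleftrightarrow> w \<in> busy D i) \<and> (mt [w] < Suc j \<or> mt [w] = T)"
    using 1 2 by (metis le_SucE less_Suc_eq_le)
qed

lemma has_vertex_sel:
  assumes D: "\<forall>w<n. has_vertex s w (D w)" "wf_data D" and t: "times_ok D j w (nat_mem s ''mt'')"
    and w: "w < n" and j: "j < T"
    and cells: "nat_mem s ''w'' [] = w" "nat_mem s ''j'' [] = j"
  shows "bval (BAnd (BNot (NLess (cell_at ''Y'' ''w'') (N ''j'')))
         (BAnd (BNot (NLess (N ''j'') (cell_at ''Y'' ''w'')))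
         (BAnd (NLess (NConst 0) (cell_at ''F'' ''w''))
         (BAnd (NLess (NConst 0) (cell_at ''b'' ''w''))
         (BAnd (NLess (target_at ''Y'' ''w'') (N ''j'')) (BNot (NLess (target_at ''mt'' ''w'') (N ''j'')))))))) s
     \<longleftrightarrow> (\<exists>u. sel D j u w)"
    and "sel D j u w \<Longrightarrow> nat_mem s ''F'' [w] = Suc u"
proof -
  have v: "nat_mem s ''Y'' [v] = phase D v" "nat_mem s ''F'' [v] = code (target D v)"
    "nat_mem s ''b'' [v] = of_bool (coin D v)" if "v < n" for v
    using D(1) that by (auto simp: has_vertex_def)
  have mt: "nat_mem s ''mt'' [v] < j \<longleftrightarrow> v \<in> busy D j" if "v < n" for v
    using t that unfolding times_ok_def by blast
  show "bval (BAnd (BNot (NLess (cell_at ''Y'' ''w'') (N ''j'')))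
         (BAnd (BNot (NLess (N ''j'') (cell_at ''Y'' ''w'')))
         (BAnd (NLess (NConst 0) (cell_at ''F'' ''w''))
         (BAnd (NLess (NConst 0) (cell_at ''b'' ''w''))
         (BAnd (NLess (target_at ''Y'' ''w'') (N ''j'')) (BNot (NLess (target_at ''mt'' ''w'') (N ''j'')))))))) s
     \<longleftrightarrow> (\<exists>u. sel D j u w)"
  proof (cases "target D w")
    case None
    then show ?thesis using v[OF w] by (simp add: cells sel_def)
  next
    case (Some u)
    then have "u < n" using D(2) by (auto simp: wf_data_def)
    then show ?thesis using v[OF w] v[of u] mt[of u] Some by (auto simp: cells sel_def)
  qed
  show "sel D j u w \<Longrightarrow> nat_mem s ''F'' [w] = Suc u"
    using v[OF w] by (simp add: sel_def)
qed

lemma runs_simulate: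
  assumes s: "base s" "nat_mem s ''k'' [] = k" "k \<le> T" and X: "bound \<le> X"
    and D: "\<forall>w<n. has_vertex s w (D w)" "wf_data D" and mt: "\<forall>w<n. nat_mem s ''mt'' [w] = T"
  shows "runs simulate s (17 * X ^ 3)
    (\<lambda>s'. (\<forall>w<n. nat_mem s' ''mt'' [w] < k \<longleftrightarrow> w \<in> busy D k) \<and> samples s' = samples s)"
proof -
  have X1: "n \<le> X" "T \<le> X" "1 \<le> X" using X bounds by linarith+
  let ?J = "\<lambda>s'. nat_mem s' ''n'' [] = n \<and> nat_mem s' ''k'' [] = k \<and> (\<forall>w<n. has_vertex s' w (D w)) \<and>
    samples s' = samples s"
  let ?I = "\<lambda>j s'. ?J s' \<and> times_before D j (nat_mem s' ''mt'')"
  show ?thesis unfolding simulate_def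
  proof (rule runs_mono[OF runs_For[where Inv = ?I and m = k and p = 12 and d = 2 and X = X and B = "12 * X ^ 2"]])
    show "?I 0 (set_nat ''j'' [] 0 s)"
      using s D mt by (auto simp: base_def has_vertex_def times_before_def)
    fix j and s1 :: state assume j: "j < k" "nat_mem s1 ''j'' [] = j" "?I j s1"
    let ?K = "\<lambda>m s'. ?J s' \<and> nat_mem s' ''j'' [] = j \<and> times_ok D j m (nat_mem s' ''mt'')"
    let ?b = "BAnd (BNot (NLess (cell_at ''Y'' ''w'') (N ''j'')))
         (BAnd (BNot (NLess (N ''j'') (cell_at ''Y'' ''w'')))
         (BAnd (NLess (NConst 0) (cell_at ''F'' ''w''))
         (BAnd (NLess (NConst 0) (cell_at ''b'' ''w''))
         (BAnd (NLess (target_at ''Y'' ''w'') (N ''j'')) (BNot (NLess (target_at ''mt'' ''w'') (N ''j'')))))))"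
    let ?body = "If ?b (Seq (NAssign ''mt'' [NSub (cell_at ''F'' ''w'') (NConst 1)] (N ''j'')) (NAssign ''mt'' [N ''w''] (N ''j''))) Skip"
    have jT: "j < T" using j s by simp
    show "runs (For ''w'' (N ''n'') ?body) s1 (12 * X ^ 2) (\<lambda>s'. nat_mem s' ''j'' [] = j \<and> ?I (Suc j) (set_nat ''j'' [] (Suc j) s'))"
    proof (rule runs_mono[OF runs_For[where Inv = ?K and m = n and p = 6 and d = 1 and X = X and B = "2 * X + 3"]])
      show "?K 0 (set_nat ''w'' [] 0 s1)"
        using j times_ok_start[OF _ jT] by (auto simp: has_vertex_def)
      show "?K n s' \<and> nat_mem s' ''w'' [] = n \<Longrightarrow> nat_mem s' ''j'' [] = j \<and> ?I (Suc j) (set_nat ''j'' [] (Suc j) s')" for s'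
        using times_ok_next[OF D(2) jT] by (auto simp: has_vertex_def)
      fix w and s2 :: state assume w: "w < n" "nat_mem s2 ''w'' [] = w" "?K w s2"
      have b: "bval ?b s2 \<longleftrightarrow> (\<exists>u. sel D j u w)"
        using w by (intro has_vertex_sel[OF _ D(2) _ w(1) jT]) auto
      show "runs ?body s2 (2 * X + 3) (\<lambda>s'. nat_mem s' ''w'' [] = w \<and> ?K (Suc w) (set_nat ''w'' [] (Suc w) s'))"
      proof (rule runs_If[where B = "2 * X + 2"])
        assume "bval ?b s2"
        then obtain u where u: "sel D j u w" using b by blast
        then have "nat_mem s2 ''F'' [w] = Suc u"
          using w by (intro has_vertex_sel(2)[OF _ D(2) _ w(1) jT]) auto
        then show "runs (Seq (NAssign ''mt'' [NSub (cell_at ''F'' ''w'') (NConst 1)] (N ''j'')) (NAssign ''mt'' [N ''w''] (N ''j''))) s2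
            (2 * X + 2) (\<lambda>s'. nat_mem s' ''w'' [] = w \<and> ?K (Suc w) (set_nat ''w'' [] (Suc w) s'))"
          using w u times_ok_sel[OF _ u] jT X1
          by (intro runs_Seq_NAssign[where B = "X + 1" and B' = "X + 1"] runs_NAssign) (auto simp: has_vertex_def)
      next
        assume "\<not> bval ?b s2"
        then show "runs Skip s2 (2 * X + 2) (\<lambda>s'. nat_mem s' ''w'' [] = w \<and> ?K (Suc w) (set_nat ''w'' [] (Suc w) s'))"
          using w b times_ok_skip by (intro runs_Skip) (auto simp: has_vertex_def)
      qed simp
    qed (use X1 j in \<open>auto simp: power2_eq_square\<close>)
  qed (use s X1 in \<open>auto simp: times_before_def eval_nat_numeral\<close>)
qed

lemma runs_reset_times:
  assumes "nat_mem s ''n'' [] = n" "nat_mem s ''T'' [] = T" and X: "bound \<le> X"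
  shows "runs reset_times s (10 * X ^ 2) (\<lambda>s'. (\<forall>w<n. nat_mem s' ''mt'' [w] = T) \<and> samples s' = samples s)"
proof -
  have X1: "n \<le> X" "T \<le> X" "1 \<le> X" using X bounds by linarith+
  let ?I = "\<lambda>j s'. nat_mem s' ''n'' [] = n \<and> nat_mem s' ''T'' [] = T \<and> (\<forall>w<j. nat_mem s' ''mt'' [w] = T) \<and>
    samples s' = samples s"
  show ?thesis unfolding reset_times_def
    by (rule runs_mono[OF runs_For[where Inv = ?I and m = n and p = 2 and d = 1 and X = X and B = "X + 1"]])
      (use assms(1,2) X1 in \<open>auto simp: power2_eq_square intro!: runs_NAssign\<close>)
qed

text \<open>The strict bound \<open>c u < R\<close> keeps the incremented counts within
  \<open>R\<close>, and thereby the cost of storing them within the time bound.\<close>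

lemma runs_count_free:
  assumes "nat_mem s ''n'' [] = n" "nat_mem s ''k'' [] = k" "nat_mem s ''q'' [] = q" "k \<le> T" and X: "bound \<le> X"
    and D: "\<forall>w<n. has_vertex s w (D w)" "wf_data D" "\<forall>w<n. nat_mem s ''mt'' [w] < k \<longleftrightarrow> w \<in> busy D k"
    and c: "\<And>u. nat_mem s ''cnt'' [k, u, q] = c u" "\<And>u. c u < R"
  shows "runs count_free s (10 * X ^ 2) (\<lambda>s'. (\<forall>u. nat_mem s' ''cnt'' [k, u, q] = add_free k D c u) \<and>
    (\<forall>js. (\<forall>u. js \<noteq> [k, u, q]) \<longrightarrow> nat_mem s' ''cnt'' js = nat_mem s ''cnt'' js) \<and> samples s' = samples s)"
proof -
  have X1: "n \<le> X" "R \<le> X" "1 \<le> X" using X bounds by linarith+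
  let ?free = "\<lambda>u. phase D u < k \<and> u \<notin> busy D k"
  let ?I = "\<lambda>j s'. nat_mem s' ''n'' [] = n \<and> nat_mem s' ''k'' [] = k \<and> nat_mem s' ''q'' [] = q \<and>
    (\<forall>w<n. nat_mem s' ''Y'' [w] = phase D w) \<and> (\<forall>w<n. nat_mem s' ''mt'' [w] < k \<longleftrightarrow> w \<in> busy D k) \<and>
    (\<forall>u. nat_mem s' ''cnt'' [k, u, q] = (if u < j \<and> ?free u then Suc (c u) else c u)) \<and>
    (\<forall>js. (\<forall>u. js \<noteq> [k, u, q]) \<longrightarrow> nat_mem s' ''cnt'' js = nat_mem s ''cnt'' js) \<and> samples s' = samples s"
  have out: "\<not> ?free u" if "\<not> u < n" for u using D(2) that assms(4) by (auto simp: wf_data_def)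
  show ?thesis unfolding count_free_def
  proof (rule runs_mono[OF runs_For[where Inv = ?I and m = n and p = 3 and d = 1 and X = X and B = "X + 2"]])
    show "?I n s' \<and> nat_mem s' ''w'' [] = n \<Longrightarrow> (\<forall>u. nat_mem s' ''cnt'' [k, u, q] = add_free k D c u) \<and>
      (\<forall>js. (\<forall>u. js \<noteq> [k, u, q]) \<longrightarrow> nat_mem s' ''cnt'' js = nat_mem s ''cnt'' js) \<and> samples s' = samples s" for s'
      using out unfolding add_free_def by metis
    fix j and s1 :: state assume j: "j < n" "nat_mem s1 ''w'' [] = j" "?I j s1"
    have cX: "Suc (c u) \<le> X" for u using c(2)[of u] X1 by linarith
    show "runs (If (BAnd (NLess (cell_at ''Y'' ''w'') (N ''k'')) (BNot (NLess (cell_at ''mt'' ''w'') (N ''k''))))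
        (NAssign ''cnt'' [N ''k'', N ''w'', N ''q''] (NAdd (NCell ''cnt'' [N ''k'', N ''w'', N ''q'']) (NConst 1))) Skip) s1
        (X + 2) (\<lambda>s'. nat_mem s' ''w'' [] = j \<and> ?I (Suc j) (set_nat ''w'' [] (Suc j) s'))"
      by (rule runs_If[where B = "X + 1"])
        (use j cX in \<open>auto intro!: runs_NAssign runs_Skip simp: less_Suc_eq\<close>)
  qed (use assms(1-3) D c X1 in \<open>auto simp: has_vertex_def power2_eq_square\<close>)
qed

lemma writes_sample [simp]:
  "nat_writes draw_vertices = {''Y'', ''F'', ''b'', ''i'', ''w''}"
  "real_writes draw_vertices = {''U'', ''S''}"
  "nat_writes remove_vertex_q = {''Y'', ''F'', ''b''}" "real_writes remove_vertex_q = {}"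
  "nat_writes reset_times = {''mt'', ''w''}" "real_writes reset_times = {}"
  "nat_writes simulate = {''mt'', ''w'', ''j''}" "real_writes simulate = {}"
  "nat_writes count_free = {''cnt'', ''w''}" "real_writes count_free = {}"
  by (auto simp: draw_vertices_def remove_vertex_q_def reset_times_def simulate_def count_free_def)

end

context scheme
begin

lemma runs_remove_vertex:
  assumes "nat_mem s ''q'' [] = q" "nat_mem s ''T'' [] = T" "T \<le> X" "1 \<le> X"
    and D: "\<forall>w<n. has_vertex s w (D w)"
  shows "runs remove_vertex_q s (5 * X) (\<lambda>s'. (\<forall>w<n. has_vertex s' w ((D(q := absent T)) w)) \<and> samples s' = samples s)"
  unfolding remove_vertex_q_def
  by (intro runs_Seq_NAssign[where B = "X + 1" and B' = "2"] runs_Seq_NAssign[where B = 1 and B' = 1] runs_NAssign)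
    (use assms in \<open>auto simp: has_vertex_def\<close>)

lemma runs_sample_free:
  assumes s: "base s" "nat_mem s ''k'' [] = k" "nat_mem s ''q'' [] = q" "has_tables k tab s" "k \<le> T" "q < n"
    and X: "bound \<le> X"
    and c: "\<And>u. nat_mem s ''cnt'' [k, u, q] = c u" "\<And>u. c u < R"
  shows "runs sample_free s (81 * X ^ 3) (\<lambda>s'.
    (\<forall>u. nat_mem s' ''cnt'' [k, u, q] = add_free k (fst (s_data tab k q (samples s))) c u) \<and>
    (\<forall>js. (\<forall>u. js \<noteq> [k, u, q]) \<longrightarrow> nat_mem s' ''cnt'' js = nat_mem s ''cnt'' js) \<and>
    samples s' = snd (s_data tab k q (samples s)))"
proof -
  have X1: "n \<le> X" "T \<le> X" "1 \<le> X" using X bounds by linarith+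
  have XX: "X \<le> X ^ 3" "X ^ 2 \<le> X ^ 3" using X1 by (auto intro: self_le_power power_increasing)
  let ?All = "fst (s_all tab k n (samples s))"
  let ?D = "fst (s_data tab k q (samples s))"
  let ?Q = "\<lambda>s'. (\<forall>u. nat_mem s' ''cnt'' [k, u, q] = add_free k ?D c u) \<and>
    (\<forall>js. (\<forall>u. js \<noteq> [k, u, q]) \<longrightarrow> nat_mem s' ''cnt'' js = nat_mem s ''cnt'' js) \<and>
    samples s' = snd (s_data tab k q (samples s))"
  have D: "?D = ?All(q := absent T)" "snd (s_data tab k q (samples s)) = snd (s_all tab k n (samples s))"
    by (simp_all add: s_data_def s_bind_def s_ret_def)
  have wf: "wf_data ?D" using s by (intro wf_data)
  show ?thesis unfolding sample_free_def
  proof (rule runs_Seq_block[where B' = "42 * X ^ 3", OF runs_draw_vertices[OF s(1,2,4) X]])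
    fix s1 :: state
    assume s1: "(\<forall>w<n. has_vertex s1 w (?All w)) \<and> samples s1 = snd (s_all tab k n (samples s))"
      and f1: "\<And>a. a \<notin> nat_writes draw_vertices \<Longrightarrow> nat_mem s1 a = nat_mem s a"
      "\<And>a. a \<notin> real_writes draw_vertices \<Longrightarrow> real_mem s1 a = real_mem s a"
    show "runs (Seq remove_vertex_q (Seq reset_times (Seq simulate count_free))) s1 (42 * X ^ 3) ?Q"
    proof (rule runs_Seq_block[where B' = "37 * X ^ 3", OF runs_remove_vertex[of s1 q X ?All]])
      fix s2 :: state
      assume s2: "(\<forall>w<n. has_vertex s2 w ((?All(q := absent T)) w)) \<and> samples s2 = samples s1"
        and f2: "\<And>a. a \<notin> nat_writes remove_vertex_q \<Longrightarrow> nat_mem s2 a = nat_mem s1 a"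
        "\<And>a. a \<notin> real_writes remove_vertex_q \<Longrightarrow> real_mem s2 a = real_mem s1 a"
      show "runs (Seq reset_times (Seq simulate count_free)) s2 (37 * X ^ 3) ?Q"
      proof (rule runs_Seq_block[where B' = "27 * X ^ 3", OF runs_reset_times[of s2 X]])
        fix s3 :: state
        assume s3: "(\<forall>w<n. nat_mem s3 ''mt'' [w] = T) \<and> samples s3 = samples s2"
          and f3: "\<And>a. a \<notin> nat_writes reset_times \<Longrightarrow> nat_mem s3 a = nat_mem s2 a"
          "\<And>a. a \<notin> real_writes reset_times \<Longrightarrow> real_mem s3 a = real_mem s2 a"
        have D3: "\<forall>w<n. has_vertex s3 w (?D w)"
          using s2 by (simp add: has_vertex_def f3 D)
        show "runs (Seq simulate count_free) s3 (27 * X ^ 3) ?Q"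
        proof (rule runs_Seq_block[where B' = "10 * X ^ 2", OF runs_simulate[of s3 k X ?D]])
          fix s4 :: state
          assume s4: "(\<forall>w<n. nat_mem s4 ''mt'' [w] < k \<longleftrightarrow> w \<in> busy ?D k) \<and> samples s4 = samples s3"
            and f4: "\<And>a. a \<notin> nat_writes simulate \<Longrightarrow> nat_mem s4 a = nat_mem s3 a"
            "\<And>a. a \<notin> real_writes simulate \<Longrightarrow> real_mem s4 a = real_mem s3 a"
          show "runs count_free s4 (10 * X ^ 2) ?Q"
            by (rule runs_mono[OF runs_count_free[of s4 k q X ?D c]])
              (use s X c wf s1 s2 s3 s4 D3 in \<open>auto simp: base_def f1 f2 f3 f4 has_vertex_def D(2)\<close>)
        qed (use s X D3 wf s3 XX in \<open>auto simp: base_def f1 f2 f3\<close>)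
      qed (use s X XX in \<open>auto simp: base_def f1 f2\<close>)
    qed (use s s1 X1 XX in \<open>auto simp: base_def f1\<close>)
  qed simp
qed

end

section \<open>Computing the parameters and the tables\<close>

lemma runs_compute_params:
  fixes \<epsilon> :: real and M :: nat
  defines "M \<equiv> nat \<lceil>1 / \<epsilon>\<rceil>"
  assumes \<epsilon>: "0 < \<epsilon>" "real_mem s ''eps'' [] = \<epsilon>" and n: "nat_mem s ''n'' [] = n"
    and T: "T = 60 * ((n + 1) * (n + 1) * M)" and h: "h = 48 * T * ((n + 1) * (n + 1)) * (M * M)"
    and R: "R = 48 * M * h" and X: "T \<le> X" "h \<le> X" "R \<le> X" "M \<le> X"
  shows "runs compute_params s (14 * X ^ 2) (\<lambda>s'. nat_mem s' ''T'' [] = T \<and> nat_mem s' ''h'' [] = h \<and>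
    nat_mem s' ''R'' [] = R \<and> samples s' = samples s)"
proof -
  let ?b = "RLess (RScale (N ''m'') (RCell ''eps'' [])) (RNat (NConst 1))"
  let ?W = "While ?b (inc ''m'')"
  have "0 < \<lceil>1 / \<epsilon>\<rceil>" using \<epsilon>(1) by (simp add: zero_less_ceiling)
  then have M: "1 \<le> M" unfolding M_def by linarith
  have less: "real m * \<epsilon> < 1 \<longleftrightarrow> m < M" for m
  proof -
    have "real m * \<epsilon> < 1 \<longleftrightarrow> real m < 1 / \<epsilon>" using \<epsilon>(1) by (simp add: field_simps)
    also have "\<dots> \<longleftrightarrow> int m < \<lceil>1 / \<epsilon>\<rceil>" by (simp add: less_ceiling_iff)
    also have "\<dots> \<longleftrightarrow> m < M" unfolding M_def by linarith
    finally show ?thesis .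
  qed
  have loop: "nat_mem s1 ''m'' [] = m \<Longrightarrow> real_mem s1 ''eps'' [] = \<epsilon> \<Longrightarrow>
      runs ?W s1 (1 + (M - m) * (M + 2)) (\<lambda>s'. nat_mem s' ''m'' [] = M \<and> samples s' = samples s1)"
    if "m \<le> M" for m s1
    using that
  proof (induction m arbitrary: s1 rule: inc_induct)
    case base
    then have "\<not> bval ?b s1" using less[of M] by simp
    then have "exec ?W s1 1 s1" by (rule exec.WhileFalse)
    then show ?case using base unfolding runs_def by (intro exI[of _ 1] exI[of _ s1]) auto
  next
    case (step m)
    have b: "bval ?b s1" using less[of m] step by simp
    have "runs (inc ''m'') s1 (1 + Suc m) (\<lambda>s'. nat_mem s' ''m'' [] = Suc m \<and> real_mem s' ''eps'' [] = \<epsilon> \<and> samples s' = samples s1)"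
      by (rule runs_NAssign) (use step in auto)
    then obtain t s' where s': "exec (inc ''m'') s1 t s'" "t \<le> 1 + Suc m" "nat_mem s' ''m'' [] = Suc m"
      "real_mem s' ''eps'' [] = \<epsilon>" "samples s' = samples s1" unfolding runs_def by blast
    have "runs ?W s' (1 + (M - Suc m) * (M + 2)) (\<lambda>s''. nat_mem s'' ''m'' [] = M \<and> samples s'' = samples s')"
      by (rule step.IH) fact+
    then obtain t' s'' where s'': "exec ?W s' t' s''" "t' \<le> 1 + (M - Suc m) * (M + 2)"
      "nat_mem s'' ''m'' [] = M" "samples s'' = samples s'" unfolding runs_def by blast
    have "1 + t + t' \<le> 1 + (M + 2) + (M - Suc m) * (M + 2)" using s'(2) s''(2) step by linarith
    also have "\<dots> = 1 + (M - m) * (M + 2)"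
    proof -
      have "M - m = Suc (M - Suc m)" using step by simp
      then show ?thesis by (simp only: mult_Suc add.assoc)
    qed
    finally have "1 + t + t' \<le> 1 + (M - m) * (M + 2)" .
    moreover have "samples s'' = samples s1" using s'' s' by simp
    ultimately show ?case unfolding runs_def
      using exec.WhileTrue[OF b s'(1) s''(1)] s''(3) by blast
  qed
  have X1: "1 \<le> X" "1 \<le> X ^ 2" "X \<le> X ^ 2" using M X by (auto simp: power2_eq_square)
  have "(M - 1) * (M + 2) \<le> X * (X + 2)" using X by (intro mult_mono) auto
  moreover have "X * (X + 2) = X ^ 2 + 2 * X" by (simp add: power2_eq_square)
  ultimately have C: "1 + (M - 1) * (M + 2) \<le> 4 * X ^ 2" using X1 by linarith
  let ?s = "set_nat ''m'' [] 1 s"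
  show ?thesis unfolding compute_params_def
  proof (rule runs_Seq_NAssign[where B = 2 and B' = "11 * X ^ 2"])
    have w: "runs ?W ?s (4 * X ^ 2) (\<lambda>s'. nat_mem s' ''m'' [] = M \<and> samples s' = samples s)"
      by (rule runs_mono[OF loop[OF M] C]) (use \<epsilon> in auto)
    show "runs (Seq ?W
     (Seq (NAssign ''T'' [] (NMul (NConst 60) (NMul (NMul (NAdd (N ''n'') (NConst 1)) (NAdd (N ''n'') (NConst 1))) (N ''m''))))
     (Seq (NAssign ''h'' [] (NMul (NMul (NMul (NConst 48) (N ''T'')) (NMul (NAdd (N ''n'') (NConst 1)) (NAdd (N ''n'') (NConst 1))))
         (NMul (N ''m'') (N ''m''))))
        (NAssign ''R'' [] (NMul (NMul (NConst 48) (N ''m'')) (N ''h''))))))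
      (set_nat ''m'' (map (\<lambda>j. nval j s) []) (nval (NConst 1) s) s) (11 * X ^ 2)
      (\<lambda>s'. nat_mem s' ''T'' [] = T \<and> nat_mem s' ''h'' [] = h \<and> nat_mem s' ''R'' [] = R \<and> samples s' = samples s)"
      unfolding list.map nval.simps
    proof (rule runs_Seq_block[where B' = "6 * X ^ 2", OF w])
      fix s1 :: state
      assume s1: "nat_mem s1 ''m'' [] = M \<and> samples s1 = samples s"
        and f: "\<And>a. a \<notin> nat_writes ?W \<Longrightarrow> nat_mem s1 a = nat_mem ?s a"
      have n1: "nat_mem s1 ''n'' [] = n" using f[of "''n''"] n by simp
      show "runs (Seq (NAssign ''T'' [] (NMul (NConst 60) (NMul (NMul (NAdd (N ''n'') (NConst 1)) (NAdd (N ''n'') (NConst 1))) (N ''m''))))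
     (Seq (NAssign ''h'' [] (NMul (NMul (NMul (NConst 48) (N ''T'')) (NMul (NAdd (N ''n'') (NConst 1)) (NAdd (N ''n'') (NConst 1))))
         (NMul (N ''m'') (N ''m''))))
        (NAssign ''R'' [] (NMul (NMul (NConst 48) (N ''m'')) (N ''h''))))) s1 (6 * X ^ 2)
      (\<lambda>s'. nat_mem s' ''T'' [] = T \<and> nat_mem s' ''h'' [] = h \<and> nat_mem s' ''R'' [] = R \<and> samples s' = samples s)"
        by (rule runs_Seq_NAssign[where B = "1 + T" and B' = "4 * X ^ 2"],
            rule runs_Seq_NAssign[where B = "1 + h" and B' = "2 * X ^ 2"], rule runs_NAssign)
          (use s1 n1 X X1 in \<open>simp_all add: T h R\<close>)
    qed (use X1 in simp_all)
  qed (use X1 in simp_all)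
qed

context scheme
begin

lemma count_le: "fst (s_count tab k v m \<omega>) u \<le> m"
  by (induction m) (auto simp: s_count_def s_ret_def s_bind_def add_free_def le_SucI)

text \<open>The program never clears \<open>cnt\<close>; counting in a new column relies on its
  cells being zero.\<close>

lemma row_zero: "m \<le> v \<Longrightarrow> fst (s_row tab k m \<omega>) u v = 0"
  by (induction m) (auto simp: s_row_def s_ret_def s_bind_def set_column_def)

lemma s_count_Suc: "s_count tab k v (Suc m) \<omega> =
   (let (c, \<omega>') = s_count tab k v m \<omega>; (D, \<omega>'') = s_data tab k v \<omega>' in (add_free k D c, \<omega>''))"
  by (simp add: s_count_def s_bind_def s_ret_def case_prod_unfold Let_def)

lemma s_row_Suc: "s_row tab k (Suc m) \<omega> =
   (let (c, \<omega>') = s_row tab k m \<omega>; (c0, \<omega>'') = s_count tab k m R \<omega>' in (set_column m c0 c, \<omega>''))"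
  by (simp add: s_row_def s_bind_def s_ret_def case_prod_unfold Let_def)

lemma s_tables_Suc: "s_tables (Suc m) \<omega> =
   (let (tab, \<omega>') = s_tables m \<omega>; (c, \<omega>'') = s_row tab m n \<omega>' in (set_row m c tab, \<omega>''))"
  by (simp add: s_tables_def s_bind_def s_ret_def case_prod_unfold Let_def)

lemma writes_sample_free [simp]:
  "nat_writes sample_free = {''Y'', ''F'', ''b'', ''i'', ''w'', ''mt'', ''j'', ''cnt''}"
  "real_writes sample_free = {''U'', ''S''}"
  by (auto simp: sample_free_def)

lemma runs_fill_row:
  assumes s: "base s" "nat_mem s ''k'' [] = k" "has_tables k tab s" "k \<le> T" and X: "bound \<le> X"
    and z: "\<And>u v. nat_mem s ''cnt'' [k, u, v] = 0"
  shows "runs fill_row s (91 * X ^ 5) (\<lambda>s'.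
    (\<forall>u v. nat_mem s' ''cnt'' [k, u, v] = fst (s_row tab k n (samples s)) u v) \<and>
    (\<forall>js. (\<forall>u v. js \<noteq> [k, u, v]) \<longrightarrow> nat_mem s' ''cnt'' js = nat_mem s ''cnt'' js) \<and>
    samples s' = snd (s_row tab k n (samples s)))"
proof -
  have X1: "n \<le> X" "R \<le> X" "1 \<le> X" using X bounds by linarith+
  let ?J = "\<lambda>c s'. base s' \<and> nat_mem s' ''k'' [] = k \<and> has_tables k tab s' \<and>
    (\<forall>u v. nat_mem s' ''cnt'' [k, u, v] = c u v) \<and>
    (\<forall>js. (\<forall>u v. js \<noteq> [k, u, v]) \<longrightarrow> nat_mem s' ''cnt'' js = nat_mem s ''cnt'' js)"
  let ?I = "\<lambda>q s'. ?J (fst (s_row tab k q (samples s))) s' \<and> samples s' = snd (s_row tab k q (samples s))"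
  show ?thesis unfolding fill_row_def
  proof (rule runs_mono[OF runs_For[where Inv = ?I and m = n and p = 86 and d = 4 and X = X and B = "86 * X ^ 4"]])
    show "?I 0 (set_nat ''q'' [] 0 s)"
      using s z by (auto simp: base_def has_tables_def s_row_def s_ret_def)
    fix q and s1 :: state assume q: "q < n" "nat_mem s1 ''q'' [] = q" "?I q s1"
    let ?c = "fst (s_row tab k q (samples s))" and ?\<omega> = "snd (s_row tab k q (samples s))"
    let ?K = "\<lambda>r s'. nat_mem s' ''q'' [] = q \<and> ?J (set_column q (fst (s_count tab k q r ?\<omega>)) ?c) s' \<and>
      samples s' = snd (s_count tab k q r ?\<omega>)"
    show "runs (For ''r'' (N ''R'') sample_free) s1 (86 * X ^ 4)
        (\<lambda>s'. nat_mem s' ''q'' [] = q \<and> ?I (Suc q) (set_nat ''q'' [] (Suc q) s'))"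
    proof (rule runs_mono[OF runs_For[where Inv = ?K and m = R and p = 81 and d = 3 and X = X and B = "81 * X ^ 3"]])
      show "?K 0 (set_nat ''r'' [] 0 s1)"
        using q row_zero[of q q tab k "samples s"]
        by (auto simp: base_def has_tables_def s_count_def s_ret_def set_column_def)
      show "?K R s' \<and> nat_mem s' ''r'' [] = R \<Longrightarrow> nat_mem s' ''q'' [] = q \<and> ?I (Suc q) (set_nat ''q'' [] (Suc q) s')" for s'
        by (auto simp: base_def has_tables_def s_row_Suc Let_def case_prod_unfold)
      fix r and s2 :: state assume r: "r < R" "nat_mem s2 ''r'' [] = r" "?K r s2"
      let ?col = "fst (s_count tab k q r ?\<omega>)"
      have c0: "?col u < R" for u using count_le[of tab k q r ?\<omega> u] r(1) by linarith
      have cnt: "nat_mem s2 ''cnt'' [k, u, q] = ?col u" for u using r by (simp add: set_column_def)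
      have J: "?J (set_column q (add_free k (fst (s_data tab k q (samples s2))) ?col) ?c) s3"
        if s3: "\<forall>u. nat_mem s3 ''cnt'' [k, u, q] = add_free k (fst (s_data tab k q (samples s2))) ?col u"
          "\<forall>js. (\<forall>u. js \<noteq> [k, u, q]) \<longrightarrow> nat_mem s3 ''cnt'' js = nat_mem s2 ''cnt'' js"
        and f: "\<And>a. a \<notin> nat_writes sample_free \<Longrightarrow> nat_mem s3 a = nat_mem s2 a"
          "\<And>a. a \<notin> real_writes sample_free \<Longrightarrow> real_mem s3 a = real_mem s2 a" for s3 :: state
        using r s3 by (auto simp: base_def has_tables_def set_column_def f)
      show "runs sample_free s2 (81 * X ^ 3) (\<lambda>s'. nat_mem s' ''r'' [] = r \<and> ?K (Suc r) (set_nat ''r'' [] (Suc r) s'))"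
      proof (rule runs_frame[OF runs_sample_free[of s2 k q tab X ?col]])
        fix s3 :: state
        assume s3: "(\<forall>u. nat_mem s3 ''cnt'' [k, u, q] = add_free k (fst (s_data tab k q (samples s2))) ?col u) \<and>
            (\<forall>js. (\<forall>u. js \<noteq> [k, u, q]) \<longrightarrow> nat_mem s3 ''cnt'' js = nat_mem s2 ''cnt'' js) \<and>
            samples s3 = snd (s_data tab k q (samples s2))"
          and f: "\<And>a. a \<notin> nat_writes sample_free \<Longrightarrow> nat_mem s3 a = nat_mem s2 a"
          "\<And>a. a \<notin> real_writes sample_free \<Longrightarrow> real_mem s3 a = real_mem s2 a"
        show "nat_mem s3 ''r'' [] = r \<and> ?K (Suc r) (set_nat ''r'' [] (Suc r) s3)"
          using J[OF _ _ f] s3 r by (auto simp: f s_count_Suc Let_def case_prod_unfold base_def has_tables_def)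
      qed (use r q s X cnt c0 in auto)
    qed (use X1 in \<open>auto simp: base_def eval_nat_numeral\<close>)
  qed (use X1 in \<open>auto simp: base_def eval_nat_numeral\<close>)
qed

lemma runs_fill_min:
  assumes s: "base s" "nat_mem s ''k'' [] = k" and X: "bound \<le> X"
    and c: "\<And>u v. nat_mem s ''cnt'' [k, u, v] = c u v"
  shows "runs fill_min s (15 * X ^ 3) (\<lambda>s'. nat_mem s' ''mn'' = (nat_mem s ''mn'')([k] := row_min c) \<and>
    samples s' = samples s)"
proof -
  have X1: "n \<le> X" "R \<le> X" "1 \<le> X" using X bounds by linarith+
  then have XX: "X \<le> X ^ 3" "1 \<le> X ^ 3" by (auto intro: self_le_power)
  \<comment> \<open>The counts of the pairs visited by the two loops before
    \<open>(a, b)\<close>.\<close>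
  let ?S = "\<lambda>a b. {c u v |u v. (u < a \<and> v < n \<or> u = a \<and> v < b) \<and> 0 < xv u v}"
  let ?J = "\<lambda>s'. base s' \<and> nat_mem s' ''k'' [] = k \<and> nat_mem s' ''cnt'' = nat_mem s ''cnt'' \<and> samples s' = samples s"
  let ?mn = "\<lambda>a b s'. nat_mem s' ''mn'' = (nat_mem s ''mn'')([k] := Min (insert R (?S a b)))"
  have fin: "finite (?S a b)" for a b
    by (rule finite_subset[of _ "(\<lambda>(u, v). c u v) ` ({..a} \<times> {..<n + b})"]) auto
  have S0: "?S a n = ?S (Suc a) 0" for a by (auto simp: less_Suc_eq)
  have Suc: "?S a (Suc b) = (if 0 < xv a b then insert (c a b) (?S a b) else ?S a b)" for a b
    by (auto simp: less_Suc_eq)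
  have Sn: "?S n 0 = {c u v |u v. u < n \<and> v < n \<and> 0 < xv u v}" by auto
  have le: "Min (insert R (?S a b)) \<le> R" for a b using fin by (intro Min_le) auto
  let ?body = "If (BAnd (RLess (RNat (NConst 0)) (RCell ''x'' [N ''w'', N ''i'']))
             (NLess (NCell ''cnt'' [N ''k'', N ''w'', N ''i'']) (cell_at ''mn'' ''k'')))
          (NAssign ''mn'' [N ''k''] (NCell ''cnt'' [N ''k'', N ''w'', N ''i''])) Skip"
  have step: "Min (insert R (?S a (Suc b))) = (if 0 < xv a b \<and> c a b < Min (insert R (?S a b)) then c a b
      else Min (insert R (?S a b)))" for a b
  proof (cases "0 < xv a b")
    case True
    then have "Min (insert R (?S a (Suc b))) = min (c a b) (Min (insert R (?S a b)))"
      unfolding Suc using fin[of a b] by (simp only: if_True insert_commute[of R "c a b"]) (subst Min_insert, auto)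
    then show ?thesis using True by (simp add: min_def)
  qed (simp add: Suc)
  show ?thesis unfolding fill_min_def
  proof (rule runs_Seq_NAssign[where B = "1 + X" and B' = "13 * X ^ 3"])
    let ?s = "set_nat ''mn'' (map (\<lambda>j. nval j s) [N ''k'']) (nval (N ''R'') s) s"
    let ?I = "\<lambda>a s'. ?J s' \<and> ?mn a 0 s'"
    show "runs (For ''w'' (N ''n'') (For ''i'' (N ''n'') ?body)) ?s (13 * X ^ 3)
       (\<lambda>s'. nat_mem s' ''mn'' = (nat_mem s ''mn'')([k] := row_min c) \<and> samples s' = samples s)"
    proof (rule runs_mono[OF runs_For[where Inv = ?I and m = n and p = 8 and d = 2 and X = X and B = "8 * X ^ 2"]])
      show "?I 0 (set_nat ''w'' [] 0 ?s)" using s by (auto simp: base_def)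
      show "?I n s' \<and> nat_mem s' ''w'' [] = n \<Longrightarrow>
          nat_mem s' ''mn'' = (nat_mem s ''mn'')([k] := row_min c) \<and> samples s' = samples s" for s'
        unfolding Sn row_min_def by simp
      fix a and s1 :: state assume a: "a < n" "nat_mem s1 ''w'' [] = a" "?I a s1"
      let ?K = "\<lambda>b s'. nat_mem s' ''w'' [] = a \<and> ?J s' \<and> ?mn a b s'"
      show "runs (For ''i'' (N ''n'') ?body) s1 (8 * X ^ 2) (\<lambda>s'. nat_mem s' ''w'' [] = a \<and> ?I (Suc a) (set_nat ''w'' [] (Suc a) s'))"
      proof (rule runs_mono[OF runs_For[where Inv = ?K and m = n and p = 3 and d = 1 and X = X and B = "X + 2"]])
        show "?K 0 (set_nat ''i'' [] 0 s1)" using a by (auto simp: base_def)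
        show "?K n s' \<and> nat_mem s' ''i'' [] = n \<Longrightarrow> nat_mem s' ''w'' [] = a \<and> ?I (Suc a) (set_nat ''w'' [] (Suc a) s')" for s'
          unfolding S0 by (simp add: base_def)
        fix b and s2 :: state assume b: "b < n" "nat_mem s2 ''i'' [] = b" "?K b s2"
        have cond: "bval (BAnd (RLess (RNat (NConst 0)) (RCell ''x'' [N ''w'', N ''i'']))
             (NLess (NCell ''cnt'' [N ''k'', N ''w'', N ''i'']) (cell_at ''mn'' ''k''))) s2 \<longleftrightarrow>
            0 < xv a b \<and> c a b < Min (insert R (?S a b))"
          using b c by (simp add: base_def)
        show "runs ?body s2 (X + 2) (\<lambda>s'. nat_mem s' ''i'' [] = b \<and> ?K (Suc b) (set_nat ''i'' [] (Suc b) s'))"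
        proof (rule runs_If[where B = "X + 1"])
          assume "bval (BAnd (RLess (RNat (NConst 0)) (RCell ''x'' [N ''w'', N ''i'']))
             (NLess (NCell ''cnt'' [N ''k'', N ''w'', N ''i'']) (cell_at ''mn'' ''k''))) s2"
          then have t: "0 < xv a b \<and> c a b < Min (insert R (?S a b))" using cond by blast
          then have "c a b \<le> X" using le[of a b] X1 by linarith
          moreover have m: "Min (insert R (?S a (Suc b))) = c a b" using t by (simp only: step if_True simp_thms)
          ultimately show "runs (NAssign ''mn'' [N ''k''] (NCell ''cnt'' [N ''k'', N ''w'', N ''i''])) s2 (X + 1)
              (\<lambda>s'. nat_mem s' ''i'' [] = b \<and> ?K (Suc b) (set_nat ''i'' [] (Suc b) s'))"
            unfolding m using b c by (intro runs_NAssign) (auto simp: base_def)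
        next
          assume "\<not> bval (BAnd (RLess (RNat (NConst 0)) (RCell ''x'' [N ''w'', N ''i'']))
             (NLess (NCell ''cnt'' [N ''k'', N ''w'', N ''i'']) (cell_at ''mn'' ''k''))) s2"
          then have t: "\<not> (0 < xv a b \<and> c a b < Min (insert R (?S a b)))" using cond by blast
          have m: "Min (insert R (?S a (Suc b))) = Min (insert R (?S a b))" using t by (simp only: step if_False)
          show "runs Skip s2 (X + 1) (\<lambda>s'. nat_mem s' ''i'' [] = b \<and> ?K (Suc b) (set_nat ''i'' [] (Suc b) s'))"
            unfolding m using b by (intro runs_Skip) (auto simp: base_def)
        qed simp
      qed (use X1 in \<open>auto simp: base_def power2_eq_square\<close>)
    qed (use X1 in \<open>auto simp: base_def eval_nat_numeral\<close>)
  qed (use s X1 XX in \<open>auto simp: base_def\<close>)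
qed

lemma writes_fill [simp]:
  "nat_writes fill_row = {''Y'', ''F'', ''b'', ''i'', ''w'', ''mt'', ''j'', ''cnt'', ''r'', ''q''}"
  "real_writes fill_row = {''U'', ''S''}"
  "nat_writes fill_min = {''mn'', ''w'', ''i''}" "real_writes fill_min = {}"
  by (auto simp: fill_row_def fill_min_def)

lemma runs_fill_tables:
  assumes s: "base s" and X: "bound \<le> X" and z: "\<And>k u v. nat_mem s ''cnt'' [k, u, v] = 0"
  shows "runs fill_tables s (111 * X ^ 6) (\<lambda>s'. base s' \<and> nat_mem s' ''k'' [] = T \<and>
    has_tables T (fst (s_tables T (samples s))) s' \<and> samples s' = snd (s_tables T (samples s)))"
proof -
  have X1: "n \<le> X" "T \<le> X" "1 \<le> X" using X bounds by linarith+
  have XX: "X ^ 3 \<le> X ^ 5" using X1 by (intro power_increasing) auto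
  let ?I = "\<lambda>k s'. base s' \<and> has_tables k (fst (s_tables k (samples s))) s' \<and>
    (\<forall>j\<ge>k. \<forall>u v. nat_mem s' ''cnt'' [j, u, v] = 0) \<and> samples s' = snd (s_tables k (samples s))"
  show ?thesis unfolding fill_tables_def
  proof (rule runs_mono[OF runs_For[where Inv = ?I and m = T and p = 106 and d = 5 and X = X and B = "106 * X ^ 5"]])
    fix k and s1 :: state assume k: "k < T" "nat_mem s1 ''k'' [] = k" "?I k s1"
    let ?tab = "fst (s_tables k (samples s))"
    let ?row = "fst (s_row ?tab k n (samples s1))"
    show "runs (Seq fill_row fill_min) s1 (106 * X ^ 5) (\<lambda>s'. nat_mem s' ''k'' [] = k \<and> ?I (Suc k) (set_nat ''k'' [] (Suc k) s'))"
    proof (rule runs_Seq_block[where B' = "15 * X ^ 3", OF runs_fill_row[of s1 k ?tab X]])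
      fix s2 :: state
      assume s2: "(\<forall>u v. nat_mem s2 ''cnt'' [k, u, v] = ?row u v) \<and>
          (\<forall>js. (\<forall>u v. js \<noteq> [k, u, v]) \<longrightarrow> nat_mem s2 ''cnt'' js = nat_mem s1 ''cnt'' js) \<and>
          samples s2 = snd (s_row ?tab k n (samples s1))"
        and f2: "\<And>a. a \<notin> nat_writes fill_row \<Longrightarrow> nat_mem s2 a = nat_mem s1 a"
          "\<And>a. a \<notin> real_writes fill_row \<Longrightarrow> real_mem s2 a = real_mem s1 a"
      show "runs fill_min s2 (15 * X ^ 3) (\<lambda>s'. nat_mem s' ''k'' [] = k \<and> ?I (Suc k) (set_nat ''k'' [] (Suc k) s'))"
      proof (rule runs_frame[OF runs_fill_min[of s2 k X ?row]])
        fix s3 :: state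
        assume s3: "nat_mem s3 ''mn'' = (nat_mem s2 ''mn'')([k] := row_min ?row) \<and> samples s3 = samples s2"
          and f3: "\<And>a. a \<notin> nat_writes fill_min \<Longrightarrow> nat_mem s3 a = nat_mem s2 a"
            "\<And>a. a \<notin> real_writes fill_min \<Longrightarrow> real_mem s3 a = real_mem s2 a"
        have cnt: "nat_mem s3 ''cnt'' [j, u, v] = (if j = k then ?row u v else nat_mem s1 ''cnt'' [j, u, v])" for j u v
          using s2 by (simp add: f3)
        have "fst (fst (s_tables (Suc k) (samples s))) = (fst ?tab)(k := ?row)"
          "snd (fst (s_tables (Suc k) (samples s))) = (snd ?tab)(k := row_min ?row)"
          "snd (s_tables (Suc k) (samples s)) = snd (s_row ?tab k n (samples s1))"
          using k by (simp_all add: s_tables_Suc Let_def case_prod_unfold set_row_def)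
        then show "nat_mem s3 ''k'' [] = k \<and> ?I (Suc k) (set_nat ''k'' [] (Suc k) s3)"
          using k s2 s3 by (auto simp: base_def has_tables_def f2 f3 cnt)
      qed (use k s2 X in \<open>auto simp: base_def f2\<close>)
    qed (use k X XX in auto)
  qed (use s z X1 in \<open>auto simp: base_def has_tables_def s_tables_def s_ret_def eval_nat_numeral\<close>)
qed

definition s_order :: "nat \<Rightarrow> (nat \<Rightarrow> nat) sampler" where
  "s_order m = s_iter (\<lambda>w z. s_bind (s_draw (phase_upto T T)) (\<lambda>y. s_ret (z(w := y)))) m (\<lambda>_. T)"

lemma realises_order: "realises (s_order n) (Pi_pmf {..<n} T (\<lambda>_. pmf_of_set {..<T}))"
  unfolding s_order_def p_iter_Pi_pmf[symmetric]
  by (intro realises_iter realises_bind realises_phase[OF T] realises_ret)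

lemma s_order_less: "w < m \<Longrightarrow> fst (s_order m \<omega>) w < T"
  using T by (induction m) (auto simp: s_order_def s_bind_def s_ret_def s_draw_def phase_upto_less less_Suc_eq)

lemma runs_draw_order:
  assumes s: "base s" and X: "bound \<le> X"
  shows "runs draw_order s (20 * X ^ 3) (\<lambda>s'. (\<forall>w<n. nat_mem s' ''Y'' [w] = fst (s_order n (samples s)) w) \<and>
    samples s' = snd (s_order n (samples s)))"
proof -
  have X1: "n \<le> X" "T \<le> X" "1 \<le> X" using X bounds by linarith+
  let ?I = "\<lambda>m s'. base s' \<and> (\<forall>w<m. nat_mem s' ''Y'' [w] = fst (s_order m (samples s)) w) \<and>
    samples s' = snd (s_order m (samples s))"
  show ?thesis unfolding draw_order_def
  proof (rule runs_mono[OF runs_For[where Inv = ?I and m = n and p = 15 and d = 2 and X = X and B = "15 * X ^ 2"]])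
    fix w and s1 :: state assume w: "w < n" "nat_mem s1 ''w'' [] = w" "?I w s1"
    show "runs draw_phase s1 (15 * X ^ 2) (\<lambda>s'. nat_mem s' ''w'' [] = w \<and> ?I (Suc w) (set_nat ''w'' [] (Suc w) s'))"
      by (rule runs_frame[OF runs_draw_phase[of s1 w X]])
        (use w X1 in \<open>auto simp: base_def s_order_def s_bind_def s_ret_def s_draw_def less_Suc_eq\<close>)
  qed (use s X1 in \<open>auto simp: base_def s_order_def s_ret_def eval_nat_numeral\<close>)
qed

end

section \<open>Processing the arrivals\<close>

text \<open>The output of the counting sort once all values below \<open>j\<close>, and for the
  value \<open>j\<close> the first \<open>m\<close> entries, have been treated.\<close>

definition sorted_part :: "nat list \<Rightarrow> nat \<Rightarrow> nat \<Rightarrow> nat list" where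
  "sorted_part zs j m = concat (map (\<lambda>i. filter (\<lambda>y. y = i) zs) [0..<j]) @ filter (\<lambda>y. y = j) (take m zs)"

lemma sorted_part_next: "sorted_part zs j (length zs) = sorted_part zs (Suc j) 0"
  by (simp add: sorted_part_def)

lemma sorted_part_Suc:
  "m < length zs \<Longrightarrow> sorted_part zs j (Suc m) = (if zs ! m = j then sorted_part zs j m @ [j] else sorted_part zs j m)"
  by (simp add: sorted_part_def take_Suc_conv_app_nth)

lemma mset_sorted_part: "mset (sorted_part zs j 0) = filter_mset (\<lambda>y. y < j) (mset zs)"
proof (induction j)
  case (Suc j)
  have "mset (sorted_part zs (Suc j) 0) = mset (sorted_part zs j 0) + filter_mset (\<lambda>y. y = j) (mset zs)"
    by (simp add: sorted_part_def)
  also have "\<dots> = filter_mset (\<lambda>y. y < Suc j) (mset zs)"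
    unfolding Suc.IH by (rule multiset_eqI) auto
  finally show ?case .
qed (simp add: sorted_part_def)

text \<open>This bounds the write position \<open>pos\<close> during the sort, whose value is
  charged at every increment.\<close>

lemma length_sorted_part: "length (sorted_part zs j m) \<le> length zs"
proof -
  have "size (mset (sorted_part zs j m)) =
      size (filter_mset (\<lambda>y. y < j) (mset zs)) + size (filter_mset (\<lambda>y. y = j) (mset (take m zs)))"
    unfolding mset_sorted_part[symmetric] by (simp add: sorted_part_def)
  also have "size (filter_mset (\<lambda>y. y = j) (mset (take m zs))) \<le> size (filter_mset (\<lambda>y. y = j) (mset zs))"
  proof -
    have "mset (take m zs) \<subseteq># mset zs" by (metis append_take_drop_id mset_append mset_subset_eq_add_left)
    then show ?thesis by (intro size_mset_mono multiset_filter_mono)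
  qed
  also have "size (filter_mset (\<lambda>y. y < j) (mset zs)) + size (filter_mset (\<lambda>y. y = j) (mset zs)) =
      size (filter_mset (\<lambda>y. y < Suc j) (mset zs))"
    unfolding size_union[symmetric] by (rule arg_cong[of _ _ size], rule multiset_eqI) auto
  also have "\<dots> \<le> size (mset zs)" by (rule size_filter_mset_lesseq)
  finally show ?thesis by simp
qed

lemma sorted_sorted_part: "sorted (sorted_part zs j 0)"
proof (induction j)
  case (Suc j)
  have "sorted_part zs (Suc j) 0 = sorted_part zs j 0 @ filter (\<lambda>y. y = j) zs"
    by (simp add: sorted_part_def)
  moreover have "y < j" if "y \<in> set (sorted_part zs j 0)" for y
    using that mset_sorted_part[of zs j] by (metis (no_types, lifting) mem_Collect_eq set_mset_filter set_mset_mset)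
  moreover have "sorted (filter (\<lambda>y. y = j) zs)" by (induction zs) auto
  ultimately show ?case using Suc by (fastforce simp: sorted_append)
qed (simp add: sorted_part_def)

lemma sorted_part_sort: "(\<And>y. y \<in> set zs \<Longrightarrow> y < T) \<Longrightarrow> sorted_part zs T 0 = sort zs"
  by (rule properties_for_sort[symmetric])
    (auto simp: mset_sorted_part sorted_sorted_part filter_mset_eq_conv)

definition update_matching ::
  "(nat \<Rightarrow> nat option) \<Rightarrow> (nat \<Rightarrow> nat) \<Rightarrow> nat \<Rightarrow> bool \<Rightarrow> nat set set \<Rightarrow> nat set set" where
  "update_matching L ph v b M = (case L v of None \<Rightarrow> M | Some u \<Rightarrow>
     if b \<and> ph u < ph v \<and> matching (insert {u, v} M) then insert {u, v} M else M)"

lemma present_simps [simp]: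
  "nat_mem (present v r s) = (nat_mem s)(''v'' := (nat_mem s ''v'')([] := v), ''partner'' := (nat_mem s ''partner'')([] := code r))"
  "real_mem (present v r s) = real_mem s" "samples (present v r s) = samples s"
  by (auto simp: present_def code_def)

context scheme
begin

lemma runs_sort_phases:
  assumes s: "base s" and X: "bound \<le> X" and z: "\<And>w. w < n \<Longrightarrow> nat_mem s ''Y'' [w] = z w" "\<And>w. w < n \<Longrightarrow> z w < T"
  shows "runs sort_phases s (16 * X ^ 3) (\<lambda>s'. (\<forall>i<n. nat_mem s' ''srt'' [i] = sort (map z [0..<n]) ! i) \<and>
    samples s' = samples s)"
proof -
  have X1: "n \<le> X" "T \<le> X" "1 \<le> X" using X bounds by linarith+
  then have XX: "1 \<le> X ^ 3" by simp
  let ?zs = "map z [0..<n]"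
  let ?J = "\<lambda>s'. base s' \<and> (\<forall>w<n. nat_mem s' ''Y'' [w] = z w) \<and> samples s' = samples s"
  let ?P = "\<lambda>l s'. nat_mem s' ''pos'' [] = length l \<and> (\<forall>i<length l. nat_mem s' ''srt'' [i] = l ! i)"
  let ?I = "\<lambda>j s'. ?J s' \<and> ?P (sorted_part ?zs j 0) s'"
  let ?body = "If (BAnd (BNot (NLess (cell_at ''Y'' ''w'') (N ''j''))) (BNot (NLess (N ''j'') (cell_at ''Y'' ''w''))))
          (Seq (NAssign ''srt'' [N ''pos''] (N ''j'')) (inc ''pos'')) Skip"
  have final: "sorted_part ?zs T 0 = sort ?zs" using z by (intro sorted_part_sort) auto
  show ?thesis unfolding sort_phases_def
  proof (rule runs_Seq_NAssign[where B = 1 and B' = "15 * X ^ 3"])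
    show "runs (For ''j'' (N ''T'') (For ''w'' (N ''n'') ?body))
       (set_nat ''pos'' (map (\<lambda>j. nval j s) []) (nval (NConst 0) s) s) (15 * X ^ 3)
       (\<lambda>s'. (\<forall>i<n. nat_mem s' ''srt'' [i] = sort (map z [0..<n]) ! i) \<and> samples s' = samples s)"
    proof (rule runs_mono[OF runs_For[where Inv = ?I and m = T and p = 10 and d = 2 and X = X and B = "10 * X ^ 2"]])
      show "?I T s' \<and> nat_mem s' ''j'' [] = T \<Longrightarrow>
          (\<forall>i<n. nat_mem s' ''srt'' [i] = sort (map z [0..<n]) ! i) \<and> samples s' = samples s" for s'
        unfolding final by simp
      fix j and s1 :: state assume j: "j < T" "nat_mem s1 ''j'' [] = j" "?I j s1"
      let ?K = "\<lambda>m s'. nat_mem s' ''j'' [] = j \<and> ?J s' \<and> ?P (sorted_part ?zs j m) s'"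
      show "runs (For ''w'' (N ''n'') ?body) s1 (10 * X ^ 2) (\<lambda>s'. nat_mem s' ''j'' [] = j \<and> ?I (Suc j) (set_nat ''j'' [] (Suc j) s'))"
      proof (rule runs_mono[OF runs_For[where Inv = ?K and m = n and p = 5 and d = 1 and X = X and B = "2 * X + 3"]])
        show "?K n s' \<and> nat_mem s' ''w'' [] = n \<Longrightarrow> nat_mem s' ''j'' [] = j \<and> ?I (Suc j) (set_nat ''j'' [] (Suc j) s')" for s'
          using sorted_part_next[of ?zs j] by (auto simp: base_def)
        fix m and s2 :: state assume m: "m < n" "nat_mem s2 ''w'' [] = m" "?K m s2"
        have Suc: "sorted_part ?zs j (Suc m) = (if z m = j then sorted_part ?zs j m @ [j] else sorted_part ?zs j m)"
          using m(1) by (subst sorted_part_Suc) auto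
        have len: "length (sorted_part ?zs j (Suc m)) \<le> n"
          using length_sorted_part[of ?zs j "Suc m"] by simp
        have cond: "bval (BAnd (BNot (NLess (cell_at ''Y'' ''w'') (N ''j''))) (BNot (NLess (N ''j'') (cell_at ''Y'' ''w'')))) s2 \<longleftrightarrow> z m = j"
          using m by auto
        show "runs ?body s2 (2 * X + 3) (\<lambda>s'. nat_mem s' ''w'' [] = m \<and> ?K (Suc m) (set_nat ''w'' [] (Suc m) s'))"
        proof (rule runs_If[where B = "2 * X + 2"])
          assume "bval (BAnd (BNot (NLess (cell_at ''Y'' ''w'') (N ''j''))) (BNot (NLess (N ''j'') (cell_at ''Y'' ''w'')))) s2"
          then have "z m = j" using cond by blast
          then show "runs (Seq (NAssign ''srt'' [N ''pos''] (N ''j'')) (inc ''pos'')) s2 (2 * X + 2)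
              (\<lambda>s'. nat_mem s' ''w'' [] = m \<and> ?K (Suc m) (set_nat ''w'' [] (Suc m) s'))"
            using m j X1 len unfolding Suc
            by (intro runs_Seq_NAssign[where B = "X + 1" and B' = "X + 1"] runs_NAssign)
              (auto simp: base_def nth_append less_Suc_eq)
        next
          assume "\<not> bval (BAnd (BNot (NLess (cell_at ''Y'' ''w'') (N ''j''))) (BNot (NLess (N ''j'') (cell_at ''Y'' ''w'')))) s2"
          then have "z m \<noteq> j" using cond by blast
          then show "runs Skip s2 (2 * X + 2) (\<lambda>s'. nat_mem s' ''w'' [] = m \<and> ?K (Suc m) (set_nat ''w'' [] (Suc m) s'))"
            using m unfolding Suc by (intro runs_Skip) (auto simp: base_def)
        qed simp
      qed (use X1 j in \<open>auto simp: base_def power2_eq_square\<close>)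
    qed (use s z X1 in \<open>auto simp: base_def sorted_part_def eval_nat_numeral\<close>)
  qed (use XX in auto)
qed

fun s_arrivals :: "tables \<Rightarrow> (nat \<Rightarrow> nat option) \<Rightarrow> (nat \<Rightarrow> nat) \<Rightarrow> nat list \<Rightarrow> nat set set \<Rightarrow> nat set set sampler" where
  "s_arrivals tab L ph [] M = s_ret M"
| "s_arrivals tab L ph (v # vs) M = s_bind (s_draw (accepts tab T (ph v) (L v) v))
     (\<lambda>b. s_arrivals tab L ph vs (update_matching L ph v b M))"

text \<open>\<open>vs\<close> are the vertices still to come and \<open>A\<close> those that have
  arrived. The \<open>Y\<close> cells of the former hold values left by the preprocessing, so the
  last conjunct is confined to \<open>A\<close>.\<close>

definition ready :: "tables \<Rightarrow> (nat \<Rightarrow> nat) \<Rightarrow> nat set \<Rightarrow> nat list \<Rightarrow> state \<Rightarrow> bool" where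
  "ready tab ph A vs s \<longleftrightarrow> base s \<and> nat_mem s ''k'' [] = T \<and> has_tables T tab s \<and>
     (\<forall>j<length vs. nat_mem s ''srt'' [nat_mem s ''pos'' [] + j] = ph (vs ! j)) \<and>
     nat_mem s ''pos'' [] + length vs = n \<and> (\<forall>u\<in>A. nat_mem s ''Y'' [u] = ph u)"

lemma runs_arrival:
  assumes s: "ready tab ph A (v # vs) s" and v: "v < n" "v \<notin> A" "ph v \<le> T"
    and r: "\<And>u. r = Some u \<Longrightarrow> u < n \<Longrightarrow> u \<in> A" and X: "bound \<le> X" "code r \<le> X"
  shows "runs arrival_com (present v r s) (20 * X) (\<lambda>s'. ready tab ph (insert v A) vs s' \<and>
    (nat_mem s' ''accept'' [] \<noteq> 0 \<longleftrightarrow> accepts tab T (ph v) r v (shd (samples s)) \<and> (\<exists>u. r = Some u \<and> ph u < ph v)) \<and>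
    samples s' = stl (samples s))"
proof -
  let ?b = "accepts tab T (ph v) r v (shd (samples s))"
  let ?Q = "\<lambda>s'. ready tab ph (insert v A) vs s' \<and>
    (nat_mem s' ''accept'' [] \<noteq> 0 \<longleftrightarrow> ?b \<and> (\<exists>u. r = Some u \<and> ph u < ph v)) \<and> samples s' = stl (samples s)"
  have X1: "n \<le> X" "T \<le> X" "1 \<le> X" using X bounds by linarith+
  let ?s0 = "present v r s"
  let ?s1 = "set_nat ''w'' [] v ?s0"
  let ?s2 = "set_nat ''F'' [v] (code r) ?s1"
  let ?s3 = "set_nat ''Y'' [v] (ph v) ?s2"
  let ?s4 = "set_nat ''pos'' [] (Suc (nat_mem s ''pos'' [])) ?s3"
  have srt: "nat_mem s ''srt'' [nat_mem s ''pos'' []] = ph v"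
    using s unfolding ready_def by (metis add.right_neutral length_greater_0_conv list.distinct(1) nth_Cons_0)
  have srt': "nat_mem s ''srt'' [Suc (nat_mem s ''pos'' [] + j)] = ph (vs ! j)" if "j < length vs" for j
    using s that unfolding ready_def by (metis add_Suc_right length_Cons not_less_eq nth_Cons_Suc)
  have "runs (Seq draw_coin
     (If (BAnd (NLess (NConst 0) (cell_at ''b'' ''w'')) (NLess (target_at ''Y'' ''w'') (cell_at ''Y'' ''w'')))
        (NAssign ''accept'' [] (NConst 1)) (NAssign ''accept'' [] (NConst 0)))) ?s4 7 ?Q"
  proof (rule runs_Seq_block[where B' = 3, OF runs_draw_coin[of ?s4 v T r "ph v" tab]])
    fix s5 :: state
    assume s5: "nat_mem s5 ''b'' = (nat_mem ?s4 ''b'')([v] := of_bool (accepts tab T (ph v) r v (shd (samples ?s4)))) \<and>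
        samples s5 = stl (samples ?s4)"
      and f: "\<And>a. a \<notin> nat_writes draw_coin \<Longrightarrow> nat_mem s5 a = nat_mem ?s4 a"
        "\<And>a. a \<notin> real_writes draw_coin \<Longrightarrow> real_mem s5 a = real_mem ?s4 a"
    have cond: "bval (BAnd (NLess (NConst 0) (cell_at ''b'' ''w'')) (NLess (target_at ''Y'' ''w'') (cell_at ''Y'' ''w''))) s5
        \<longleftrightarrow> ?b \<and> (\<exists>u. r = Some u \<and> ph u < ph v)"
    proof (cases r)
      case None
      then show ?thesis using s5 by (simp add: f accepts_def)
    next
      case (Some u)
      have "nat_mem s ''Y'' [u] = ph u \<and> u \<noteq> v" if ?b
        using that r[OF Some] s v Some by (auto simp: accepts_def ready_def)
      then show ?thesis using s5 Some by (auto simp: f)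
    qed
    have fin: "ready tab ph (insert v A) vs s'" if "nat_mem s' = (nat_mem s5)(''accept'' := m)" "real_mem s' = real_mem s5" for s' m
      using s v srt' that unfolding ready_def by (auto simp: base_def has_tables_def f)
    show "runs (If (BAnd (NLess (NConst 0) (cell_at ''b'' ''w'')) (NLess (target_at ''Y'' ''w'') (cell_at ''Y'' ''w'')))
        (NAssign ''accept'' [] (NConst 1)) (NAssign ''accept'' [] (NConst 0))) s5 3 ?Q"
      using cond s5 by (intro runs_If[where B = 2] runs_NAssign) (auto intro!: fin)
  qed (use s v in \<open>auto simp: ready_def base_def has_tables_def\<close>)
  moreover have "nat_mem s ''pos'' [] < n" using s by (simp add: ready_def)
  ultimately show ?thesis unfolding arrival_com_def
    apply (rule_tac B = "1 + X" and B' = "3 * X + 10" in runs_Seq_NAssign)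
      apply (rule_tac B = "1 + X" and B' = "2 * X + 9" in runs_Seq_NAssign)
        apply (rule_tac B = "1 + X" and B' = "X + 8" in runs_Seq_NAssign)
          apply (rule_tac B = "1 + X" and B' = "7" in runs_Seq_NAssign)
    using X X1 v by (simp_all add: srt)
qed

lemma select_update:
  assumes "nat_mem s ''accept'' [] \<noteq> 0 \<longleftrightarrow> b \<and> (\<exists>u. L v = Some u \<and> ph u < ph v)"
  shows "select v (L v) s M = update_matching L ph v b M"
  using assms by (auto simp: select_def update_matching_def split: option.splits)

lemma arrivals_run:
  assumes "ready tab ph A vs s" "distinct vs" "set vs \<subseteq> {..<n}" "A \<inter> set vs = {}"
    and "\<And>v. v \<in> set vs \<Longrightarrow> ph v \<le> T \<and> code (L v) \<le> X"
    and "\<And>j u. j < length vs \<Longrightarrow> L (vs ! j) = Some u \<Longrightarrow> u < n \<Longrightarrow> u \<in> A \<union> set (take j vs)"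
    and X: "bound \<le> X"
  shows "\<exists>t. arrivals arrival_com L vs s M t (fst (s_arrivals tab L ph vs M (samples s))) \<and> t \<le> length vs * (20 * X)"
  using assms(1-6)
proof (induction vs arbitrary: A s M)
  case Nil
  then show ?case using arrivals.Nil by (auto simp: s_ret_def)
next
  case (Cons v vs)
  let ?b = "accepts tab T (ph v) (L v) v (shd (samples s))"
  have "runs arrival_com (present v (L v) s) (20 * X) (\<lambda>s'. ready tab ph (insert v A) vs s' \<and>
    (nat_mem s' ''accept'' [] \<noteq> 0 \<longleftrightarrow> ?b \<and> (\<exists>u. L v = Some u \<and> ph u < ph v)) \<and> samples s' = stl (samples s))"
    using Cons.prems(6)[of 0] Cons.prems X by (intro runs_arrival) auto
  then obtain t s' where s': "exec arrival_com (present v (L v) s) t s'" "t \<le> 20 * X"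
    "ready tab ph (insert v A) vs s'" "samples s' = stl (samples s)"
    "nat_mem s' ''accept'' [] \<noteq> 0 \<longleftrightarrow> ?b \<and> (\<exists>u. L v = Some u \<and> ph u < ph v)"
    unfolding runs_def by blast
  let ?M = "update_matching L ph v ?b M"
  have "\<exists>t. arrivals arrival_com L vs s' ?M t (fst (s_arrivals tab L ph vs ?M (samples s'))) \<and> t \<le> length vs * (20 * X)"
  proof (rule Cons.IH[OF s'(3)])
    fix j u assume "j < length vs" "L (vs ! j) = Some u" "u < n"
    then show "u \<in> insert v A \<union> set (take j vs)" using Cons.prems(6)[of "Suc j" u] by auto
  qed (use Cons.prems in auto)
  then obtain t' where t': "arrivals arrival_com L vs s' ?M t' (fst (s_arrivals tab L ph vs ?M (samples s')))"
    "t' \<le> length vs * (20 * X)" by blast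
  have "arrivals arrival_com L (v # vs) s M (t + t') (fst (s_arrivals tab L ph vs ?M (samples s')))"
    using arrivals.Cons[where p = L, OF s'(1)] t'(1) select_update[where L = L, OF s'(5)] by simp
  then show ?case using s' t'(2)
    by (intro exI[of _ "t + t'"]) (simp add: s_bind_def s_draw_def)
qed

definition rank :: "nat list \<Rightarrow> nat \<Rightarrow> nat" where
  "rank vs v = the_inv_into {..<length vs} ((!) vs) v"

lemma rank_nth: "distinct vs \<Longrightarrow> i < length vs \<Longrightarrow> rank vs (vs ! i) = i"
  unfolding rank_def by (intro the_inv_into_f_f) (auto simp: inj_on_nth)

definition assigned_phase :: "(nat \<Rightarrow> nat) \<Rightarrow> nat list \<Rightarrow> nat \<Rightarrow> nat" where
  "assigned_phase z vs v = (if v < n then sort (map z [0..<n]) ! rank vs v else T)"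

definition s_run :: "(nat \<Rightarrow> nat option) \<Rightarrow> nat list \<Rightarrow> nat set set sampler" where
  "s_run L vs = s_bind (s_tables T) (\<lambda>tab. s_bind (s_order n) (\<lambda>z.
     s_arrivals tab L (assigned_phase z vs) vs {}))"

lemma writes_order [simp]:
  "nat_writes draw_order = {''Y'', ''i'', ''w''}" "real_writes draw_order = {''U''}"
  "nat_writes sort_phases = {''pos'', ''srt'', ''j'', ''w''}" "real_writes sort_phases = {}"
  "nat_writes compute_params = {''m'', ''T'', ''h'', ''R''}" "real_writes compute_params = {}"
  by (auto simp: draw_order_def sort_phases_def compute_params_def)

lemma runs_preprocess:
  fixes \<epsilon> :: real and M :: nat and \<omega> :: "real stream"
  assumes \<epsilon>: "0 < \<epsilon>" and M: "M = nat \<lceil>1 / \<epsilon>\<rceil>"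
    and params: "T = 60 * ((n + 1) * (n + 1) * M)" "h = 48 * T * ((n + 1) * (n + 1)) * (M * M)" "R = 48 * M * h"
    and X: "bound \<le> X"
  defines "tab \<equiv> fst (s_tables T \<omega>)" and "\<omega>' \<equiv> snd (s_tables T \<omega>)"
  defines "z \<equiv> fst (s_order n \<omega>')"
  shows "runs preprocess_com (initial_state n E x \<epsilon> \<omega>) (165 * X ^ 6) (\<lambda>s.
    base s \<and> nat_mem s ''k'' [] = T \<and> has_tables T tab s \<and>
    (\<forall>i<n. nat_mem s ''srt'' [i] = sort (map z [0..<n]) ! i) \<and> nat_mem s ''pos'' [] = 0 \<and>
    samples s = snd (s_order n \<omega>'))"
proof -
  have X1: "n \<le> X" "T \<le> X" "R \<le> X" "h \<le> X" "1 \<le> X" using X bounds by linarith+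
  have "M \<le> R" unfolding params(3) using h by simp
  then have MX: "M \<le> X" using X1 by linarith
  have XX: "1 \<le> X ^ 6" "X ^ 2 \<le> X ^ 6" "X ^ 3 \<le> X ^ 6" using X1 by (auto intro: power_increasing)
  let ?s = "initial_state n E x \<epsilon> \<omega>"
  let ?Q = "\<lambda>s. base s \<and> nat_mem s ''k'' [] = T \<and> has_tables T tab s \<and>
    (\<forall>i<n. nat_mem s ''srt'' [i] = sort (map z [0..<n]) ! i) \<and> nat_mem s ''pos'' [] = 0 \<and>
    samples s = snd (s_order n \<omega>')"
  have init: "nat_mem ?s ''n'' [] = n" "real_mem ?s ''eps'' [] = \<epsilon>" "real_mem ?s ''x'' [u, v] = xv u v"
    "nat_mem ?s ''cnt'' [k, u, v] = 0" "samples ?s = \<omega>" for k u v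
    by (auto simp: initial_state_def xv_def)
  show ?thesis unfolding preprocess_com_def
  proof (rule runs_Seq_block[where B = "14 * X ^ 2" and B' = "151 * X ^ 6"])
    show "runs compute_params ?s (14 * X ^ 2) (\<lambda>s'. nat_mem s' ''T'' [] = T \<and> nat_mem s' ''h'' [] = h \<and>
        nat_mem s' ''R'' [] = R \<and> samples s' = samples ?s)"
      by (rule runs_compute_params[OF \<epsilon> init(2,1) params[unfolded M] X1(2,4,3) MX[unfolded M]])
    fix s1 :: state
    assume s1: "nat_mem s1 ''T'' [] = T \<and> nat_mem s1 ''h'' [] = h \<and> nat_mem s1 ''R'' [] = R \<and> samples s1 = samples ?s"
      and f1: "\<And>a. a \<notin> nat_writes compute_params \<Longrightarrow> nat_mem s1 a = nat_mem ?s a"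
        "\<And>a. a \<notin> real_writes compute_params \<Longrightarrow> real_mem s1 a = real_mem ?s a"
    have b1: "base s1" using s1 by (simp add: base_def f1 init)
    show "runs (Seq fill_tables (Seq draw_order (Seq sort_phases (NAssign ''pos'' [] (NConst 0))))) s1 (151 * X ^ 6) ?Q"
    proof (rule runs_Seq_block[where B' = "37 * X ^ 6", OF runs_fill_tables[OF b1 X]])
      show "nat_mem s1 ''cnt'' [k, u, v] = 0" for k u v by (simp add: f1 init)
      fix s2 :: state
      assume "base s2 \<and> nat_mem s2 ''k'' [] = T \<and> has_tables T (fst (s_tables T (samples s1))) s2 \<and>
          samples s2 = snd (s_tables T (samples s1))"
      then have s2: "base s2" "nat_mem s2 ''k'' [] = T" "has_tables T tab s2" "samples s2 = \<omega>'"
        using s1 by (simp_all add: init tab_def \<omega>'_def)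
      show "runs (Seq draw_order (Seq sort_phases (NAssign ''pos'' [] (NConst 0)))) s2 (37 * X ^ 6) ?Q"
      proof (rule runs_Seq_block[where B' = "17 * X ^ 6", OF runs_draw_order[OF s2(1) X]])
        fix s3 :: state
        assume s3: "(\<forall>w<n. nat_mem s3 ''Y'' [w] = fst (s_order n (samples s2)) w) \<and> samples s3 = snd (s_order n (samples s2))"
          and f3: "\<And>a. a \<notin> nat_writes draw_order \<Longrightarrow> nat_mem s3 a = nat_mem s2 a"
            "\<And>a. a \<notin> real_writes draw_order \<Longrightarrow> real_mem s3 a = real_mem s2 a"
        have b3: "base s3" using s2(1) by (simp add: base_def f3)
        have z: "nat_mem s3 ''Y'' [w] = z w" "z w < T" if "w < n" for w
          using that s3 s2(4) s_order_less by (simp_all add: z_def)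
        show "runs (Seq sort_phases (NAssign ''pos'' [] (NConst 0))) s3 (17 * X ^ 6) ?Q"
        proof (rule runs_Seq_block[where B' = 1, OF runs_sort_phases[OF b3 X z]])
          fix s4 :: state
          assume s4: "(\<forall>i<n. nat_mem s4 ''srt'' [i] = sort (map z [0..<n]) ! i) \<and> samples s4 = samples s3"
            and f4: "\<And>a. a \<notin> nat_writes sort_phases \<Longrightarrow> nat_mem s4 a = nat_mem s3 a"
              "\<And>a. a \<notin> real_writes sort_phases \<Longrightarrow> real_mem s4 a = real_mem s3 a"
          show "runs (NAssign ''pos'' [] (NConst 0)) s4 1 ?Q"
            using s4 s3 s2 by (intro runs_NAssign) (auto simp: base_def has_tables_def f3 f4)
        qed (use XX in simp_all)
      qed (use XX in simp_all)
    qed (use XX in simp)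
  qed (use XX in simp)
qed

text \<open>This holds for every single outcome, so the output of the program can be replaced by the
  function \<open>s_run\<close> of the samples before any probability is taken.\<close>

lemma rcrs_run_exists:
  fixes \<epsilon> :: real and M :: nat
  assumes \<epsilon>: "0 < \<epsilon>" and M: "M = nat \<lceil>1 / \<epsilon>\<rceil>"
    and params: "T = 60 * ((n + 1) * (n + 1) * M)" "h = 48 * T * ((n + 1) * (n + 1)) * (M * M)" "R = 48 * M * h"
    and X: "bound \<le> X" "\<And>v. v < n \<Longrightarrow> code (learned F Y v) \<le> X"
  shows "\<exists>t. rcrs_run the_rcrs n E x \<epsilon> F Y \<omega> t
      (fst (s_run (learned F Y) (sort_key Y [0..<n]) \<omega>)) \<and> t \<le> 185 * X ^ 6"
proof -
  let ?L = "learned F Y" and ?vs = "sort_key Y [0..<n]"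
  let ?tab = "fst (s_tables T \<omega>)" and ?\<omega> = "snd (s_tables T \<omega>)"
  let ?z = "fst (s_order n ?\<omega>)"
  let ?ph = "assigned_phase ?z ?vs"
  have X1: "n \<le> X" "1 \<le> X" using X bounds by linarith+
  have vs: "distinct ?vs" "set ?vs = {..<n}" "length ?vs = n" by auto
  obtain t s where s: "exec preprocess_com (initial_state n E x \<epsilon> \<omega>) t s" "t \<le> 165 * X ^ 6"
    "base s" "nat_mem s ''k'' [] = T" "has_tables T ?tab s"
    "\<forall>i<n. nat_mem s ''srt'' [i] = sort (map ?z [0..<n]) ! i" "nat_mem s ''pos'' [] = 0"
    "samples s = snd (s_order n ?\<omega>)"
    using runs_preprocess[OF \<epsilon> M params X(1)] unfolding runs_def by blast
  have nth: "?vs ! i < n" if "i < n" for i using that vs nth_mem[of i ?vs] by simp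
  have "ready ?tab ?ph {} ?vs s"
    using s vs nth by (auto simp: ready_def assigned_phase_def rank_nth)
  moreover have "?ph v \<le> T" if "v \<in> set ?vs" for v
  proof -
    obtain i where i: "v = ?vs ! i" "i < n" using \<open>v \<in> set ?vs\<close> vs(3) by (metis in_set_conv_nth)
    then have "?ph v = sort (map ?z [0..<n]) ! i" using vs nth by (simp add: assigned_phase_def rank_nth)
    also have "\<dots> \<in> set (sort (map ?z [0..<n]))" using i by (intro nth_mem) simp
    finally have "\<exists>w<n. ?ph v = ?z w" by auto
    then show ?thesis using s_order_less[of _ n ?\<omega>] by (metis less_imp_le)
  qed
  moreover have "u \<in> {} \<union> set (take j ?vs)" if j: "j < length ?vs" "?L (?vs ! j) = Some u" "u < n" for j u
  proof -
    have "Y u < Y (?vs ! j)" using j(2) by (simp add: learned_iff)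
    obtain i where i: "i < n" "u = ?vs ! i" using j(3) vs by (metis in_set_conv_nth lessThan_iff)
    \<comment> \<open>A learned neighbour has a smaller arrival time and so stands earlier in the
      list; its assigned phase is stored by the time it is compared.\<close>
    have "i < j"
    proof (rule ccontr)
      assume "\<not> i < j"
      moreover have "sorted (map Y ?vs)" by simp
      ultimately have "map Y ?vs ! j \<le> map Y ?vs ! i" using i vs by (intro sorted_nth_mono) auto
      then show False using \<open>Y u < Y (?vs ! j)\<close> i j vs by simp
    qed
    then show ?thesis using i j vs(3) by (auto simp: in_set_conv_nth intro!: exI[of _ i])
  qed
  ultimately obtain t' where t': "arrivals arrival_com ?L ?vs s {} t'
      (fst (s_arrivals ?tab ?L ?ph ?vs {} (samples s)))" "t' \<le> length ?vs * (20 * X)"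
    using arrivals_run[of ?tab ?ph "{}" ?vs s ?L X "{}"] X vs by blast
  have "length ?vs * (20 * X) \<le> X * (20 * X)" using X1 vs(3) by (intro mult_right_mono) auto
  also have "\<dots> = 20 * X ^ 2" by (simp add: power2_eq_square)
  also have "\<dots> \<le> 20 * X ^ 6" using X1 by (intro mult_left_mono power_increasing) auto
  finally have "t + t' \<le> 185 * X ^ 6" using s(2) t'(2) by linarith
  moreover have "fst (s_run ?L ?vs \<omega>) = fst (s_arrivals ?tab ?L ?ph ?vs {} (samples s))"
    by (simp add: s_run_def s_bind_def s(8))
  ultimately show ?thesis using s(1) t'(1) unfolding rcrs_run_def the_rcrs_def by auto
qed

end

section \<open>The matching found by the scheme\<close>

fun run_coins :: "(nat \<Rightarrow> nat option) \<Rightarrow> (nat \<Rightarrow> nat) \<Rightarrow> (nat \<Rightarrow> bool) \<Rightarrow> nat list \<Rightarrow> nat set set \<Rightarrow> nat set set" where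
  "run_coins L ph b [] M = M"
| "run_coins L ph b (v # vs) M = run_coins L ph b vs (update_matching L ph v (b v) M)"

lemma run_coins_cong:
  "(\<And>v. v \<in> set vs \<Longrightarrow> L v \<noteq> None \<Longrightarrow> b v = b' v) \<Longrightarrow> run_coins L ph b vs M = run_coins L ph b' vs M"
proof (induction vs arbitrary: M)
  case (Cons v vs)
  have "update_matching L ph v (b v) M = update_matching L ph v (b' v) M"
    using Cons.prems[of v] by (cases "L v") (auto simp: update_matching_def)
  then show ?case using Cons by simp
qed simp

definition make_data :: "nat \<Rightarrow> nat \<Rightarrow> (nat \<Rightarrow> nat) \<Rightarrow> (nat \<Rightarrow> nat option) \<Rightarrow> (nat \<Rightarrow> bool) \<Rightarrow> data" where
  "make_data n T ph F b = (\<lambda>v. if v < n then (ph v, F v, b v) else absent T)"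

lemma matching_insert_iff:
  assumes "matching M" "v \<notin> \<Union>M"
  shows "matching (insert {u, v} M) \<longleftrightarrow> u \<notin> \<Union>M"
proof -
  have "\<forall>e\<in>M. {u, v} \<noteq> e" using assms(2) by auto
  moreover have "disjnt {u, v} e \<longleftrightarrow> u \<notin> e" if "e \<in> M" for e
    using that assms(2) by (auto simp: disjnt_def)
  ultimately show ?thesis
    using assms(1) unfolding matching_def pairwise_insert by (auto simp: disjnt_sym)
qed

text \<open>Since phases increase strictly along \<open>vs\<close>, the vertices covered by
  \<open>M\<close> when \<open>v\<close> is processed are exactly \<open>busy D (ph v)\<close>. The
  test that the matching stays a matching is then the test that the chosen vertex is free.\<close>

lemma run_coins_sel:
  assumes D: "D = make_data n T ph F b" and inj: "inj_on ph {..<n}" and T: "\<And>v. v < n \<Longrightarrow> ph v < T"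
    and L: "\<And>v u. v < n \<Longrightarrow> L v = Some u \<longleftrightarrow> F v = Some u \<and> ph u < ph v"
    and F: "\<And>v u. v < n \<Longrightarrow> F v = Some u \<Longrightarrow> u < n"
    and "sorted_wrt (\<lambda>v w. ph v < ph w) vs" "A \<union> set vs = {..<n}" "A \<inter> set vs = {}"
    and "\<And>a v. a \<in> A \<Longrightarrow> v \<in> set vs \<Longrightarrow> ph a < ph v"
    and "M = {{u, v} |u v k. sel D k u v \<and> v \<in> A}" "matching M"
  shows "run_coins L ph b vs M = {{u, v} |u v k. sel D k u v \<and> v < n}"
  using assms(6-)
proof (induction vs arbitrary: A M)
  case Nil
  then show ?case by auto
next
  case (Cons v vs)
  have v: "v < n" "v \<notin> A" using Cons.prems by auto
  have phase: "phase D w = ph w" "target D w = F w" "coin D w = b w" if "w < n" for w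
    using that by (auto simp: D make_data_def)
  have out: "w < n" if "phase D w < T" for w using that by (auto simp: D make_data_def split: if_splits)
  have sel_n: "w < n" if "sel D k u w" for k u w
    using that by (auto simp: sel_def D make_data_def split: if_splits)
  have earlier: "w \<in> A" if "w < n" "ph w < ph v" for w
  proof -
    have "w \<in> A \<union> set (v # vs)" using that(1) Cons.prems(2) by simp
    moreover have "w \<notin> set (v # vs)" using that(2) Cons.prems(1) by auto
    ultimately show ?thesis by blast
  qed
  have M: "\<Union>M = busy D (ph v)"
  proof
    show "\<Union>M \<subseteq> busy D (ph v)"
    proof
      fix w assume "w \<in> \<Union>M"
      then obtain u a k where a: "sel D k u a" "a \<in> A" "w = u \<or> w = a" using Cons.prems(5) by auto
      then have "k < ph v" using Cons.prems(4)[of a v] phase[of a] sel_n[OF a(1)] by (auto simp: sel_def)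
      then show "w \<in> busy D (ph v)" using a busy_iff by blast
    qed
    show "busy D (ph v) \<subseteq> \<Union>M"
    proof
      fix w assume "w \<in> busy D (ph v)"
      then obtain j u a where a: "j < ph v" "sel D j u a" "w = u \<or> w = a" by (rule busyE)
      then have "ph a < ph v" using sel_n[OF a(2)] phase[of a] by (auto simp: sel_def)
      then have "a \<in> A" using earlier sel_n[OF a(2)] by blast
      then show "w \<in> \<Union>M" using a Cons.prems(5) by blast
    qed
  qed
  have nv: "v \<notin> \<Union>M" using M busy_phase[of v D "ph v"] phase[OF v(1)] by auto
  have sel_v: "sel D k u v \<longleftrightarrow> k = ph v \<and> L v = Some u \<and> u \<notin> \<Union>M \<and> b v" for k u
  proof -
    have "phase D u = ph u" if "F v = Some u" using phase(1) F[OF v(1) that] by blast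
    then show ?thesis unfolding M using L[OF v(1), of u] phase[OF v(1)] by (auto simp: sel_def)
  qed
  let ?M = "update_matching L ph v (b v) M"
  have up: "?M = {{u, w} |u w k. sel D k u w \<and> w \<in> insert v A}"
  proof -
    have "{{u, w} |u w k. sel D k u w \<and> w \<in> insert v A} = M \<union> {{u, v} |u k. sel D k u v}"
      unfolding Cons.prems(5) by auto
    also have "\<dots> = ?M"
    proof (cases "L v")
      case None
      then show ?thesis by (auto simp: sel_v update_matching_def)
    next
      case (Some u)
      then have "ph u < ph v" using L[OF v(1)] by blast
      then show ?thesis using Some matching_insert_iff[OF Cons.prems(6) nv, of u]
        by (auto simp: sel_v update_matching_def)
    qed
    finally show ?thesis by simp
  qed
  have "matching ?M" using Cons.prems(6) by (auto simp: update_matching_def split: option.splits)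
  moreover have "ph a < ph w" if "a \<in> insert v A" "w \<in> set vs" for a w
    using that Cons.prems(1,4) by auto
  ultimately have "run_coins L ph b vs ?M = {{u, v} |u v k. sel D k u v \<and> v < n}"
    using Cons.prems v up by (intro Cons.IH[of "insert v A"]) auto
  then show ?case by simp
qed

lemma Pi_pmf_return_map:
  assumes "finite A"
  shows "Pi_pmf A d (\<lambda>v. bind_pmf (p v) (\<lambda>b. return_pmf (g v b))) =
    map_pmf (\<lambda>b v. if v \<in> A then g v (b v) else d) (Pi_pmf A d' p)"
  by (subst Pi_pmf_bind[OF assms, where d' = d'])
    (simp add: Pi_pmf_return_pmf[OF assms] map_pmf_def)

context scheme
begin

definition coins_pmf :: "tables \<Rightarrow> (nat \<Rightarrow> nat option) \<Rightarrow> (nat \<Rightarrow> nat) \<Rightarrow> nat set \<Rightarrow> (nat \<Rightarrow> bool) pmf" where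
  "coins_pmf tab F ph A = Pi_pmf A False (\<lambda>v. bernoulli_pmf (threshold tab T (ph v) (F v) v))"

text \<open>Visible edges and assigned phases are fixed before the first arrival, so coins drawn one
  after another are independent and may be drawn all at once.\<close>

lemma realises_arrivals:
  "distinct vs \<Longrightarrow> realises (s_arrivals tab L ph vs M) (map_pmf (\<lambda>b. run_coins L ph b vs M) (coins_pmf tab L ph (set vs)))"
proof (induction vs arbitrary: M)
  case Nil
  then show ?case by (simp add: coins_pmf_def realises_ret)
next
  case (Cons v vs)
  let ?p = "bernoulli_pmf (threshold tab T (ph v) (L v) v)"
  have "map_pmf (\<lambda>b. run_coins L ph b (v # vs) M) (coins_pmf tab L ph (set (v # vs))) =
      bind_pmf ?p (\<lambda>c. bind_pmf (coins_pmf tab L ph (set vs))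
        (\<lambda>b. return_pmf (run_coins L ph (b(v := c)) vs (update_matching L ph v c M))))"
    using Cons.prems unfolding coins_pmf_def
    by (simp add: Pi_pmf_insert' map_bind_pmf)
  also have "\<dots> = bind_pmf ?p (\<lambda>c. map_pmf (\<lambda>b. run_coins L ph b vs (update_matching L ph v c M)) (coins_pmf tab L ph (set vs)))"
    unfolding map_pmf_def
    by (intro bind_pmf_cong refl arg_cong[of _ _ return_pmf] run_coins_cong) (use Cons.prems in auto)
  finally show ?case
    using Cons by (auto intro!: realises_bind realises_accepts)
qed

text \<open>In the data a vertex flips a coin for its choice \<open>F v\<close> even if the chosen
  vertex arrives later, whereas the program sees no edge then and its coin fails. Masking the coins
  couples the two; \<open>run_coins_cong\<close> shows that the output stays the same.\<close>

lemma coins_learned: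
  assumes "\<And>v u. v < n \<Longrightarrow> L v = Some u \<Longrightarrow> F v = Some u"
  shows "coins_pmf tab L ph {..<n} = map_pmf (\<lambda>b v. b v \<and> L v \<noteq> None) (coins_pmf tab F ph {..<n})"
proof -
  have "coins_pmf tab L ph {..<n} = Pi_pmf {..<n} False
      (\<lambda>v. bind_pmf (bernoulli_pmf (threshold tab T (ph v) (F v) v)) (\<lambda>b. return_pmf (b \<and> L v \<noteq> None)))"
    unfolding coins_pmf_def
  proof (rule Pi_pmf_cong)
    fix v assume v: "v \<in> {..<n}"
    show "bernoulli_pmf (threshold tab T (ph v) (L v) v) =
        bind_pmf (bernoulli_pmf (threshold tab T (ph v) (F v) v)) (\<lambda>b. return_pmf (b \<and> L v \<noteq> None))"
    proof (cases "L v")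
      case None
      then show ?thesis by (simp add: threshold_def bernoulli_0)
    next
      case (Some u)
      then have "F v = Some u" using assms v by simp
      then show ?thesis using Some by (simp add: bind_return_pmf')
    qed
  qed simp_all
  also have "\<dots> = map_pmf (\<lambda>b v. if v \<in> {..<n} then b v \<and> L v \<noteq> None else False) (coins_pmf tab F ph {..<n})"
    unfolding coins_pmf_def by (rule Pi_pmf_return_map) simp
  also have "\<dots> = map_pmf (\<lambda>b v. b v \<and> L v \<noteq> None) (coins_pmf tab F ph {..<n})"
    using set_Pi_pmf_subset[of "{..<n}" False] unfolding coins_pmf_def
    by (intro map_pmf_cong refl) (fastforce simp: fun_eq_iff)
  finally show ?thesis .
qed

text \<open>Choices come first, phases next and coins last: this separates what the input draws from
  what the program draws, as required to match a run.\<close>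

lemma all_data_make:
  "all_data (threshold tab T) =
    bind_pmf (Pi_pmf {..<n} None (choice_pmf E x)) (\<lambda>F.
    bind_pmf (Pi_pmf {..<n} T (\<lambda>_. pmf_of_set {..<T})) (\<lambda>z.
    map_pmf (make_data n T z F) (coins_pmf tab F z {..<n})))"
proof -
  let ?F = "Pi_pmf {..<n} None (choice_pmf E x)" and ?Y = "Pi_pmf {..<n} T (\<lambda>_. pmf_of_set {..<T})"
  let ?b = "\<lambda>d v. bernoulli_pmf (threshold tab T (snd d) (fst d) v)"
  have "vertex_pmf (threshold tab T) v = bind_pmf (pair_pmf (choice_pmf E x v) (pmf_of_set {..<T}))
      (\<lambda>d. bind_pmf (?b d v) (\<lambda>b. return_pmf (snd d, fst d, b)))" for v
    unfolding vertex_pmf_def pair_pmf_def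
    by (subst bind_commute_pmf) (simp add: bind_assoc_pmf bind_return_pmf)
  then have v: "vertex_pmf (threshold tab T) = (\<lambda>v. bind_pmf (pair_pmf (choice_pmf E x v) (pmf_of_set {..<T}))
      (\<lambda>d. bind_pmf (?b d v) (\<lambda>b. return_pmf (snd d, fst d, b))))" by (rule ext)
  have "all_data (threshold tab T) = bind_pmf (Pi_pmf {..<n} (None, T) (\<lambda>v. pair_pmf (choice_pmf E x v) (pmf_of_set {..<T})))
      (\<lambda>d. Pi_pmf {..<n} (absent T) (\<lambda>v. bind_pmf (?b (d v) v) (\<lambda>b. return_pmf (snd (d v), fst (d v), b))))"
    unfolding data_pmf_def v by (rule Pi_pmf_bind) simp
  also have "\<dots> = bind_pmf (pair_pmf ?F ?Y)
      (\<lambda>(F, z). map_pmf (make_data n T z F) (coins_pmf tab F z {..<n}))"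
    unfolding Pi_pmf_pair[OF finite_lessThan] bind_map_pmf coins_pmf_def
    by (intro bind_pmf_cong refl, subst Pi_pmf_return_map[where d' = False])
      (auto simp: make_data_def[abs_def] case_prod_unfold cong: if_cong)
  finally show ?thesis by (simp add: pair_pmf_def bind_assoc_pmf bind_return_pmf)
qed

end

section \<open>Random orders\<close>

lemma insort_key_cong_order:
  "(\<And>y. y \<in> set ys \<Longrightarrow> f a \<le> f y \<longleftrightarrow> g a \<le> g y) \<Longrightarrow> insort_key f a ys = insort_key g a ys"
  by (induction ys) auto

lemma sort_key_cong_order:
  "(\<And>a b. a \<in> set xs \<Longrightarrow> b \<in> set xs \<Longrightarrow> f a \<le> f b \<longleftrightarrow> g a \<le> g b) \<Longrightarrow> sort_key f xs = sort_key g xs"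
proof (induction xs)
  case (Cons a xs)
  then have "sort_key f xs = sort_key g xs" by simp
  then show ?case using Cons.prems
    by (simp add: sort_key_def) (rule insort_key_cong_order, simp flip: sort_key_def)
qed simp

lemma measurable_map_list:
  fixes X :: "nat \<Rightarrow> 'a \<Rightarrow> 'b :: countable"
  assumes "\<And>i. i < m \<Longrightarrow> X i \<in> M \<rightarrow>\<^sub>M count_space UNIV"
  shows "(\<lambda>\<omega>. map (\<lambda>i. X i \<omega>) [0..<m]) \<in> M \<rightarrow>\<^sub>M count_space UNIV"
  using assms
proof (induction m)
  case (Suc m)
  have "(\<lambda>\<omega>. xs @ [X m \<omega>]) \<in> M \<rightarrow>\<^sub>M count_space UNIV" for xs
    by (rule measurable_compose[OF Suc.prems[of m]]) simp_all
  then have "(\<lambda>\<omega>. map (\<lambda>i. X i \<omega>) [0..<m] @ [X m \<omega>]) \<in> M \<rightarrow>\<^sub>M count_space UNIV"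
    by (rule measurable_compose_countable) (use Suc in simp)
  then show ?case by simp
qed simp

abbreviation times :: "nat \<Rightarrow> (nat \<Rightarrow> real) measure" where
  "times n \<equiv> \<Pi>\<^sub>M v\<in>{..<n}. uniform01"

interpretation times: product_prob_space "\<lambda>_. uniform01" "{..<n}" for n :: nat
  by unfold_locales

lemma measurable_time: "v < n \<Longrightarrow> (\<lambda>Y. Y v) \<in> borel_measurable (times n)"
  using measurable_component_singleton[of v "{..<n}" "\<lambda>_. uniform01"]
  unfolding measurable_cong_sets[OF refl sets_uniform01] by simp

lemma measurable_order [measurable]:
  "(\<lambda>Y. sort_key Y [0..<n]) \<in> times n \<rightarrow>\<^sub>M count_space UNIV"
proof -
  let ?c = "\<lambda>Y :: nat \<Rightarrow> real. map (\<lambda>i. Y (i div n) \<le> Y (i mod n)) [0..<n * n]"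
  have c: "?c \<in> times n \<rightarrow>\<^sub>M count_space UNIV"
  proof (rule measurable_map_list)
    fix i assume "i < n * n"
    then have "i div n < n" "i mod n < n" by (cases "n = 0"; simp add: less_mult_imp_div_less)+
    from borel_measurable_le[OF this[THEN measurable_time]]
    show "(\<lambda>Y. Y (i div n) \<le> Y (i mod n)) \<in> times n \<rightarrow>\<^sub>M count_space UNIV"
      unfolding pred_def .
  qed
  \<comment> \<open>The order depends on the times only through their finitely many pairwise
    comparisons, listed by \<open>?c\<close> with the pair (a, b) at index a * n + b. Any times with
    the same comparisons give the same order, so \<open>SOME\<close> may pick them.\<close>
  let ?g = "\<lambda>c. sort_key (SOME Y. ?c Y = c) [0..<n]"
  have "sort_key Y [0..<n] = ?g (?c Y)" for Y :: "nat \<Rightarrow> real"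
  proof -
    have "?c (SOME Y'. ?c Y' = ?c Y) = ?c Y" by (rule someI[where P = "\<lambda>Y'. ?c Y' = ?c Y" and x = Y]) (rule refl)
    then have *: "\<And>i. i < n * n \<Longrightarrow> (SOME Y'. ?c Y' = ?c Y) (i div n) \<le> (SOME Y'. ?c Y' = ?c Y) (i mod n) \<longleftrightarrow> Y (i div n) \<le> Y (i mod n)"
      by (simp only: map_eq_conv set_upt) simp
    show ?thesis
    proof (rule sort_key_cong_order)
      fix a b assume "a \<in> set [0..<n]" "b \<in> set [0..<n]"
      then have ab: "a < n" "b < n" by auto
      have "a * n + b < Suc a * n" using ab by simp
      also have "\<dots> \<le> n * n" using ab by (intro mult_right_mono) auto
      finally show "Y a \<le> Y b \<longleftrightarrow> (SOME Y'. ?c Y' = ?c Y) a \<le> (SOME Y'. ?c Y' = ?c Y) b"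
        using *[of "a * n + b"] ab by simp
    qed
  qed
  then show ?thesis using measurable_compose[OF c, of ?g "count_space UNIV"] by simp
qed

lemma emeasure_uniform01_singleton: "emeasure uniform01 {y} = 0"
proof -
  have "emeasure lborel ({0..1} \<inter> {y}) = 0" by (rule emeasure_lborel_countable) (simp add: countable_Int2)
  then show ?thesis by (simp add: emeasure_uniform01)
qed

lemma AE_times_neq:
  assumes "u < n" "v < n" "u \<noteq> v"
  shows "AE Y in times n. Y u \<noteq> Y v"
proof -
  let ?I = "{..<n} - {u}"
  have P: "product_sigma_finite (\<lambda>_::nat. uniform01)" by unfold_locales
  have ins: "insert u ?I = {..<n}" using assms by auto
  have set: "{Y \<in> space (times n). Y u = Y v} \<in> sets (times n)"
    using assms by (intro borel_measurable_eq measurable_time)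
  have "emeasure (times n) {Y \<in> space (times n). Y u = Y v} =
      (\<integral>\<^sup>+Y. indicator {Y \<in> space (times n). Y u = Y v} Y \<partial>times n)"
    using set by simp
  also have "\<dots> = (\<integral>\<^sup>+Y. \<integral>\<^sup>+y. indicator {Y \<in> space (times n). Y u = Y v} (Y(u := y)) \<partial>uniform01 \<partial>(\<Pi>\<^sub>M v\<in>?I. uniform01))"
    using product_sigma_finite.product_nn_integral_insert[OF P, of ?I u "indicator {Y \<in> space (times n). Y u = Y v}"] set
    unfolding ins by simp
  also have "\<dots> \<le> (\<integral>\<^sup>+Y. \<integral>\<^sup>+y. indicator {Y v} y \<partial>uniform01 \<partial>(\<Pi>\<^sub>M v\<in>?I. uniform01))"
    using assms by (intro nn_integral_mono) (auto simp: indicator_def)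
  also have "\<dots> = 0" by (simp add: emeasure_uniform01_singleton)
  finally have "emeasure (times n) {Y \<in> space (times n). Y u = Y v} = 0" by simp
  then show ?thesis using set by (intro AE_I[of _ _ "{Y \<in> space (times n). Y u = Y v}"]) auto
qed

lemma AE_times_inj: "AE Y in times n. inj_on Y {..<n}"
proof -
  have "AE Y in times n. \<forall>u\<in>{..<n}. \<forall>v\<in>{..<n}. u \<noteq> v \<longrightarrow> Y u \<noteq> Y v"
    using AE_times_neq by (intro AE_finite_allI) auto
  then show ?thesis by eventually_elim (auto simp: inj_on_def)
qed

text \<open>Both lists are sorted by the permuted times, which are distinct, and have the same
  elements.\<close>

lemma order_permute:
  fixes Y :: "nat \<Rightarrow> real"
  assumes inj: "inj_on Y {..<n}" and \<pi>: "\<pi> permutes {..<n}"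
  shows "sort_key (\<lambda>i\<in>{..<n}. Y (\<pi> i)) [0..<n] = map (inv \<pi>) (sort_key Y [0..<n])"
proof -
  let ?Y = "\<lambda>i\<in>{..<n}. Y (\<pi> i)" and ?vs = "sort_key Y [0..<n]"
  have set: "inv \<pi> ` {..<n} = {..<n}" using permutes_image[OF permutes_inv[OF \<pi>]] .
  have injY: "inj_on ?Y {..<n}"
    using inj permutes_in_image[OF \<pi>] permutes_inj[OF \<pi>]
    by (auto simp: inj_on_def dest: injD)
  have eq: "map ?Y (map (inv \<pi>) ?vs) = map Y ?vs"
    using permutes_in_image[OF permutes_inv[OF \<pi>]] permutes_inverses(1)[OF \<pi>] by auto
  show ?thesis
  proof (rule map_sorted_distinct_set_unique[of ?Y])
    have sets: "set (sort_key ?Y [0..<n]) = {..<n}" "set (map (inv \<pi>) ?vs) = {..<n}"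
      using set by (auto simp: atLeast0LessThan)
    show "inj_on ?Y (set (sort_key ?Y [0..<n]) \<union> set (map (inv \<pi>) ?vs))"
      unfolding sets using injY by simp
    show "distinct (map ?Y (sort_key ?Y [0..<n]))"
      unfolding distinct_map sets using injY by simp
    show "sorted (map ?Y (map (inv \<pi>) ?vs))" unfolding eq by simp
    show "distinct (map ?Y (map (inv \<pi>) ?vs))"
      unfolding eq using inj by (simp add: distinct_map atLeast0LessThan)
    show "set (sort_key ?Y [0..<n]) = set (map (inv \<pi>) ?vs)" unfolding sets ..
  qed simp
qed

lemma nn_integral_times_permute:
  fixes g :: "nat list \<Rightarrow> ennreal"
  assumes \<pi>: "\<pi> permutes {..<n}"
  shows "(\<integral>\<^sup>+Y. g (sort_key (\<lambda>i\<in>{..<n}. Y (\<pi> i)) [0..<n]) \<partial>times n) = (\<integral>\<^sup>+Y. g (sort_key Y [0..<n]) \<partial>times n)"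
proof -
  have d: "distr (times n) (times n) (\<lambda>Y. \<lambda>i\<in>{..<n}. Y (\<pi> i)) = times n"
    using distr_PiM_reindex[of "{..<n}" "\<lambda>_. uniform01" \<pi> "{..<n}"] permutes_inj_on[OF \<pi>]
      permutes_in_image[OF \<pi>] uniform01.prob_space_axioms by auto
  have m: "(\<lambda>Y. \<lambda>i\<in>{..<n}. Y (\<pi> i)) \<in> times n \<rightarrow>\<^sub>M times n"
    using permutes_in_image[OF \<pi>] by (intro measurable_restrict) auto
  have g: "(\<lambda>Y. g (sort_key Y [0..<n])) \<in> borel_measurable (times n)"
    by (rule measurable_compose[OF measurable_order]) simp
  have "(\<integral>\<^sup>+Y. g (sort_key Y [0..<n]) \<partial>times n) =
      (\<integral>\<^sup>+Y. g (sort_key Y [0..<n]) \<partial>distr (times n) (times n) (\<lambda>Y. \<lambda>i\<in>{..<n}. Y (\<pi> i)))"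
    by (simp only: d)
  also have "\<dots> = (\<integral>\<^sup>+Y. g (sort_key (\<lambda>i\<in>{..<n}. Y (\<pi> i)) [0..<n]) \<partial>times n)"
    by (rule nn_integral_distr[OF m]) (use g in simp)
  finally show ?thesis by simp
qed

context scheme
begin

abbreviation phases_pmf :: "(nat \<Rightarrow> nat) pmf" where
  "phases_pmf \<equiv> Pi_pmf {..<n} T (\<lambda>_. pmf_of_set {..<T})"

lemma assigned_permute:
  assumes vs: "distinct vs" "set vs = {..<n}" and \<pi>: "\<pi> permutes {..<n}"
  shows "assigned_phase z (map (inv \<pi>) vs) = assigned_phase z vs \<circ> \<pi>"
proof
  fix v
  have len: "length vs = n" using distinct_card[OF vs(1)] vs(2) by simp
  show "assigned_phase z (map (inv \<pi>) vs) v = (assigned_phase z vs \<circ> \<pi>) v"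
  proof (cases "v < n")
    case True
    then have "\<pi> v < n" using permutes_in_image[OF \<pi>, of v] by simp
    then have "\<pi> v \<in> set vs" using vs by simp
    then obtain i where i: "i < n" "vs ! i = \<pi> v" unfolding in_set_conv_nth len by blast
    have d: "distinct (map (inv \<pi>) vs)"
      using vs(1) permutes_inj[OF permutes_inv[OF \<pi>]] by (simp add: distinct_map inj_on_subset[OF _ subset_UNIV])
    have "map (inv \<pi>) vs ! i = v" using i len permutes_inverses(2)[OF \<pi>] by simp
    then have "rank (map (inv \<pi>) vs) v = i" using rank_nth[OF d, of i] i len by simp
    moreover have "rank vs (\<pi> v) = i" using rank_nth[OF vs(1), of i] i len by simp
    ultimately show ?thesis using True \<open>\<pi> v < n\<close> by (simp add: assigned_phase_def)
  next
    case False
    then show ?thesis using permutes_not_in[OF \<pi>, of v] by (simp add: assigned_phase_def)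
  qed
qed

text \<open>Sorting the phases and dealing them out by rank both permute. Which permutation results
  depends on \<open>z\<close>, but a sum over all permutations does not notice it.\<close>

lemma assigned_is_permuted:
  assumes vs: "distinct vs" "set vs = {..<n}" and z: "\<And>v. \<not> v < n \<Longrightarrow> z v = T"
  obtains \<sigma> where "\<sigma> permutes {..<n}" "assigned_phase z vs = z \<circ> \<sigma>"
proof -
  have len: "length vs = n" using distinct_card[OF vs(1)] vs(2) by simp
  obtain \<tau> where \<tau>: "\<tau> permutes {..<n}" "permute_list \<tau> (map z [0..<n]) = sort (map z [0..<n])"
    using mset_eq_permutation[of "sort (map z [0..<n])" "map z [0..<n]"] by auto
  define \<sigma> where "\<sigma> v = (if v < n then \<tau> (rank vs v) else v)" for v
  have rank_less: "rank vs v < n \<and> vs ! rank vs v = v" if "v < n" for v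
  proof -
    have "v \<in> set vs" using that vs by simp
    then obtain i where "i < n" "vs ! i = v" unfolding in_set_conv_nth len by blast
    then show ?thesis using rank_nth[OF vs(1), of i] len by auto
  qed
  have "\<sigma> permutes {..<n}"
  proof (rule inj_imp_permutes)
    show "inj_on \<sigma> {..<n}"
    proof (rule inj_onI)
      fix a b assume ab: "a \<in> {..<n}" "b \<in> {..<n}" "\<sigma> a = \<sigma> b"
      then have rank: "rank vs a = rank vs b"
        using injD[OF permutes_inj[OF \<tau>(1)]] by (auto simp: \<sigma>_def)
      have a: "vs ! rank vs a = a" and b: "vs ! rank vs b = b" using rank_less ab(1,2) by blast+
      show "a = b" by (rule box_equals[OF arg_cong[OF rank, of "(!) vs"] a b])
    qed
    show "\<sigma> v \<in> {..<n}" if "v \<in> {..<n}" for v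
      using that rank_less permutes_in_image[OF \<tau>(1)] by (auto simp: \<sigma>_def)
  qed (auto simp: \<sigma>_def)
  moreover have "assigned_phase z vs = z \<circ> \<sigma>"
  proof
    fix v
    show "assigned_phase z vs v = (z \<circ> \<sigma>) v"
    proof (cases "v < n")
      case True
      have "sort (map z [0..<n]) ! rank vs v = map z [0..<n] ! \<tau> (rank vs v)"
        using permute_list_nth[of \<tau> "map z [0..<n]" "rank vs v"] \<tau> rank_less[OF True] by simp
      also have "\<dots> = z (\<tau> (rank vs v))"
        using permutes_in_image[OF \<tau>(1), of "rank vs v"] rank_less[OF True] by simp
      finally show ?thesis using True by (simp add: assigned_phase_def \<sigma>_def)
    qed (simp add: assigned_phase_def \<sigma>_def z)
  qed
  ultimately show ?thesis by (rule that)
qed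

text \<open>
  Assigning the sorted phases according to a random order gives independent phases: both sides are
  averages over all permutations of the phases.
\<close>
lemma nn_integral_assigned:
  fixes f :: "(nat \<Rightarrow> nat) \<Rightarrow> ennreal"
  shows "(\<integral>\<^sup>+Y. \<integral>\<^sup>+z. f (assigned_phase z (sort_key Y [0..<n])) \<partial>phases_pmf \<partial>times n) = (\<integral>\<^sup>+z. f z \<partial>phases_pmf)"
proof -
  let ?S = "{\<pi>. \<pi> permutes {..<n}}"
  let ?g = "\<lambda>vs. \<integral>\<^sup>+z. f (assigned_phase z vs) \<partial>phases_pmf"
  let ?c = "of_nat (fact n) :: ennreal"
  have S: "finite ?S" "card ?S = fact n" by (auto intro: finite_permutations simp: card_permutations)
  have perm: "(\<integral>\<^sup>+z. f (z \<circ> \<pi>) \<partial>phases_pmf) = (\<integral>\<^sup>+z. f z \<partial>phases_pmf)" if "\<pi> \<in> ?S" for \<pi>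
  proof -
    have \<pi>: "\<pi> permutes {..<n}" using that by simp
    have "phases_pmf = map_pmf (\<lambda>z. z \<circ> \<pi>) phases_pmf"
      using permutes_imp_bij[OF \<pi>] permutes_in_image[OF \<pi>] by (intro Pi_pmf_bij_betw) auto
    then have "(\<integral>\<^sup>+z. f z \<partial>phases_pmf) = (\<integral>\<^sup>+z. f z \<partial>map_pmf (\<lambda>z. z \<circ> \<pi>) phases_pmf)" by simp
    then show ?thesis by simp
  qed
  have sum: "(\<Sum>\<pi>\<in>?S. ?g (map (inv \<pi>) vs)) = ?c * (\<integral>\<^sup>+z. f z \<partial>phases_pmf)" if vs: "distinct vs" "set vs = {..<n}" for vs
  proof -
    have "(\<Sum>\<pi>\<in>?S. ?g (map (inv \<pi>) vs)) = (\<Sum>\<pi>\<in>?S. \<integral>\<^sup>+z. f (assigned_phase z vs \<circ> \<pi>) \<partial>phases_pmf)"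
      using assigned_permute[OF vs] by (intro sum.cong refl) simp
    also have "\<dots> = (\<integral>\<^sup>+z. (\<Sum>\<pi>\<in>?S. f (assigned_phase z vs \<circ> \<pi>)) \<partial>phases_pmf)"
      by (rule nn_integral_sum[symmetric]) simp
    \<comment> \<open>For each \<open>z\<close>, composition with its own \<sigma> merely permutes
      the index of summation.\<close>
    also have "\<dots> = (\<integral>\<^sup>+z. (\<Sum>\<pi>\<in>?S. f (z \<circ> \<pi>)) \<partial>phases_pmf)"
    proof (rule nn_integral_cong_AE, rule AE_pmfI)
      fix z assume "z \<in> set_pmf phases_pmf"
      then have "\<And>v. \<not> v < n \<Longrightarrow> z v = T" using set_Pi_pmf_subset[OF finite_lessThan, of n T] by fastforce
      then obtain \<sigma> where \<sigma>: "\<sigma> permutes {..<n}" "assigned_phase z vs = z \<circ> \<sigma>"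
        using assigned_is_permuted[OF vs] by metis
      show "(\<Sum>\<pi>\<in>?S. f (assigned_phase z vs \<circ> \<pi>)) = (\<Sum>\<pi>\<in>?S. f (z \<circ> \<pi>))"
        using setum_permutations_compose_left[OF \<sigma>(1), of "\<lambda>\<pi>. f (z \<circ> \<pi>)"] by (simp add: \<sigma>(2) comp_assoc)
    qed
    also have "\<dots> = (\<Sum>\<pi>\<in>?S. \<integral>\<^sup>+z. f (z \<circ> \<pi>) \<partial>phases_pmf)"
      by (rule nn_integral_sum) simp
    also have "\<dots> = ?c * (\<integral>\<^sup>+z. f z \<partial>phases_pmf)" using perm S by simp
    finally show ?thesis .
  qed
  have m: "(\<lambda>Y. ?g (sort_key (\<lambda>i\<in>{..<n}. Y (\<pi> i)) [0..<n])) \<in> borel_measurable (times n)" if "\<pi> \<in> ?S" for \<pi>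
  proof (rule measurable_compose[OF _ measurable_compose[OF measurable_order]])
    show "(\<lambda>Y. \<lambda>i\<in>{..<n}. Y (\<pi> i)) \<in> times n \<rightarrow>\<^sub>M times n"
      using that permutes_in_image[of \<pi> "{..<n}"] by (intro measurable_restrict) auto
  qed simp
  have "?c * (\<integral>\<^sup>+Y. ?g (sort_key Y [0..<n]) \<partial>times n) = (\<Sum>\<pi>\<in>?S. \<integral>\<^sup>+Y. ?g (sort_key Y [0..<n]) \<partial>times n)"
    using S by simp
  also have "\<dots> = (\<Sum>\<pi>\<in>?S. \<integral>\<^sup>+Y. ?g (sort_key (\<lambda>i\<in>{..<n}. Y (\<pi> i)) [0..<n]) \<partial>times n)"
    using nn_integral_times_permute[of _ n ?g] by (intro sum.cong) auto
  also have "\<dots> = (\<integral>\<^sup>+Y. (\<Sum>\<pi>\<in>?S. ?g (sort_key (\<lambda>i\<in>{..<n}. Y (\<pi> i)) [0..<n])) \<partial>times n)"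
    by (rule nn_integral_sum[symmetric]) (rule m)
  also have "\<dots> = (\<integral>\<^sup>+Y. ?c * (\<integral>\<^sup>+z. f z \<partial>phases_pmf) \<partial>times n)"
  proof (rule nn_integral_cong_AE)
    show "AE Y in times n. (\<Sum>\<pi>\<in>?S. ?g (sort_key (\<lambda>i\<in>{..<n}. Y (\<pi> i)) [0..<n])) = ?c * (\<integral>\<^sup>+z. f z \<partial>phases_pmf)"
      using AE_times_inj
    proof eventually_elim
      fix Y :: "nat \<Rightarrow> real" assume inj: "inj_on Y {..<n}"
      have "(\<Sum>\<pi>\<in>?S. ?g (sort_key (\<lambda>i\<in>{..<n}. Y (\<pi> i)) [0..<n])) = (\<Sum>\<pi>\<in>?S. ?g (map (inv \<pi>) (sort_key Y [0..<n])))"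
        using order_permute[OF inj] by (intro sum.cong refl) simp
      also have "\<dots> = ?c * (\<integral>\<^sup>+z. f z \<partial>phases_pmf)" by (rule sum) auto
      finally show "(\<Sum>\<pi>\<in>?S. ?g (sort_key (\<lambda>i\<in>{..<n}. Y (\<pi> i)) [0..<n])) = ?c * (\<integral>\<^sup>+z. f z \<partial>phases_pmf)" .
    qed
  qed
  also have "\<dots> = ?c * (\<integral>\<^sup>+z. f z \<partial>phases_pmf)"
    by (simp add: times.P.emeasure_space_1)
  finally have "?c * (\<integral>\<^sup>+Y. ?g (sort_key Y [0..<n]) \<partial>times n) = ?c * (\<integral>\<^sup>+z. f z \<partial>phases_pmf)" .
  then show ?thesis by (simp add: ennreal_mult_cancel_left)
qed

end

text \<open>The two product constructions differ outside \<open>I\<close>, where functions are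
  \<open>undefined\<close> in one and \<open>d\<close> in the other; hence the restriction.\<close>

lemma nn_integral_PiM_pmf:
  assumes fin: "finite I" and g: "g \<in> borel_measurable (\<Pi>\<^sub>M i\<in>I. measure_pmf (p i))"
  shows "(\<integral>\<^sup>+F. g F \<partial>(\<Pi>\<^sub>M i\<in>I. measure_pmf (p i))) = (\<integral>\<^sup>+F. g (restrict F I) \<partial>Pi_pmf I d p)"
proof -
  interpret P: product_sigma_finite "\<lambda>i. measure_pmf (p i)" by unfold_locales
  let ?M = "\<Pi>\<^sub>M i\<in>I. measure_pmf (p i)"
  have m: "(\<lambda>F. restrict F I) \<in> measure_pmf (Pi_pmf I d p) \<rightarrow>\<^sub>M ?M"
    by (auto simp: space_PiM)
  have "distr (Pi_pmf I d p) ?M (\<lambda>F. restrict F I) = ?M"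
  proof (rule P.PiM_eqI[OF fin])
    fix A assume A: "\<And>i. i \<in> I \<Longrightarrow> A i \<in> sets (measure_pmf (p i))"
    have "emeasure (distr (Pi_pmf I d p) ?M (\<lambda>F. restrict F I)) (Pi\<^sub>E I A) =
        emeasure (Pi_pmf I d p) {F. restrict F I \<in> Pi\<^sub>E I A}"
      using fin A by (subst emeasure_distr[OF m]) (auto simp: vimage_def intro!: sets_PiM_I_finite)
    also have "{F. restrict F I \<in> Pi\<^sub>E I A} = Pi I A" by (auto simp: restrict_PiE_iff)
    also have "emeasure (Pi_pmf I d p) (Pi I A) = (\<Prod>i\<in>I. emeasure (p i) (A i))"
      using measure_Pi_pmf_Pi[OF fin, of d p A]
      by (simp add: measure_pmf.emeasure_eq_measure prod_ennreal)
    finally show "emeasure (distr (Pi_pmf I d p) ?M (\<lambda>F. restrict F I)) (Pi\<^sub>E I A) = (\<Prod>i\<in>I. emeasure (p i) (A i))" .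
  qed simp
  then have "(\<integral>\<^sup>+F. g F \<partial>?M) = (\<integral>\<^sup>+F. g F \<partial>distr (Pi_pmf I d p) ?M (\<lambda>F. restrict F I))" by simp
  also have "\<dots> = (\<integral>\<^sup>+F. g (restrict F I) \<partial>Pi_pmf I d p)"
    by (rule nn_integral_distr[OF m]) (use g in simp)
  finally show ?thesis .
qed

lemma nn_integral_pmf_swap:
  "(\<integral>\<^sup>+a. \<integral>\<^sup>+b. f a b \<partial>measure_pmf q \<partial>measure_pmf p) = (\<integral>\<^sup>+b. \<integral>\<^sup>+a. f a b \<partial>measure_pmf p \<partial>measure_pmf q)"
proof -
  have "(\<integral>\<^sup>+a. \<integral>\<^sup>+b. f a b \<partial>measure_pmf q \<partial>measure_pmf p) = (\<integral>\<^sup>+z. f (fst z) (snd z) \<partial>pair_pmf p q)"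
    by (simp add: nn_integral_pair_pmf')
  also have "\<dots> = (\<integral>\<^sup>+z. f (snd z) (fst z) \<partial>pair_pmf q p)"
    by (subst pair_commute_pmf) (simp add: case_prod_unfold)
  finally show ?thesis by (simp add: nn_integral_pair_pmf')
qed

section \<open>The output as an event of the arrival space\<close>

context scheme
begin

text \<open>\<open>learned\<close> cut off outside the vertex set. It is determined by a list of n
  values, which makes the output measurable; the output is the same because \<open>accepts\<close>
  refuses targets that are not vertices.\<close>

definition seen :: "(nat \<Rightarrow> nat option) \<Rightarrow> (nat \<Rightarrow> real) \<Rightarrow> nat \<Rightarrow> nat option" where
  "seen F Y v = (case F v of None \<Rightarrow> None | Some u \<Rightarrow> if u < n \<and> v < n \<and> Y u < Y v then Some u else None)"

lemma s_arrivals_cong: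
  "(\<And>v. v \<in> set vs \<Longrightarrow> L v = L' v \<or> (L' v = None \<and> (\<exists>u. L v = Some u \<and> \<not> u < n))) \<Longrightarrow>
   s_arrivals tab L ph vs M = s_arrivals tab L' ph vs M"
proof (induction vs arbitrary: M)
  case (Cons v vs)
  have IH: "s_arrivals tab L ph vs M = s_arrivals tab L' ph vs M" for M
    using Cons by simp
  show ?case
  proof (cases "L v = L' v")
    case True
    then show ?thesis by (simp add: IH update_matching_def)
  next
    case False
    then obtain u where u: "L' v = None" "L v = Some u" "\<not> u < n" using Cons.prems[of v] by auto
    then have "accepts tab T (ph v) (L v) v = (\<lambda>t. False)" "accepts tab T (ph v) (L' v) v = (\<lambda>t. False)"
      by (auto simp: accepts_def)
    moreover have "update_matching L ph v False M = M" "update_matching L' ph v False M = M"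
      by (auto simp: update_matching_def split: option.splits)
    ultimately show ?thesis by (simp add: IH s_bind_def s_draw_def)
  qed
qed simp

lemma s_run_seen: "s_run (learned F Y) (sort_key Y [0..<n]) = s_run (seen F Y) (sort_key Y [0..<n])"
proof -
  have "s_arrivals tab (learned F Y) ph (sort_key Y [0..<n]) M = s_arrivals tab (seen F Y) ph (sort_key Y [0..<n]) M"
    for tab ph M
    by (rule s_arrivals_cong) (auto simp: seen_def learned_def split: option.splits)
  then show ?thesis by (simp only: s_run_def)
qed

definition run_pmf :: "(nat \<Rightarrow> nat option) \<Rightarrow> nat list \<Rightarrow> nat set set pmf" where
  "run_pmf L vs = bind_pmf (tables_pmf T) (\<lambda>tab. bind_pmf phases_pmf (\<lambda>z.
     map_pmf (\<lambda>b. run_coins L (assigned_phase z vs) b vs {}) (coins_pmf tab L (assigned_phase z vs) (set vs))))"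

lemma realises_run: "distinct vs \<Longrightarrow> realises (s_run L vs) (run_pmf L vs)"
  unfolding s_run_def run_pmf_def
  by (intro realises_bind realises_tables realises_order realises_arrivals)

text \<open>Arrival times and assigned phases are both injective and both increase along the order
  of arrival, so they order the vertices alike. A choice is therefore visible exactly if the chosen
  vertex has the smaller phase, as \<open>run_coins_sel\<close> requires.\<close>

lemma run_coins_selects:
  assumes F: "\<And>v u. v < n \<Longrightarrow> F v = Some u \<Longrightarrow> u < n" and Y: "inj_on Y {..<n}" and z: "\<And>v. v < n \<Longrightarrow> z v < T"
    and selects: "selects u v (make_data n T (assigned_phase z (sort_key Y [0..<n])) F b)"
  shows "{u, v} \<in> run_coins (seen F Y) (assigned_phase z (sort_key Y [0..<n])) b (sort_key Y [0..<n]) {}"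
proof -
  let ?vs = "sort_key Y [0..<n]" and ?l = "sort (map z [0..<n])"
  let ?ph = "assigned_phase z ?vs"
  let ?D = "make_data n T ?ph F b"
  have vs: "distinct ?vs" "set ?vs = {..<n}" "length ?vs = n" by auto
  have inj: "inj_on ?ph {..<n}"
  proof -
    have "?ph w = phase ?D w" if "w < n" for w using that by (simp add: make_data_def)
    then show ?thesis using selects unfolding selects_def inj_on_def by auto
  qed
  have nth: "?vs ! i < n" if "i < n" for i using that vs nth_mem[of i ?vs] by simp
  have ph: "?ph (?vs ! i) = ?l ! i" if "i < n" for i
    using that vs nth by (simp add: assigned_phase_def rank_nth)
  have index: "\<exists>i<n. w = ?vs ! i" if "w < n" for w
  proof -
    have "w \<in> set ?vs" using that vs by simp
    then show ?thesis unfolding in_set_conv_nth vs(3) by blast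
  qed
  have neq: "?vs ! i \<noteq> ?vs ! j" if "i < j" "j < n" for i j
    using that vs by (simp add: nth_eq_iff_index_eq)
  have less: "?ph (?vs ! i) < ?ph (?vs ! j)" "Y (?vs ! i) < Y (?vs ! j)" if ij: "i < j" "j < n" for i j
  proof -
    have "?l ! i \<le> ?l ! j" using ij by (intro sorted_nth_mono) auto
    moreover have "?ph (?vs ! i) \<noteq> ?ph (?vs ! j)"
      using inj_on_eq_iff[OF inj] neq[OF ij] nth[of i] nth[of j] ij by simp
    ultimately show "?ph (?vs ! i) < ?ph (?vs ! j)" using ph ij by simp
    have "map Y ?vs ! i \<le> map Y ?vs ! j" using ij vs by (intro sorted_nth_mono) auto
    moreover have "Y (?vs ! i) \<noteq> Y (?vs ! j)"
      using inj_on_eq_iff[OF Y] neq[OF ij] nth[of i] nth[of j] ij by simp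
    ultimately show "Y (?vs ! i) < Y (?vs ! j)" using ij vs by simp
  qed
  have order: "Y a < Y c \<longleftrightarrow> ?ph a < ?ph c" if ac: "a < n" "c < n" for a c
  proof -
    obtain i j where ij: "i < n" "a = ?vs ! i" "j < n" "c = ?vs ! j" using index ac by metis
    then show ?thesis using less[of i j] less[of j i] by (cases i j rule: linorder_cases) auto
  qed
  have phT: "?ph w < T" if "w < n" for w
  proof -
    obtain i where i: "i < n" "w = ?vs ! i" using index[OF \<open>w < n\<close>] by blast
    have "?l ! i \<in> set ?l" using i by (intro nth_mem) simp
    then show ?thesis using ph[OF i(1)] i z by auto
  qed
  have run: "run_coins (seen F Y) ?ph b ?vs {} = {{u, v} |u v k. sel ?D k u v \<and> v < n}"
  proof (rule run_coins_sel[where F = F and T = T and A = "{}"])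
    show "seen F Y v = Some u \<longleftrightarrow> F v = Some u \<and> ?ph u < ?ph v" if "v < n" for u v
      using F[OF that] order[OF _ that] that by (auto simp: seen_def split: option.splits)
    show "sorted_wrt (\<lambda>v w. ?ph v < ?ph w) ?vs" using less vs by (simp add: sorted_wrt_iff_nth_less)
  qed (use inj phT F vs in \<open>auto simp: matching_def\<close>)
  have less_n: "w < n" if "sel ?D k a w" for k a w
    using that by (auto simp: sel_def make_data_def split: if_splits)
  obtain k a w where kaw: "{u, v} = {a, w}" "sel ?D k a w"
    using selects unfolding selects_def by (auto simp: insert_commute)
  show ?thesis
    unfolding run mem_Collect_eq by (intro exI conjI) (rule kaw(1), rule kaw(2), rule less_n[OF kaw(2)])
qed

definition selects_prob :: "tables \<Rightarrow> (nat \<Rightarrow> nat option) \<Rightarrow> nat \<Rightarrow> nat \<Rightarrow> (nat \<Rightarrow> nat) \<Rightarrow> ennreal" where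
  "selects_prob tab F u v ph = emeasure (coins_pmf tab F ph {..<n}) {b. selects u v (make_data n T ph F b)}"

abbreviation good_tables :: "tables set" where
  "good_tables \<equiv> {tab. \<forall>k<T. good_row tab k}"

lemma run_pmf_ge:
  assumes F: "\<And>v u. v < n \<Longrightarrow> F v = Some u \<Longrightarrow> u < n" and Y: "inj_on Y {..<n}"
  shows "(\<integral>\<^sup>+tab. indicator good_tables tab *
      (\<integral>\<^sup>+z. selects_prob tab F u v (assigned_phase z (sort_key Y [0..<n])) \<partial>phases_pmf) \<partial>tables_pmf T)
    \<le> emeasure (run_pmf (seen F Y) (sort_key Y [0..<n])) {M. {u, v} \<in> M}"
proof -
  let ?vs = "sort_key Y [0..<n]" and ?L = "seen F Y"
  have "indicator good_tables tab * (\<integral>\<^sup>+z. selects_prob tab F u v (assigned_phase z ?vs) \<partial>phases_pmf) \<le>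
      (\<integral>\<^sup>+z. emeasure (map_pmf (\<lambda>b. run_coins ?L (assigned_phase z ?vs) b ?vs {})
         (coins_pmf tab ?L (assigned_phase z ?vs) (set ?vs))) {M. {u, v} \<in> M} \<partial>phases_pmf)" for tab
  proof -
    have "(\<integral>\<^sup>+z. selects_prob tab F u v (assigned_phase z ?vs) \<partial>phases_pmf) \<le>
      (\<integral>\<^sup>+z. emeasure (map_pmf (\<lambda>b. run_coins ?L (assigned_phase z ?vs) b ?vs {})
         (coins_pmf tab ?L (assigned_phase z ?vs) (set ?vs))) {M. {u, v} \<in> M} \<partial>phases_pmf)"
    proof (rule nn_integral_mono_AE, rule AE_pmfI)
      fix z assume "z \<in> set_pmf phases_pmf"
      then have z: "z v < T" if "v < n" for v
        using that T by (auto simp: set_Pi_pmf PiE_dflt_def set_phase)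
      let ?ph = "assigned_phase z ?vs"
      have sub: "coins_pmf tab ?L ?ph {..<n} = map_pmf (\<lambda>b v. b v \<and> ?L v \<noteq> None) (coins_pmf tab F ?ph {..<n})"
        by (rule coins_learned) (auto simp: seen_def split: option.splits if_splits)
      have cong: "run_coins ?L ?ph (\<lambda>v. b v \<and> ?L v \<noteq> None) ?vs {} = run_coins ?L ?ph b ?vs {}" for b
        by (rule run_coins_cong) auto
      have vs: "set ?vs = {..<n}" by auto
      have "map_pmf (\<lambda>b. run_coins ?L ?ph b ?vs {}) (coins_pmf tab ?L ?ph (set ?vs)) =
          map_pmf (\<lambda>b. run_coins ?L ?ph b ?vs {}) (coins_pmf tab F ?ph {..<n})"
        unfolding vs sub map_pmf_comp cong ..
      then have "emeasure (map_pmf (\<lambda>b. run_coins ?L ?ph b ?vs {}) (coins_pmf tab ?L ?ph (set ?vs))) {M. {u, v} \<in> M} =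
          emeasure (coins_pmf tab F ?ph {..<n}) {b. {u, v} \<in> run_coins ?L ?ph b ?vs {}}"
        by (simp only: emeasure_map_pmf vimage_def mem_Collect_eq)
      moreover have "selects_prob tab F u v ?ph \<le> emeasure (coins_pmf tab F ?ph {..<n}) {b. {u, v} \<in> run_coins ?L ?ph b ?vs {}}"
        unfolding selects_prob_def
        by (rule emeasure_mono) (use run_coins_selects[OF F Y z] in auto)
      ultimately show "selects_prob tab F u v ?ph \<le>
          emeasure (map_pmf (\<lambda>b. run_coins ?L ?ph b ?vs {}) (coins_pmf tab ?L ?ph (set ?vs))) {M. {u, v} \<in> M}" by simp
    qed
    then show ?thesis by (simp add: indicator_def)
  qed
  then show ?thesis unfolding run_pmf_def emeasure_bind_pmf by (intro nn_integral_mono)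
qed

lemma integral_selects_prob:
  "(\<integral>\<^sup>+F. \<integral>\<^sup>+z. selects_prob tab F u v z \<partial>phases_pmf \<partial>Pi_pmf {..<n} None (choice_pmf E x)) =
    emeasure (all_data (threshold tab T)) {D. selects u v D}"
  unfolding all_data_make by (simp add: selects_prob_def vimage_def)

abbreviation choices :: "(nat \<Rightarrow> nat option) measure" where
  "choices \<equiv> \<Pi>\<^sub>M v\<in>{..<n}. measure_pmf (choice_pmf E x v)"

definition chosen_event :: "nat \<Rightarrow> nat \<Rightarrow> ((nat \<Rightarrow> nat option) \<times> (nat \<Rightarrow> real) \<times> real stream) set" where
  "chosen_event u v = {p \<in> space (arrival_space n E x).
     {u, v} \<in> fst (s_run (seen (fst p) (fst (snd p))) (sort_key (fst (snd p)) [0..<n]) (snd (snd p)))}"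

lemma measurable_seen:
  assumes i: "i < n"
  shows "(\<lambda>p. seen (fst p) (fst (snd p)) i) \<in> arrival_space n E x \<rightarrow>\<^sub>M count_space UNIV"
proof -
  have F: "(\<lambda>p. fst p i) \<in> arrival_space n E x \<rightarrow>\<^sub>M count_space UNIV"
  proof -
    have "(\<lambda>F. F i) \<in> choices \<rightarrow>\<^sub>M count_space UNIV"
      using measurable_component_singleton[of i "{..<n}" "\<lambda>v. measure_pmf (choice_pmf E x v)"] i
      unfolding measurable_cong_sets[OF refl sets_measure_pmf_count_space] by simp
    then show ?thesis unfolding arrival_space_def by (rule measurable_compose[OF measurable_fst])
  qed
  have Y: "(\<lambda>p. fst (snd p) w) \<in> borel_measurable (arrival_space n E x)" if "w < n" for w
    unfolding arrival_space_def
    by (rule measurable_compose[OF measurable_compose[OF measurable_snd measurable_fst] measurable_time[OF that]])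
  have "(\<lambda>p. case r of None \<Rightarrow> None | Some u \<Rightarrow> if u < n \<and> i < n \<and> fst (snd p) u < fst (snd p) i then Some u else None)
      \<in> arrival_space n E x \<rightarrow>\<^sub>M count_space UNIV" for r
  proof (cases "\<exists>u. r = Some u \<and> u < n")
    case True
    then obtain u where "r = Some u" "u < n" by blast
    moreover have "Measurable.pred (arrival_space n E x) (\<lambda>p. fst (snd p) u < fst (snd p) i)"
      using Y[OF \<open>u < n\<close>] Y[OF i] by (rule borel_measurable_pred_less)
    ultimately show ?thesis using i by (simp add: measurable_If)
  next
    case False
    then have "(\<lambda>p. case r of None \<Rightarrow> None | Some u \<Rightarrow>
        if u < n \<and> i < n \<and> fst (snd p) u < fst (snd p) i then Some u else None) =
        (\<lambda>p :: (nat \<Rightarrow> nat option) \<times> (nat \<Rightarrow> real) \<times> real stream. None)"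
      by (auto simp: fun_eq_iff split: option.splits)
    then show ?thesis by simp
  qed
  from measurable_compose_countable[OF this F] show ?thesis by (simp add: seen_def)
qed

text \<open>Choices and arrival times enter through two variables with countably many values, the
  list of visible edges and the order of arrival. For fixed values the event concerns the samples
  alone, where \<open>realises\<close> gives measurability.\<close>

lemma sets_chosen_event: "chosen_event u v \<in> sets (arrival_space n E x)"
proof -
  let ?A = "arrival_space n E x"
  let ?L = "\<lambda>ls v. if v < n then ls ! v else None"
  let ?ls = "\<lambda>p. map (\<lambda>i. seen (fst p) (fst (snd p)) i) [0..<n]" and ?vs = "\<lambda>p. sort_key (fst (snd p)) [0..<n]"
  \<comment> \<open>\<open>distinct vs\<close> is included because \<open>realises_run\<close>
    assumes it; every order that occurs satisfies it.\<close>
  let ?P = "\<lambda>ls vs p. distinct vs \<and> {u, v} \<in> fst (s_run (?L ls) vs (snd (snd p)))"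
  have P: "?P ls vs \<in> ?A \<rightarrow>\<^sub>M count_space UNIV" for ls vs
  proof (cases "distinct vs")
    case True
    have "{\<omega>. fst (s_run (?L ls) vs \<omega>) \<in> {M. {u, v} \<in> M}} \<in> sets sample_space"
      by (rule realises_emeasure(1)[OF realises_run[OF True]])
    then have "(\<lambda>\<omega>. {u, v} \<in> fst (s_run (?L ls) vs \<omega>)) \<in> sample_space \<rightarrow>\<^sub>M count_space UNIV"
      by (simp add: pred_def)
    then have "(\<lambda>p. {u, v} \<in> fst (s_run (?L ls) vs (snd (snd p)))) \<in> ?A \<rightarrow>\<^sub>M count_space UNIV"
      unfolding arrival_space_def
      by (rule measurable_compose[OF measurable_compose[OF measurable_snd measurable_snd]])
    then show ?thesis using True by simp
  qed simp
  have vs: "?vs \<in> ?A \<rightarrow>\<^sub>M count_space UNIV"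
    unfolding arrival_space_def
    by (rule measurable_compose[OF measurable_compose[OF measurable_snd measurable_fst] measurable_order])
  have ls: "?ls \<in> ?A \<rightarrow>\<^sub>M count_space UNIV" by (rule measurable_map_list) (rule measurable_seen)
  have L: "?L (?ls p) = seen (fst p) (fst (snd p))" for p
    by (auto simp: seen_def fun_eq_iff split: option.splits)
  have "(\<lambda>p. ?P (?ls p) (?vs p) p) \<in> ?A \<rightarrow>\<^sub>M count_space UNIV"
    by (rule measurable_compose_countable[OF measurable_compose_countable[OF P vs] ls])
  then have "(\<lambda>p. {u, v} \<in> fst (s_run (seen (fst p) (fst (snd p))) (?vs p) (snd (snd p)))) \<in> ?A \<rightarrow>\<^sub>M count_space UNIV"
    unfolding L by simp
  then show ?thesis unfolding chosen_event_def pred_def .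
qed

end

context scheme
begin

lemma choices_prob_space: "prob_space choices"
  by (intro prob_space_PiM measure_pmf.prob_space_axioms)

lemma seen_restrict: "seen (restrict F {..<n}) Y = seen F Y"
  by (auto simp: seen_def fun_eq_iff restrict_def xv_outside split: option.splits)

lemma emeasure_chosen:
  "emeasure (arrival_space n E x) (chosen_event u v) =
    (\<integral>\<^sup>+F. \<integral>\<^sup>+Y. emeasure (run_pmf (seen F Y) (sort_key Y [0..<n])) {M. {u, v} \<in> M} \<partial>times n
       \<partial>Pi_pmf {..<n} None (choice_pmf E x))"
proof -
  let ?run = "\<lambda>F Y. emeasure (run_pmf (seen F Y) (sort_key Y [0..<n])) {M. {u, v} \<in> M}"
  interpret Q: pair_prob_space "times n" sample_space by unfold_locales
  interpret C: prob_space choices by (rule choices_prob_space)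
  interpret A: pair_prob_space choices "times n \<Otimes>\<^sub>M sample_space" by unfold_locales
  let ?i = "indicator (chosen_event u v) :: _ \<Rightarrow> ennreal"
  have arr: "arrival_space n E x = choices \<Otimes>\<^sub>M (times n \<Otimes>\<^sub>M sample_space)" by (simp add: arrival_space_def)
  have i: "?i \<in> borel_measurable (choices \<Otimes>\<^sub>M (times n \<Otimes>\<^sub>M sample_space))"
    using sets_chosen_event[of u v] unfolding arr by simp
  have inner: "(\<integral>\<^sup>+q. ?i (F, q) \<partial>(times n \<Otimes>\<^sub>M sample_space)) = (\<integral>\<^sup>+Y. ?run F Y \<partial>times n)" if F: "F \<in> space choices" for F
  proof -
    have m: "(\<lambda>q. ?i (F, q)) \<in> borel_measurable (times n \<Otimes>\<^sub>M sample_space)"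
      using measurable_compose[OF measurable_Pair1'[OF F] i] by simp
    have "(\<integral>\<^sup>+q. ?i (F, q) \<partial>(times n \<Otimes>\<^sub>M sample_space)) = (\<integral>\<^sup>+Y. \<integral>\<^sup>+\<omega>. ?i (F, Y, \<omega>) \<partial>sample_space \<partial>times n)"
      by (rule sample_space.nn_integral_fst[OF m, symmetric])
    also have "\<dots> = (\<integral>\<^sup>+Y. ?run F Y \<partial>times n)"
    proof (rule nn_integral_cong)
      fix Y assume Y: "Y \<in> space (times n)"
      have sp: "space sample_space = UNIV" by (simp add: space_stream_space)
      have "?i (F, Y, \<omega>) = indicator {\<omega>. fst (s_run (seen F Y) (sort_key Y [0..<n]) \<omega>) \<in> {M. {u, v} \<in> M}} \<omega>" for \<omega>
        using F Y sp by (auto simp: chosen_event_def arr space_pair_measure indicator_def)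
      then show "(\<integral>\<^sup>+\<omega>. ?i (F, Y, \<omega>) \<partial>sample_space) = ?run F Y"
        using realises_emeasure[OF realises_run[of "sort_key Y [0..<n]" "seen F Y"], of "{M. {u, v} \<in> M}"] by simp
    qed
    finally show ?thesis .
  qed
  have "emeasure (arrival_space n E x) (chosen_event u v) = (\<integral>\<^sup>+p. ?i p \<partial>(choices \<Otimes>\<^sub>M (times n \<Otimes>\<^sub>M sample_space)))"
    using sets_chosen_event[of u v] by (simp add: arr)
  also have "\<dots> = (\<integral>\<^sup>+F. \<integral>\<^sup>+q. ?i (F, q) \<partial>(times n \<Otimes>\<^sub>M sample_space) \<partial>choices)"
    by (rule Q.nn_integral_fst[OF i, symmetric])
  also have "\<dots> = (\<integral>\<^sup>+F. \<integral>\<^sup>+q. ?i (restrict F {..<n}, q) \<partial>(times n \<Otimes>\<^sub>M sample_space) \<partial>Pi_pmf {..<n} None (choice_pmf E x))"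
    by (rule nn_integral_PiM_pmf) (use Q.borel_measurable_nn_integral_fst[OF i] in auto)
  also have "\<dots> = (\<integral>\<^sup>+F. \<integral>\<^sup>+Y. ?run F Y \<partial>times n \<partial>Pi_pmf {..<n} None (choice_pmf E x))"
    by (intro nn_integral_cong) (simp add: inner space_PiM seen_restrict)
  finally show ?thesis .
qed

text \<open>For fixed tables and choices the order of arrival is averaged first. By
  \<open>nn_integral_assigned\<close> this replaces the assigned phases by independent ones, and
  averaging over the choices then gives the law \<open>all_data\<close>. Inaccurate tables are
  discarded.\<close>

lemma prob_chosen_ge:
  assumes c: "\<And>tab. tab \<in> good_tables \<Longrightarrow> c \<le> emeasure (all_data (threshold tab T)) {D. selects u v D}"
  shows "c * emeasure (tables_pmf T) good_tables \<le> emeasure (arrival_space n E x) (chosen_event u v)"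
proof -
  let ?P = "Pi_pmf {..<n} None (choice_pmf E x)"
  let ?g = "\<lambda>tab F Y. \<integral>\<^sup>+z. selects_prob tab F u v (assigned_phase z (sort_key Y [0..<n])) \<partial>phases_pmf"
  let ?i = "\<lambda>tab. indicator good_tables tab :: ennreal"
  have swap: "(\<integral>\<^sup>+Y. \<integral>\<^sup>+tab. ?i tab * ?g tab F Y \<partial>tables_pmf T \<partial>times n) =
      (\<integral>\<^sup>+tab. ?i tab * (\<integral>\<^sup>+z. selects_prob tab F u v z \<partial>phases_pmf) \<partial>tables_pmf T)" for F
  proof -
    interpret S: pair_sigma_finite "times n" "tables_pmf T" by unfold_locales
    have m: "(\<lambda>(Y, tab). ?i tab * ?g tab F Y) \<in> borel_measurable (times n \<Otimes>\<^sub>M tables_pmf T)"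
    proof -
      let ?G = "\<lambda>vs p. ?i (snd p) * (\<integral>\<^sup>+z. selects_prob (snd p) F u v (assigned_phase z vs) \<partial>phases_pmf)"
      let ?H = "\<lambda>vs tab. ?i tab * (\<integral>\<^sup>+z. selects_prob tab F u v (assigned_phase z vs) \<partial>phases_pmf)"
      have "?H vs \<in> tables_pmf T \<rightarrow>\<^sub>M borel" for vs by simp
      from measurable_compose[OF measurable_snd this]
      have "?G vs \<in> borel_measurable (times n \<Otimes>\<^sub>M tables_pmf T)" for vs .
      then have "(\<lambda>p. ?G (sort_key (fst p) [0..<n]) p) \<in> borel_measurable (times n \<Otimes>\<^sub>M tables_pmf T)"
        by (rule measurable_compose_countable[where f = ?G and g = "\<lambda>p. sort_key (fst p) [0..<n]"])
          (rule measurable_compose[OF measurable_fst measurable_order])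
      then show ?thesis unfolding case_prod_unfold .
    qed
    have mY: "(\<lambda>Y. ?g tab F Y) \<in> borel_measurable (times n)" for tab
      by (rule measurable_compose[OF measurable_order, where g =
            "\<lambda>vs. \<integral>\<^sup>+z. selects_prob tab F u v (assigned_phase z vs) \<partial>phases_pmf"]) simp
    have "(\<integral>\<^sup>+Y. \<integral>\<^sup>+tab. ?i tab * ?g tab F Y \<partial>tables_pmf T \<partial>times n) = (\<integral>\<^sup>+tab. \<integral>\<^sup>+Y. ?i tab * ?g tab F Y \<partial>times n \<partial>tables_pmf T)"
      by (rule S.Fubini'[OF m, symmetric])
    also have "\<dots> = (\<integral>\<^sup>+tab. ?i tab * (\<integral>\<^sup>+z. selects_prob tab F u v z \<partial>phases_pmf) \<partial>tables_pmf T)"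
      by (simp add: nn_integral_cmult[OF mY] nn_integral_assigned)
    finally show ?thesis .
  qed
  have "c * emeasure (tables_pmf T) good_tables = (\<integral>\<^sup>+tab. c * ?i tab \<partial>tables_pmf T)"
    by (simp add: nn_integral_cmult)
  also have "\<dots> \<le> (\<integral>\<^sup>+tab. \<integral>\<^sup>+F. ?i tab * (\<integral>\<^sup>+z. selects_prob tab F u v z \<partial>phases_pmf) \<partial>?P \<partial>tables_pmf T)"
    by (intro nn_integral_mono) (auto simp: integral_selects_prob indicator_def intro!: c)
  also have "\<dots> = (\<integral>\<^sup>+F. \<integral>\<^sup>+tab. ?i tab * (\<integral>\<^sup>+z. selects_prob tab F u v z \<partial>phases_pmf) \<partial>tables_pmf T \<partial>?P)"
    by (rule nn_integral_pmf_swap)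
  also have "\<dots> = (\<integral>\<^sup>+F. \<integral>\<^sup>+Y. \<integral>\<^sup>+tab. ?i tab * ?g tab F Y \<partial>tables_pmf T \<partial>times n \<partial>?P)"
    by (simp only: swap)
  also have "\<dots> \<le> (\<integral>\<^sup>+F. \<integral>\<^sup>+Y. emeasure (run_pmf (seen F Y) (sort_key Y [0..<n])) {M. {u, v} \<in> M} \<partial>times n \<partial>?P)"
  proof (rule nn_integral_mono_AE, rule AE_pmfI)
    fix F assume "F \<in> set_pmf ?P"
    then have F: "w < n" if "v < n" "F v = Some w" for v w
      using that choice_support[of v "Some w" w] xv_outside(1)[of w v]
      by (auto simp: set_Pi_pmf PiE_dflt_def)
    show "(\<integral>\<^sup>+Y. \<integral>\<^sup>+tab. ?i tab * ?g tab F Y \<partial>tables_pmf T \<partial>times n)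
        \<le> (\<integral>\<^sup>+Y. emeasure (run_pmf (seen F Y) (sort_key Y [0..<n])) {M. {u, v} \<in> M} \<partial>times n)"
    proof (rule nn_integral_mono_AE)
      show "AE Y in times n. (\<integral>\<^sup>+tab. ?i tab * ?g tab F Y \<partial>tables_pmf T) \<le>
          emeasure (run_pmf (seen F Y) (sort_key Y [0..<n])) {M. {u, v} \<in> M}"
        using AE_times_inj by eventually_elim (rule run_pmf_ge[OF F])
    qed
  qed
  also have "\<dots> = emeasure (arrival_space n E x) (chosen_event u v)" by (rule emeasure_chosen[symmetric])
  finally show ?thesis .
qed

lemma prob_chosen:
  assumes g: "odd_girth E x = g" and gg: "g = \<infinity> \<or> (\<exists>k. g = enat k \<and> odd k \<and> 3 \<le> k)" and uv: "0 < xv u v" and T2: "2 \<le> T"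
    and nonneg: "0 \<le> alpha g - 8 / T - 8 * h / R - 2 * (real n)\<^sup>2 / T"
  shows "xv u v * (alpha g - 8 / T - 8 * h / R - 2 * (real n)\<^sup>2 / T) * (1 - T * ((real n)\<^sup>2 * (R / (real h)\<^sup>2)))
    \<le> measure (arrival_space n E x) (chosen_event u v)"
proof -
  let ?c = "xv u v * (alpha g - 8 / T - 8 * h / R - 2 * (real n)\<^sup>2 / T)"
  have c0: "0 \<le> ?c" using nonneg uv by simp
  interpret Q: pair_prob_space "times n" sample_space by unfold_locales
  interpret C: prob_space choices by (rule choices_prob_space)
  interpret A: pair_prob_space choices "times n \<Otimes>\<^sub>M sample_space" by unfold_locales
  interpret Ar: prob_space "arrival_space n E x" unfolding arrival_space_def by (rule A.prob_space_axioms)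
  have "ennreal ?c * emeasure (tables_pmf T) good_tables \<le> emeasure (arrival_space n E x) (chosen_event u v)"
  proof (rule prob_chosen_ge)
    fix tab assume "tab \<in> good_tables"
    then have "?c \<le> measure_pmf.prob (all_data (threshold tab T)) {D. selects u v D}"
      by (intro prob_selects[OF _ g gg uv T2]) auto
    then show "ennreal ?c \<le> emeasure (all_data (threshold tab T)) {D. selects u v D}"
      by (simp add: measure_pmf.emeasure_eq_measure ennreal_leI)
  qed
  then have "?c * measure_pmf.prob (tables_pmf T) good_tables \<le> measure (arrival_space n E x) (chosen_event u v)"
    using c0 by (simp add: measure_pmf.emeasure_eq_measure Ar.emeasure_eq_measure ennreal_mult[symmetric])
  moreover have "1 - T * ((real n)\<^sup>2 * (R / (real h)\<^sup>2)) \<le> measure_pmf.prob (tables_pmf T) good_tables"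
  proof -
    have "measure_pmf.prob (tables_pmf T) {tab. \<not> (\<forall>k<T. good_row tab k)} = 1 - measure_pmf.prob (tables_pmf T) good_tables"
      using measure_pmf.prob_compl[of good_tables "tables_pmf T"]
      unfolding Compl_eq_Diff_UNIV[symmetric] by (simp only: Collect_neg_eq[symmetric] space_measure_pmf Compl_eq_Diff_UNIV[symmetric] sets_measure_pmf UNIV_I)
    then show ?thesis using prob_bad_tables[of T] by linarith
  qed
  ultimately show ?thesis using mult_left_mono[OF _ c0] order_trans by blast
qed

end

section \<open>Selectability and running time for the chosen parameters\<close>

context scheme
begin

lemma selectable_the_rcrs:
  fixes \<epsilon> :: real and M :: nat
  assumes \<epsilon>: "0 < \<epsilon>" "\<epsilon> < 1" and M: "M = nat \<lceil>1 / \<epsilon>\<rceil>"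
    and params: "T = 60 * ((n + 1) * (n + 1) * M)" "h = 48 * T * ((n + 1) * (n + 1)) * (M * M)" "R = 48 * M * h"
    and g: "odd_girth E x = g" and gg: "g = \<infinity> \<or> (\<exists>k. g = enat k \<and> odd k \<and> 3 \<le> k)"
  shows "selectable the_rcrs n E x \<epsilon> ((1 - \<epsilon>)\<^sup>2 * alpha g)"
proof -
  let ?A = "arrival_space n E x"
  let ?err = "8 / T + 8 * h / R + 2 * (real n)\<^sup>2 / T"
  define N where "N = (real n + 1) * (real n + 1)"
  have M0: "0 < M" and M\<epsilon>: "1 / M \<le> \<epsilon>"
  proof -
    have "0 < 1 / \<epsilon>" using \<epsilon> by simp
    then have "1 / \<epsilon> \<le> M" and M0: "0 < M" unfolding M by linarith+
    show "0 < M" by (rule M0)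
    then show "1 / M \<le> \<epsilon>" using \<open>1 / \<epsilon> \<le> M\<close> \<epsilon> by (simp add: field_simps)
  qed
  have T2: "2 \<le> T" using M0 by (simp add: params(1))
  have N: "(real n)\<^sup>2 \<le> N" "1 \<le> N" "8 + 2 * (real n)\<^sup>2 \<le> 8 * N" by (auto simp: N_def power2_eq_square algebra_simps)
  have pT: "real T = 60 * (N * M)" and ph: "real h = 48 * T * N * (real M * M)" and pR: "real R = 48 * M * h"
    unfolding params N_def by (simp_all add: algebra_simps)
  \<comment> \<open>The chance of inaccurate tables, which accounts for one of the two factors 1 -
    \<epsilon>.\<close>
  have bad: "T * ((real n)\<^sup>2 * (R / (real h)\<^sup>2)) \<le> \<epsilon>"
  proof -
    have "T * ((real n)\<^sup>2 * (R / (real h)\<^sup>2)) = 48 * M * T * (real n)\<^sup>2 / h"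
      using h by (simp add: pR power2_eq_square)
    also have "\<dots> = (real n)\<^sup>2 / (N * M)"
      using M0 N T by (simp add: ph field_simps)
    also have "\<dots> \<le> 1 / M" using M0 N by (simp add: field_simps)
    finally show ?thesis using M\<epsilon> by linarith
  qed
  \<comment> \<open>Discretisation with ties, and the margin of the estimates, contribute at most
    \<open>1 / (6 * M)\<close> each; \<open>alpha_ge\<close> makes their sum a fraction \<epsilon>
    of \<open>alpha g\<close>, which is the other factor.\<close>
  have err: "?err \<le> \<epsilon> * alpha g"
  proof -
    have "8 / T + 2 * (real n)\<^sup>2 / T = (8 + 2 * (real n)\<^sup>2) / (60 * (N * M))" by (simp add: pT add_divide_distrib)
    also have "\<dots> \<le> (8 * N) / (60 * (N * M))" using M0 N by (intro divide_right_mono) auto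
    also have "\<dots> \<le> 1 / (6 * M)" using M0 N by (simp add: field_simps)
    finally have "8 / T + 2 * (real n)\<^sup>2 / T \<le> 1 / (6 * M)" .
    moreover have "8 * h / R = 1 / (6 * M)" using h M0 by (simp add: pR field_simps)
    ultimately have "?err \<le> 1 / M * (1 / 3)" by (simp add: field_simps)
    also have "\<dots> \<le> \<epsilon> * alpha g" using M\<epsilon> \<epsilon> alpha_ge[OF gg] by (intro mult_mono) auto
    finally show ?thesis .
  qed
  have event: "\<P>((F, Y, \<omega>) in ?A. \<exists>t M. rcrs_run the_rcrs n E x \<epsilon> F Y \<omega> t M \<and> {u, v} \<in> M) =
      measure ?A (chosen_event u v)" for u v
  proof -
    have "(\<exists>t Ma. rcrs_run the_rcrs n E x \<epsilon> F Y \<omega> t Ma \<and> {u, v} \<in> Ma) \<longleftrightarrow>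
        {u, v} \<in> fst (s_run (seen F Y) (sort_key Y [0..<n]) \<omega>)" for F Y \<omega>
    proof -
      \<comment> \<open>The event ranges over all outcomes, including null ones in which
        \<open>F v\<close> is not a vertex. Adding the codes makes the cost bound applicable to
        these too; here only the existence of a run matters.\<close>
      let ?X = "bound + (\<Sum>v<n. code (learned F Y v))"
      have X: "code (learned F Y v) \<le> ?X" if "v < n" for v
        using member_le_sum[of v "{..<n}" "\<lambda>v. code (learned F Y v)"] that by simp
      obtain t where "rcrs_run the_rcrs n E x \<epsilon> F Y \<omega> t (fst (s_run (learned F Y) (sort_key Y [0..<n]) \<omega>))"
        using rcrs_run_exists[OF \<epsilon>(1) M params le_add1 X] by blast
      then show ?thesis using rcrs_run_deterministic unfolding s_run_seen by blast
    qed
    then show ?thesis unfolding chosen_event_def by (intro arg_cong[where f = "measure ?A"]) auto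
  qed
  show ?thesis unfolding selectable_def
  proof
    fix e assume e: "e \<in> E"
    then obtain u v where uv: "e = {u, v}" using graph unfolding graph_def by blast
    have xe: "x e = xv u v" using e uv by (simp add: xv_def)
    have "(1 - \<epsilon>)\<^sup>2 * alpha g * xv u v \<le> measure ?A (chosen_event u v)"
    proof (cases "xv u v = 0")
      case False
      then have pos: "0 < xv u v" using xv_nonneg[of u v] by simp
      have \<alpha>: "0 \<le> (1 - \<epsilon>) * alpha g" using \<epsilon> alpha_ge[OF gg] by simp
      have le: "(1 - \<epsilon>) * alpha g \<le> alpha g - 8 / T - 8 * h / R - 2 * (real n)\<^sup>2 / T"
        using err by (simp add: algebra_simps)
      have "(1 - \<epsilon>)\<^sup>2 * alpha g * xv u v = xv u v * ((1 - \<epsilon>) * alpha g) * (1 - \<epsilon>)"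
        by (simp add: power2_eq_square algebra_simps)
      also have "\<dots> \<le> xv u v * (alpha g - 8 / T - 8 * h / R - 2 * (real n)\<^sup>2 / T) *
          (1 - T * ((real n)\<^sup>2 * (R / (real h)\<^sup>2)))"
        using le bad pos \<alpha> \<epsilon> by (intro mult_mono mult_left_mono mult_nonneg_nonneg) auto
      also have "\<dots> \<le> measure ?A (chosen_event u v)"
        using le \<alpha> by (intro prob_chosen[OF g gg pos T2]) linarith
      finally show ?thesis .
    qed simp
    then show "(1 - \<epsilon>)\<^sup>2 * alpha g * x e \<le>
        \<P>((F, Y, \<omega>) in ?A. \<exists>t M. rcrs_run the_rcrs n E x \<epsilon> F Y \<omega> t M \<and> e \<in> M)"
      unfolding xe unfolding uv event .
  qed
qed

end

lemma scheme_params: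
  fixes \<epsilon> :: real and M :: nat
  assumes "graph n E" "fractional_matching n E x" "0 < \<epsilon>" "M = nat \<lceil>1 / \<epsilon>\<rceil>"
    and "T = 60 * ((n + 1) * (n + 1) * M)" "h = 48 * T * ((n + 1) * (n + 1)) * (M * M)" "R = 48 * M * h"
  shows "scheme n E x T R h"
proof -
  have "0 < M" using assms(3,4) by simp
  then show ?thesis using assms(1,2,5-7) by unfold_locales auto
qed

lemma polynomial_time_the_rcrs: "polynomial_time the_rcrs"
proof -
  \<comment> \<open>With P the input measure below, n + 1, T, h and R are at most P, 120 P^3, 23040
    P^7 and 2211840 P^8; their coefficients sum to 2235001, rounded up here. The exponent 48 is 8 *
    6, as a run takes at most 185 X^6 steps.\<close>
  define c :: nat where "c = 2300000"
  have "\<exists>t Ma. rcrs_run the_rcrs n E x \<epsilon> F Y \<omega> t Ma \<and>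
      real t \<le> real (185 * c ^ 6) * (real n + real (card E) + 1 / \<epsilon>) ^ 48"
    if \<epsilon>: "0 < \<epsilon>" "\<epsilon> < 1" and graph: "graph n E" and fm: "fractional_matching n E x"
      and F: "\<forall>v<n. \<forall>u. F v = Some u \<longrightarrow> u \<in> neighbours E v"
    for \<epsilon> :: real and n E x F Y \<omega>
  proof -
    define M where "M = nat \<lceil>1 / \<epsilon>\<rceil>"
    define T where "T = 60 * ((n + 1) * (n + 1) * M)"
    define h where "h = 48 * T * ((n + 1) * (n + 1)) * (M * M)"
    define R where "R = 48 * M * h"
    define P where "P = real n + real (card E) + 1 / \<epsilon>"
    interpret scheme n E x T R h using scheme_params[OF graph fm \<epsilon>(1) M_def T_def h_def R_def] .
    have \<epsilon>1: "1 < 1 / \<epsilon>" using \<epsilon> by simp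
    have P: "1 \<le> P" "real n + 1 \<le> P" using \<epsilon>1 unfolding P_def by linarith+
    have "real M \<le> 1 / \<epsilon> + 1" using \<epsilon>1 unfolding M_def by linarith
    moreover have "1 / \<epsilon> \<le> P" by (simp add: P_def)
    ultimately have M: "real M \<le> 2 * P" using P by linarith
    have T: "real T \<le> 120 * P ^ 3"
    proof -
      have "real T = 60 * ((real n + 1) * (real n + 1) * M)" by (simp add: T_def algebra_simps)
      also have "\<dots> \<le> 60 * (P * P * (2 * P))" using P M by (intro mult_mono mult_left_mono) auto
      finally show ?thesis by (simp add: power3_eq_cube)
    qed
    have h: "real h \<le> 23040 * P ^ 7"
    proof -
      have "real h = 48 * T * ((real n + 1) * (real n + 1)) * (real M * M)" by (simp add: h_def algebra_simps)
      also have "\<dots> \<le> 48 * (120 * P ^ 3) * (P * P) * ((2 * P) * (2 * P))"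
        using P M T by (intro mult_mono mult_nonneg_nonneg) auto
      finally show ?thesis by (simp add: power3_eq_cube power_numeral_reduce mult_ac)
    qed
    have R: "real R \<le> 2211840 * P ^ 8"
    proof -
      have "real R = 48 * real M * h" by (simp add: R_def)
      also have "\<dots> \<le> 48 * (2 * P) * (23040 * P ^ 7)" using P M h by (intro mult_mono mult_nonneg_nonneg) auto
      finally show ?thesis by (simp add: power_numeral_reduce mult_ac)
    qed
    have "P ^ 1 \<le> P ^ 8" "P ^ 3 \<le> P ^ 8" "P ^ 7 \<le> P ^ 8" using P by (intro power_increasing; simp)+
    then have bound: "real bound \<le> c * P ^ 8"
      using P T h R unfolding bound_def c_def by simp
    have code: "code (learned F Y v) \<le> bound" if "v < n" for v
    proof -
      have "u < n" if "learned F Y v = Some u" for u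
        using that F \<open>v < n\<close> edge_less[of u v] by (auto simp: learned_def neighbours_def split: option.splits if_splits)
      then show ?thesis using bounds by (cases "learned F Y v") (auto simp: Suc_le_eq intro: less_le_trans)
    qed
    obtain t where t: "rcrs_run the_rcrs n E x \<epsilon> F Y \<omega> t (fst (s_run (learned F Y) (sort_key Y [0..<n]) \<omega>))"
      "t \<le> 185 * bound ^ 6"
      using rcrs_run_exists[OF \<epsilon>(1) M_def T_def h_def R_def order_refl code] by blast
    have "real t \<le> real (185 * bound ^ 6)" using t(2) by (simp only: of_nat_le_iff)
    also have "\<dots> = 185 * real bound ^ 6" by simp
    also have "\<dots> \<le> 185 * (c * P ^ 8) ^ 6" using bound by (intro mult_left_mono power_mono) auto
    also have "\<dots> = real (185 * c ^ 6) * P ^ 48" by (simp add: power_mult_distrib power_mult[symmetric])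
    finally show ?thesis using t(1) unfolding P_def by blast
  qed
  then show ?thesis unfolding polynomial_time_def by blast
qed

theorem theorem1:
  shows "\<exists>S :: rcrs. polynomial_time S \<and>
    (\<forall>\<epsilon>::real. 0 < \<epsilon> \<and> \<epsilon> < 1 \<longrightarrow>
      (\<forall>(g::enat) (n::nat) (E::nat set set) (x::nat set \<Rightarrow> real).
        (g = \<infinity> \<or> (\<exists>k. g = enat k \<and> odd k \<and> 3 \<le> k)) \<and>
        graph n E \<and> odd_girth E x = g \<and> fractional_matching n E x \<longrightarrow>
        selectable S n E x \<epsilon> ((1 - \<epsilon>)\<^sup>2 * alpha g)))"
proof (intro exI[of _ the_rcrs] conjI allI impI polynomial_time_the_rcrs; elim conjE)
  fix \<epsilon> :: real and g n E x
  assume \<epsilon>: "0 < \<epsilon>" "\<epsilon> < 1" and g: "g = \<infinity> \<or> (\<exists>k. g = enat k \<and> odd k \<and> 3 \<le> k)" "odd_girth E x = g"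
    and "graph n E" "fractional_matching n E x"
  then show "selectable the_rcrs n E x \<epsilon> ((1 - \<epsilon>)\<^sup>2 * alpha g)"
    by (intro scheme.selectable_the_rcrs[OF scheme_params[OF _ _ \<epsilon>(1) refl refl refl refl] \<epsilon> refl refl refl refl g(2,1)])
qed

end
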